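(* Let $\varphi:\mathcal M\to\mathbb R$ be measurable, write $\varphi_\omega:=\varphi(\omega,\cdot)$, and suppose that $\int_{M_\omega}\varphi_\omega\,d\mu_\omega=0$ for $\mathbb P$-a.e. $\omega\in\Omega$, that $\varphi_\omega$ is Lipschitz for $\mathbb P$-a.e. $\omega\in\Omega$, and that $\omega\mapsto\|\varphi_\omega\|_{\mathrm{Lip}}$ belongs to $L^r(\Omega,\mathcal F,\mathbb P)$ for some $r>0$. Suppose that the decay condition holds with $\mathcal I=\{2s\}$, where $2s\ge2$, with exponent $p>0$, and that $\sum_{n=1}^\infty a_{2s,n}<+\infty$. Suppose that for $\mathbb P$-a.e. $\omega\in\Omega$ and all $\delta>0$, $$\Big\|\sum_{j=0}^{n-1}(H_{\omega,j}\circ T_\omega^j)^2-\sum_{j=0}^{n-1}\mathbb E_{\sigma^j\omega}[(H_{\omega,j})^2]\Big\|_{L^s(\mu_\omega)}^s=O\big(n^{s/2+2s/p+2s/r+A+\delta}\big)$$ for some $A\ge1$. Let $\Phi(t)$ be the standard normal distribution function. Then for $\mathbb P$-a.e. $\omega\in\Omega$ and every $\delta>0$, $$\sup_{t\in\mathbb R}\big|\mu_\omega(S_n^\omega\varphi\le t\,\Sigma_{\omega,n})-\Phi(t)\big|=O\Big(n^{-\frac{s}{2(2s+1)}+\frac{2s}{p(2s+1)}+\frac{2s}{r(2s+1)}+\frac{A}{2s+1}+\delta}\Big),$$ where $S_n^\omega\varphi:=\sum_{k=0}^{n-1}\varphi_{\sigma^k\omega}\circ T_\omega^k$ and $\Sigma_{\omega,n}^2:=\int_{M_\omega}\big(\sum_{k=0}^{n-1}\varphi_{\sigma^k\omega}\circ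 T_\omega^k\big)^2\,d\mu_\omega$.
   Context: Setting: $(\Omega,\mathcal F,\mathbb P,\sigma)$ is an ergodic probability-preserving system. $M$ is a metric space and $M_\omega\subset M$, $\omega\in\Omega$, are closed subsets such that $\mathcal M:=\{(\omega,x):\omega\in\Omega,\ x\in M_\omega\}\in\mathcal F\otimes\mathcal B(M)$, where $\mathcal B(M)$ is the Borel $\sigma$-algebra of $M$. The maps $T_\omega:M_\omega\to M_{\sigma\omega}$ are such that $(\omega,x)\mapsto T_\omega(x)$ is measurable; $T_\omega^n:=T_{\sigma^{n-1}\omega}\circ\cdots\circ T_{\sigma\omega}\circ T_\omega$, $T_\omega^0=\mathrm{Id}$. $\mu_\omega$ are Borel probability measures on $M_\omega$ with $(T_\omega)_*\mu_\omega=\mu_{\sigma\omega}$ for $\mathbb P$-a.e. $\omega$, such that $\omega\mapsto\mu_\omega(\mathcal C_\omega)$ is measurable for every measurable $\mathcal C\subset\mathcal M$, where $\mathcal C_\omega=\{x\in M_\omega:(\omega,x)\in\mathcal C\}$. $\mathbb E_\omega$ denotes expectation with respect to $\mu_\omega$. $L_\omega$ is the transfer operator of $T_\omega$ with respect to these measures: $\int_{M_\omega}g\cdot(f\circ T_\omega)\,d\mu_\omega=\int_{M_{\sigma\omega}}(L_\omega g)f\,d\mu_{\sigma\omega}$ for bounded measurable $g:M_\omega\to\mathbb R$, $f:M_{\sigma\omega}\to\mathbb R$; $L_\omega^n=L_{\sigma^{n-1}\omega}\circ\cdots\circ L_{\sigma\omega}\circ L_\omega$, $L_\omega^0=\mathrm{Id}$.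 $\|\cdot\|_{\mathrm{Lip}}$ is the usual Lipschitz norm and $[g]_\omega:=g-\mu_\omega(g)$. Decay condition (with finite set $\mathcal I\subset(0,\infty)$ and exponent $p>0$): there are a random variable $K\in L^p(\Omega,\mathcal F,\mathbb P)$ and, for each $u\in\mathcal I$, a decreasing sequence $(a_{u,n})_n$ of positive numbers converging to $0$ such that for $\mathbb P$-a.e. $\omega$, every $u\in\mathcal I$, all integers $0\le r'\le i\le j$ and all Lipschitz $g_1:M_{\sigma^{r'}\omega}\to\mathbb R$, $g_2:M_{\sigma^i\omega}\to\mathbb R$, $$\big\|\big[L_{\sigma^i\omega}^{j-i}\big(g_2\,L_{\sigma^{r'}\omega}^{i-r'}(g_1)\big)\big]_{\sigma^j\omega}\big\|_{L^u(\mu_{\sigma^j\omega})}\le K(\sigma^i\omega)\,a_{u,j-i}\,(1+\|g_1\|_{\mathrm{Lip}})(1+\|g_2\|_{\mathrm{Lip}}).$$ Martingale part: for $n\ge0$, $G_{\omega,n}:=\sum_{j=0}^{n-1}L_{\sigma^j\omega}^{n-j}(\varphi_{\sigma^j\omega})$ (so $G_{\omega,0}=0$) and $H_{\omega,n}:=\varphi_{\sigma^n\omega}+G_{\omega,n}-G_{\omega,n+1}\circ T_{\sigma^n\omega}$. The $O(\cdot)$ are as $n\to\infty$, with constants that may depend on $\omega$ and $\delta$.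
   Formalization: The formal theorem additionally assumes that for P-a.e. ω there is c>0 (depending on ω) with Σ_{ω,n}^2 ≥ c n for all large n; without it the claim fails, e.g. for φ = 0 with one-point fibres and large s, p, r. *)

theory Defs
  imports "HOL-Probability.Probability"
begin

(* M \<omega> is the fibre over \<omega> inside the ambient metric space (the type 'm); \<mu> \<omega> lives on the
   Borel subspace M \<omega>.  No invertibility of \<sigma> or of the T \<omega> is assumed. *)

definition ergodic_pps :: "'w measure \<Rightarrow> ('w \<Rightarrow> 'w) \<Rightarrow> bool" where
  "ergodic_pps P \<sigma> \<longleftrightarrow>
     prob_space P \<and> \<sigma> \<in> measurable P P \<and> distr P P \<sigma> = P \<and>
     (\<forall>A\<in>sets P. \<sigma> -` A \<inter> space P = A \<longrightarrow> measure P A = 0 \<or> measure P A = 1)"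

definition bdd_measurable :: "'m measure \<Rightarrow> ('m \<Rightarrow> real) \<Rightarrow> bool" where
  "bdd_measurable N g \<longleftrightarrow> g \<in> borel_measurable N \<and> bounded (g ` space N)"

(* The transfer operator is determined only up to null sets.  Any choice of representatives is
   allowed, as long as bounded functions get bounded representatives, so that iterates make sense. *)
definition is_transfer_operator ::
    "'m measure \<Rightarrow> 'm measure \<Rightarrow> ('m \<Rightarrow> 'm) \<Rightarrow> (('m \<Rightarrow> real) \<Rightarrow> 'm \<Rightarrow> real) \<Rightarrow> bool" where
  "is_transfer_operator N N' F \<L> \<longleftrightarrow>
     (\<forall>g. bdd_measurable N g \<longrightarrow>
        bdd_measurable N' (\<L> g) \<and>
        (\<forall>f. bdd_measurable N' f \<longrightarrow>
           (\<integral>x. g x * f (F x) \<partial>N) = (\<integral>y. \<L> g y * f y \<partial>N')))"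

locale fibred_system =
  fixes P :: "'w measure"
    and \<sigma> :: "'w \<Rightarrow> 'w"
    and M :: "'w \<Rightarrow> 'm::metric_space set"
    and T :: "'w \<Rightarrow> 'm \<Rightarrow> 'm"
    and \<mu> :: "'w \<Rightarrow> 'm measure"
    and L :: "'w \<Rightarrow> ('m \<Rightarrow> real) \<Rightarrow> 'm \<Rightarrow> real"
  assumes base: "ergodic_pps P \<sigma>"
    and fibre_closed: "\<And>\<omega>. \<omega> \<in> space P \<Longrightarrow> closed (M \<omega>)"
    and total_measurable: "Sigma (space P) M \<in> sets (P \<Otimes>\<^sub>M borel)"
    and T_maps: "\<And>\<omega>. \<omega> \<in> space P \<Longrightarrow> T \<omega> \<in> M \<omega> \<rightarrow> M (\<sigma> \<omega>)"
    and T_measurable: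
      "(\<lambda>(\<omega>, x). T \<omega> x) \<in> measurable (restrict_space (P \<Otimes>\<^sub>M borel) (Sigma (space P) M)) borel"
    and mu_prob: "\<And>\<omega>. \<omega> \<in> space P \<Longrightarrow> prob_space (\<mu> \<omega>)"
    and mu_sets: "\<And>\<omega>. \<omega> \<in> space P \<Longrightarrow> sets (\<mu> \<omega>) = sets (restrict_space borel (M \<omega>))"
    and mu_equivariant: "AE \<omega> in P. distr (\<mu> \<omega>) (\<mu> (\<sigma> \<omega>)) (T \<omega>) = \<mu> (\<sigma> \<omega>)"
    and mu_measurable: "\<And>C. C \<in> sets (P \<Otimes>\<^sub>M borel) \<Longrightarrow> C \<subseteq> Sigma (space P) M \<Longrightarrow>
      (\<lambda>\<omega>. measure (\<mu> \<omega>) {x \<in> M \<omega>. (\<omega>, x) \<in> C}) \<in> borel_measurable P"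
    and L_transfer: "AE \<omega> in P. is_transfer_operator (\<mu> \<omega>) (\<mu> (\<sigma> \<omega>)) (T \<omega>) (L \<omega>)"

primrec T_iter :: "('w \<Rightarrow> 'w) \<Rightarrow> ('w \<Rightarrow> 'm \<Rightarrow> 'm) \<Rightarrow> 'w \<Rightarrow> nat \<Rightarrow> 'm \<Rightarrow> 'm" where
  "T_iter \<sigma> T \<omega> 0 = id"
| "T_iter \<sigma> T \<omega> (Suc n) = T ((\<sigma> ^^ n) \<omega>) \<circ> T_iter \<sigma> T \<omega> n"

primrec L_iter :: "('w \<Rightarrow> 'w) \<Rightarrow> ('w \<Rightarrow> ('m \<Rightarrow> real) \<Rightarrow> 'm \<Rightarrow> real) \<Rightarrow>
    'w \<Rightarrow> nat \<Rightarrow> ('m \<Rightarrow> real) \<Rightarrow> 'm \<Rightarrow> real" where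
  "L_iter \<sigma> L \<omega> 0 = id"
| "L_iter \<sigma> L \<omega> (Suc n) = L ((\<sigma> ^^ n) \<omega>) \<circ> L_iter \<sigma> L \<omega> n"

(* Membership in L^p as a space of almost-everywhere classes. *)
definition in_Lp :: "'a measure \<Rightarrow> real \<Rightarrow> ('a \<Rightarrow> real) \<Rightarrow> bool" where
  "in_Lp N p f \<longleftrightarrow> (\<exists>h\<in>borel_measurable N. (AE x in N. f x = h x) \<and>
                       integrable N (\<lambda>x. \<bar>h x\<bar> powr p))"

(* Only applied below to functions that are bounded and measurable on space N (for almost every
   \<omega>), so the integral never takes its default value 0. *)
definition Lp_norm :: "'a measure \<Rightarrow> real \<Rightarrow> ('a \<Rightarrow> real) \<Rightarrow> real" where
  "Lp_norm N u f = (\<integral>x. \<bar>f x\<bar> powr u \<partial>N) powr (1 / u)"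

(* Lipschitz functions are those of finite Lipschitz norm, hence bounded as well. *)
definition lipschitz_fun :: "'m::metric_space set \<Rightarrow> ('m \<Rightarrow> real) \<Rightarrow> bool" where
  "lipschitz_fun S g \<longleftrightarrow> bounded (g ` S) \<and> (\<exists>C. C-lipschitz_on S g)"

(* The diagonal contributes 0 / 0 = 0 to the second supremum. *)
definition lip_norm :: "'m::metric_space set \<Rightarrow> ('m \<Rightarrow> real) \<Rightarrow> real" where
  "lip_norm S g = (SUP x\<in>S. \<bar>g x\<bar>) + (SUP (x, y)\<in>S \<times> S. \<bar>g x - g y\<bar> / dist x y)"

definition centered :: "'m measure \<Rightarrow> ('m \<Rightarrow> real) \<Rightarrow> 'm \<Rightarrow> real" where
  "centered N g = (\<lambda>x. g x - (\<integral>y. g y \<partial>N))"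

definition decay_condition ::
    "'w measure \<Rightarrow> ('w \<Rightarrow> 'w) \<Rightarrow> ('w \<Rightarrow> 'm::metric_space set) \<Rightarrow> ('w \<Rightarrow> 'm measure) \<Rightarrow>
     ('w \<Rightarrow> ('m \<Rightarrow> real) \<Rightarrow> 'm \<Rightarrow> real) \<Rightarrow> real set \<Rightarrow> real \<Rightarrow> (real \<Rightarrow> nat \<Rightarrow> real) \<Rightarrow> bool" where
  "decay_condition P \<sigma> M \<mu> L I p a \<longleftrightarrow>
     finite I \<and> I \<subseteq> {0<..} \<and> 0 < p \<and>
     (\<forall>u\<in>I. decseq (a u) \<and> (\<forall>n. 0 < a u n) \<and> a u \<longlonglongrightarrow> 0) \<and>
     (\<exists>K. K \<in> borel_measurable P \<and> in_Lp P p K \<and>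
       (AE \<omega> in P. \<forall>u\<in>I. \<forall>r' i j. r' \<le> i \<longrightarrow> i \<le> j \<longrightarrow>
         (\<forall>g1 g2. lipschitz_fun (M ((\<sigma> ^^ r') \<omega>)) g1 \<longrightarrow> lipschitz_fun (M ((\<sigma> ^^ i) \<omega>)) g2 \<longrightarrow>
           Lp_norm (\<mu> ((\<sigma> ^^ j) \<omega>)) u
             (centered (\<mu> ((\<sigma> ^^ j) \<omega>))
               (L_iter \<sigma> L ((\<sigma> ^^ i) \<omega>) (j - i)
                 (\<lambda>x. g2 x * L_iter \<sigma> L ((\<sigma> ^^ r') \<omega>) (i - r') g1 x)))
           \<le> K ((\<sigma> ^^ i) \<omega>) * a u (j - i)
               * (1 + lip_norm (M ((\<sigma> ^^ r') \<omega>)) g1) * (1 + lip_norm (M ((\<sigma> ^^ i) \<omega>)) g2))))"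

definition birkhoff_sum ::
    "('w \<Rightarrow> 'w) \<Rightarrow> ('w \<Rightarrow> 'm \<Rightarrow> 'm) \<Rightarrow> ('w \<Rightarrow> 'm \<Rightarrow> real) \<Rightarrow> 'w \<Rightarrow> nat \<Rightarrow> 'm \<Rightarrow> real" where
  "birkhoff_sum \<sigma> T \<phi> \<omega> n x = (\<Sum>k<n. \<phi> ((\<sigma> ^^ k) \<omega>) (T_iter \<sigma> T \<omega> k x))"

definition Sigma_std ::
    "('w \<Rightarrow> 'w) \<Rightarrow> ('w \<Rightarrow> 'm \<Rightarrow> 'm) \<Rightarrow> ('w \<Rightarrow> 'm measure) \<Rightarrow> ('w \<Rightarrow> 'm \<Rightarrow> real) \<Rightarrow>
     'w \<Rightarrow> nat \<Rightarrow> real" where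
  "Sigma_std \<sigma> T \<mu> \<phi> \<omega> n = sqrt (\<integral>x. (birkhoff_sum \<sigma> T \<phi> \<omega> n x)\<^sup>2 \<partial>\<mu> \<omega>)"

definition G_fun ::
    "('w \<Rightarrow> 'w) \<Rightarrow> ('w \<Rightarrow> ('m \<Rightarrow> real) \<Rightarrow> 'm \<Rightarrow> real) \<Rightarrow> ('w \<Rightarrow> 'm \<Rightarrow> real) \<Rightarrow>
     'w \<Rightarrow> nat \<Rightarrow> 'm \<Rightarrow> real" where
  "G_fun \<sigma> L \<phi> \<omega> n x = (\<Sum>j<n. L_iter \<sigma> L ((\<sigma> ^^ j) \<omega>) (n - j) (\<phi> ((\<sigma> ^^ j) \<omega>)) x)"

definition H_fun ::
    "('w \<Rightarrow> 'w) \<Rightarrow> ('w \<Rightarrow> 'm \<Rightarrow> 'm) \<Rightarrow> ('w \<Rightarrow> ('m \<Rightarrow> real) \<Rightarrow> 'm \<Rightarrow> real) \<Rightarrow>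
     ('w \<Rightarrow> 'm \<Rightarrow> real) \<Rightarrow> 'w \<Rightarrow> nat \<Rightarrow> 'm \<Rightarrow> real" where
  "H_fun \<sigma> T L \<phi> \<omega> n x =
     \<phi> ((\<sigma> ^^ n) \<omega>) x + G_fun \<sigma> L \<phi> \<omega> n x - G_fun \<sigma> L \<phi> \<omega> (Suc n) (T ((\<sigma> ^^ n) \<omega>) x)"

end

theory Submission
  imports Defs
begin

text \<open>The Birkhoff sum is a martingale up to a coboundary. With \<open>G\<close> and \<open>H\<close> as in the martingale part,
\<open>S_n \<phi> = (\<Sum>j<n. H_j \<circ> T^j) + G_n \<circ> T^n\<close> holds pointwise by telescoping, and \<open>L (\<phi>_n + G_n) = G_{n+1}\<close>
makes \<open>H_n\<close> orthogonal to every bounded function of \<open>T_{\<sigma>^n \<omega>}\<close>. Read backwards in time, the functions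
\<open>H_j \<circ> T^j\<close> are therefore martingale differences. The decay condition, with summable \<open>a\<close>, and the
almost sure growth \<open>O(k^{1/p+\<epsilon>})\<close> and \<open>O(k^{1/r+\<epsilon>})\<close> of \<open>K\<close> and of the Lipschitz norm along the orbit give
\<open>\<parallel>G_n\<parallel>_{2s}, \<parallel>H_n\<parallel>_{2s} = O(n^{1/p+1/r+\<epsilon>})\<close>.

The probabilistic core is a Berry--Esseen bound for martingales (\<open>martingale_berry_esseen\<close>), formulated with
the realised squares \<open>Q_n = \<Sum> X_k^2\<close>, because this is what the hypothesis controls. It is proved by
Lindeberg's method run against a random clock. If \<open>\<Phi>\<close> is the normal distribution function, then
\<open>u(R, x) = \<Phi>((t - x) / sqrt R)\<close> solves the heat equation backwards in the remaining variance \<open>R\<close>; letting the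
clock lose \<open>X_k^2\<close> while the walk moves by \<open>X_k\<close> cancels the second-order terms exactly, pathwise, and
leaves a martingale increment plus an error of order \<open>\<bar>X_k\<bar>^3 R^{-3/2}\<close> (\<open>normal_cdf_clock_step\<close>). Since \<open>X_k^2\<close>
is the decrease of \<open>R\<close>, for jumps of size at most \<open>e^2\<close> these errors telescope against \<open>2 e^2 R^{-1/2}\<close> and
sum to \<open>O(e)\<close> if the clock is stopped before it falls below \<open>e^2\<close> (\<open>heat_telescope\<close>). The clock starts at \<open>1 + 3 e^2\<close>,
so on the event that \<open>Q_n\<close> is within \<open>e^2\<close> of \<open>1\<close> and all jumps are small nothing is ever stopped and the
remaining time has order \<open>e^2\<close>: the final value of \<open>u\<close> is an indicator smoothed at scale \<open>e\<close>. Hence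
the distance to the normal law is at most of order \<open>e\<close>, plus the smoothing width \<open>y\<close> and its Gaussian
tail, plus \<open>P(\<bar>Q_n - 1\<bar> > e^2)\<close>, plus \<open>e^{-4s} \<Sum> E \<bar>X_k\<bar>^{2s}\<close> for the large jumps. The boundary term \<open>G_n \<circ> T^n\<close>
enters as a perturbation \<open>W\<close> of the martingale and adds \<open>P(\<bar>W\<bar> > y)\<close>.

Markov's inequality turns the hypothesis on the squares into \<open>P(\<bar>Q_n - 1\<bar> > e^2) = O(n^{-s/2+2s(1/p+1/r)+A+\<delta>} e^{-2s})\<close>.
Balancing this against \<open>e\<close> gives \<open>e^{2s+1} = n^{-s/2+2s(1/p+1/r)+A}\<close>, which is the claimed exponent; every
other term is of no larger order, up to powers \<open>n^\<delta>\<close>, whenever this exponent is negative (\<open>orbit_rate\<close>), and otherwise there is nothing to prove.\<close>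

section \<open>The normal distribution function along a moving clock\<close>

abbreviation (input) normal_cdf :: "real \<Rightarrow> real" where
  "normal_cdf \<equiv> cdf std_normal_distribution"

lemma normal_cdf_diff:
  assumes "a \<le> b"
  shows "normal_cdf b - normal_cdf a = integral {a..b} std_normal_density"
proof -
  interpret N: real_distribution std_normal_distribution by (rule real_dist_normal_dist)
  have c: "continuous_on {a..b} std_normal_density"
    unfolding std_normal_density_def by (intro continuous_intros) auto
  have si: "set_integrable lborel {a..b} std_normal_density"
    by (rule borel_integrable_atLeastAtMost') (rule c)
  have "normal_cdf b - normal_cdf a = measure std_normal_distribution {a<..b}"
    using assms N.cdf_diff_eq[of a b] by (cases "a = b") auto
  also have "\<dots> = measure std_normal_distribution {a..b}"
  proof (rule measure_eq_AE)
    show "AE x in std_normal_distribution. (x \<in> {a<..b}) = (x \<in> {a..b})"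
    proof (subst AE_density)
      show "AE x in lborel. 0 < ennreal (std_normal_density x) \<longrightarrow> (x \<in> {a<..b}) = (x \<in> {a..b})"
        using AE_lborel_singleton[of a] by eventually_elim auto
    qed simp
  qed auto
  also have "\<dots> = (\<integral>x. indicator {a..b} x \<partial>std_normal_distribution)"
    by simp
  also have "\<dots> = (\<integral>x. std_normal_density x * indicator {a..b} x \<partial>lborel)"
    by (subst integral_density) auto
  also have "\<dots> = (LINT x:{a..b}|lborel. std_normal_density x)"
    unfolding set_lebesgue_integral_def by (simp add: mult.commute)
  also have "\<dots> = integral {a..b} std_normal_density"
    using set_borel_integral_eq_integral(2)[OF si] .
  finally show ?thesis .
qed

lemma normal_cdf_deriv: "(normal_cdf has_real_derivative std_normal_density x) (at x)"
proof -
  have c: "continuous_on {x-1..x+1} std_normal_density"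
    unfolding std_normal_density_def by (intro continuous_intros) auto
  have "((\<lambda>u. integral {x-1..u} std_normal_density) has_real_derivative std_normal_density x)
      (at x within {x-1..x+1})"
    by (rule integral_has_real_derivative[OF c]) auto
  then have "((\<lambda>u. integral {x-1..u} std_normal_density) has_real_derivative std_normal_density x) (at x)"
    by (simp add: at_within_Icc_at)
  then have "((\<lambda>u. normal_cdf (x-1) + integral {x-1..u} std_normal_density)
      has_real_derivative std_normal_density x) (at x)"
    by (auto intro!: derivative_eq_intros)
  moreover have "\<forall>\<^sub>F u in nhds x. normal_cdf u = normal_cdf (x-1) + integral {x-1..u} std_normal_density"
  proof -
    have "\<forall>\<^sub>F u in nhds x. u \<in> {x-1<..}"
      by (rule eventually_nhds_in_open) auto
    then show ?thesis
    proof eventually_elim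
      case (elim u)
      then show ?case using normal_cdf_diff[of "x - 1" u] by simp
    qed
  qed
  ultimately show ?thesis
    by (rule DERIV_cong_ev[OF refl _ refl, THEN iffD2, rotated])
qed

lemma std_normal_density_deriv:
  "(std_normal_density has_real_derivative - x * std_normal_density x) (at x)"
  unfolding std_normal_density_def
  by (rule derivative_eq_intros refl | simp add: field_simps)+

text \<open>The density absorbs polynomials of degree four; this is what makes the Taylor remainders below uniform in
the position \<open>z\<close>.\<close>

lemma std_normal_density_le: "std_normal_density x * (1 + x^4) \<le> 8"
proof -
  define y where "y = x\<^sup>2 / 2"
  have y: "0 \<le> y" unfolding y_def by simp
  have "1 + y + y\<^sup>2 / 2 \<le> exp y" by (rule exp_lower_Taylor_quadratic[OF y])
  moreover have "x^4 = 4 * y\<^sup>2" unfolding y_def by (simp add: power_divide power_mult[symmetric])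
  moreover have "0 \<le> y^2" by simp
  ultimately have *: "1 + x^4 \<le> 8 * exp y" using y by linarith
  have "1 / sqrt (2 * pi) \<le> 1" using pi_ge_two by simp
  then have "(1 / sqrt (2 * pi)) * exp (- y) \<le> 1 * exp (- y)"
    by (intro mult_right_mono) auto
  then have "std_normal_density x \<le> exp (- y)"
    unfolding std_normal_density_def y_def by simp
  then have "std_normal_density x * (1 + x^4) \<le> exp (- y) * (8 * exp y)"
    by (intro mult_mono *) auto
  also have "\<dots> = 8" by (simp add: exp_minus)
  finally show ?thesis .
qed

lemma std_normal_density_le1: "std_normal_density x \<le> 1"
proof -
  have "1 / sqrt (2 * pi) \<le> 1" using pi_ge_two by simp
  then have "(1 / sqrt (2 * pi)) * exp (- x\<^sup>2 / 2) \<le> 1 * 1"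
    by (intro mult_mono) auto
  then show ?thesis unfolding std_normal_density_def by simp
qed

lemma abs_mult_std_normal_density_le: "\<bar>x\<bar> * std_normal_density x \<le> 1"
proof -
  define y where "y = x\<^sup>2 / 2"
  have "1 + y \<le> exp y" by (rule exp_ge_add_one_self)
  moreover have "2 * \<bar>x\<bar> \<le> 1 + x\<^sup>2"
    using zero_le_power2[of "\<bar>x\<bar> - 1"] by (simp add: power2_diff)
  ultimately have *: "\<bar>x\<bar> \<le> exp y" unfolding y_def by linarith
  have "1 / sqrt (2 * pi) \<le> 1" using pi_ge_two by simp
  then have "(1 / sqrt (2 * pi)) * exp (- y) \<le> 1 * exp (- y)"
    by (intro mult_right_mono) auto
  then have "std_normal_density x \<le> exp (- y)"
    unfolding std_normal_density_def y_def by simp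
  then have "\<bar>x\<bar> * std_normal_density x \<le> exp y * exp (- y)"
    by (intro mult_mono *) auto
  also have "\<dots> = 1" by (simp add: exp_minus)
  finally show ?thesis .
qed

text \<open>For jumps that are too large to be charged to the clock, so that time stands still while the walk moves.\<close>

lemma normal_cdf_taylor1: 
  "\<bar>normal_cdf (z - b) - normal_cdf z + b * std_normal_density z\<bar> \<le> b\<^sup>2 / 2"
proof -
  define d where "d = (\<lambda>m::nat. if m = 0 then (\<lambda>u. normal_cdf (z - u))
     else if m = 1 then (\<lambda>u. - std_normal_density (z - u))
     else (\<lambda>u. - (z - u) * std_normal_density (z - u)))"
  have "\<exists>t. \<bar>t\<bar> \<le> \<bar>b\<bar> \<and> normal_cdf (z - b) = (\<Sum>m<2. d m 0 / fact m * b ^ m) + d 2 t / fact 2 * b ^ 2"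
  proof (rule Maclaurin_bi_le)
    show "d 0 = (\<lambda>u. normal_cdf (z - u))" by (simp add: d_def)
    have "((\<lambda>u. normal_cdf (z - u)) has_real_derivative - std_normal_density (z - t)) (at t)" for t
      by (rule DERIV_cong[OF DERIV_chain2[OF normal_cdf_deriv]])
        (auto intro!: derivative_eq_intros)
    moreover have "((\<lambda>u. - std_normal_density (z - u)) has_real_derivative
        - (z - t) * std_normal_density (z - t)) (at t)" for t
      by (rule DERIV_cong[OF DERIV_minus[OF DERIV_chain2[OF std_normal_density_deriv]]])
        (auto intro!: derivative_eq_intros)
    ultimately show "\<forall>m t. m < 2 \<and> \<bar>t\<bar> \<le> \<bar>b\<bar> \<longrightarrow> (d m has_real_derivative d (Suc m) t) (at t)"
      by (auto simp: d_def less_2_cases_iff)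
  qed
  then obtain t where "normal_cdf (z - b) = (\<Sum>m<2. d m 0 / fact m * b ^ m) + d 2 t / fact 2 * b ^ 2"
    by blast
  then have *: "normal_cdf (z - b) - normal_cdf z + b * std_normal_density z
     = (- (z - t) * std_normal_density (z - t)) * (b\<^sup>2 / 2)"
    by (simp add: d_def lessThan_Suc numeral_2_eq_2 field_simps)
  have "\<bar>(- (z - t) * std_normal_density (z - t)) * (b\<^sup>2 / 2)\<bar>
     = \<bar>z - t\<bar> * std_normal_density (z - t) * (b\<^sup>2 / 2)"
    by (simp add: abs_mult abs_minus_commute)
  also have "\<dots> \<le> 1 * (b\<^sup>2 / 2)"
    by (intro mult_right_mono abs_mult_std_normal_density_le) auto
  finally show ?thesis unfolding * by simp
qed

lemma mehler_poly_bound: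
  fixes z a w :: real
  assumes a: "\<bar>a\<bar> \<le> 1/2" and zw: "\<bar>z\<bar> \<le> \<bar>w\<bar> + 1"
  shows "\<bar>2 * z\<^sup>2 - z^3 * a + z\<^sup>2 * a\<^sup>2 - z * a - 2 - 2 * z * a^3 + 3 * a\<^sup>2\<bar> \<le> 128 * (1 + w^4)"
proof -
  define y where "y = \<bar>z\<bar>"
  define v where "v = \<bar>w\<bar>"
  have y0: "0 \<le> y" "0 \<le> v" "y \<le> v + 1" using zw by (auto simp: y_def v_def)
  have a2: "a\<^sup>2 \<le> 1" using power_mono[OF a, of 2] by (simp add: power2_eq_square)
  have a3: "\<bar>a\<bar>^3 \<le> 1" using power_mono[OF a, of 3] by (simp add: power3_eq_cube)
  have t1: "\<bar>z^3 * a\<bar> \<le> y^3" using a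
    unfolding y_def by (simp add: abs_mult power_abs mult_left_le)
  have t2: "\<bar>z\<^sup>2 * a\<^sup>2\<bar> \<le> y^2" using a2 unfolding y_def by (simp add: abs_mult mult_left_le)
  have t3: "\<bar>z * a\<bar> \<le> y" using a unfolding y_def by (simp add: abs_mult mult_left_le)
  have t4: "\<bar>z * a^3\<bar> \<le> y" using a3 unfolding y_def by (simp add: abs_mult power_abs mult_left_le)
  have t5: "z\<^sup>2 = y\<^sup>2" unfolding y_def by simp
  have "\<bar>2 * z\<^sup>2 - z^3 * a + z\<^sup>2 * a\<^sup>2 - z * a - 2 - 2 * z * a^3 + 3 * a\<^sup>2\<bar>
     \<le> y^3 + 3 * y\<^sup>2 + 3 * y + 5"
    using t1 t2 t3 t4 t5 a2 zero_le_power2[of a] unfolding abs_le_iff by (intro conjI) linarith+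
  also have "\<dots> \<le> 5 * (1 + y)^3" 
    using y0 by (simp add: power3_eq_cube power2_eq_square algebra_simps)
  also have "\<dots> \<le> 5 * (2 + v)^3" using y0 by (intro mult_left_mono power_mono) auto
  also have "5 * (2 + v)^3 = 5 * v^3 + 30 * v^2 + 60 * v + 40"
    by (simp add: power3_eq_cube power2_eq_square algebra_simps)
  also have "5 * v^3 + 30 * v^2 + 60 * v + 40 \<le> 128 * (1 + v^4)"
  proof -
    have v4: "0 \<le> v^4" by simp
    have "0 \<le> (v^2-1)^2" by simp
    then have b2: "2 * v^2 \<le> 1 + v^4" by (simp add: power2_diff power_mult[symmetric])
    have "0 \<le> (v-1)^2" by simp
    then have b1: "2 * v \<le> 1 + v^2" by (simp add: power2_diff)
    have "0 \<le> (v^2-v)^2" by simp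
    then have b3: "2 * v^3 \<le> v^4 + v^2"
      by (simp add: power2_diff power_mult[symmetric] power2_eq_square power3_eq_cube power4_eq_xxxx algebra_simps)
    show ?thesis using b1 b2 b3 v4 unfolding distrib_left by linarith
  qed
  finally show ?thesis by (simp add: v_def)
qed

text \<open>When the walk moves by \<open>a\<close> (in units of the square root of the remaining time) and the clock loses \<open>a\<^sup>2\<close>, the argument
of the normal distribution function becomes \<open>(z - a) / sqrt (1 - a\<^sup>2)\<close>, as in Mehler's kernel. The next
two lemmas compute two derivatives along this curve. That the second one carries a factor \<open>a\<close>, hence vanishes at
\<open>a = 0\<close>, is the heat equation.\<close>

lemma mehler_deriv1:
  fixes z a :: real
  assumes a: "\<bar>a\<bar> < 1"
  defines "w \<equiv> \<lambda>a. (z - a) / sqrt (1 - a\<^sup>2)"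
  shows "(w has_real_derivative (z * a - 1) / sqrt (1 - a\<^sup>2) ^ 3) (at a)"
proof -
  have "a\<^sup>2 < 1" using a by (simp add: abs_square_less_1)
  then have q: "0 < 1 - a\<^sup>2" by simp
  define q where "q = sqrt (1 - a\<^sup>2)"
  have q0: "q > 0" "q * q = 1 - a * a" using q unfolding q_def by (auto simp: power2_eq_square)
  have "((\<lambda>a. sqrt (1 - a\<^sup>2)) has_real_derivative - a / q) (at a)"
    using q unfolding q_def by (auto intro!: derivative_eq_intros simp: field_simps)
  then have "((\<lambda>a. (z - a) / sqrt (1 - a\<^sup>2)) has_real_derivative
      ((- 1) * q - (z - a) * (- a / q)) / (q * q)) (at a)"
    unfolding q_def using q by (intro DERIV_divide) (auto intro!: derivative_eq_intros)
  moreover have "((- 1) * q - (z - a) * (- a / q)) / (q * q) = (z * a - 1) / q ^ 3"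
  proof -
    have "((- 1) * q - (z - a) * (- a / q)) / (q * q) = (- (q * q) + (z - a) * a) / q^3"
      using q0(1) by (simp add: field_simps power3_eq_cube)
    also have "- (q * q) + (z - a) * a = z * a - 1" unfolding q0(2) by (simp add: algebra_simps)
    finally show ?thesis .
  qed
  ultimately show ?thesis unfolding w_def q_def by metis
qed

lemma mehler_deriv2:
  fixes z a :: real
  assumes a: "\<bar>a\<bar> < 1"
  defines "w \<equiv> \<lambda>a. (z - a) / sqrt (1 - a\<^sup>2)"
  shows "((\<lambda>a. std_normal_density (w a) * ((z * a - 1) / sqrt (1 - a\<^sup>2) ^ 3)) has_real_derivative
     std_normal_density (w a) / sqrt (1 - a\<^sup>2) ^ 7 *
       (a * (2 * z\<^sup>2 - z^3 * a + z\<^sup>2 * a\<^sup>2 - z * a - 2 - 2 * z * a^3 + 3 * a\<^sup>2))) (at a)"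
proof -
  have "a\<^sup>2 < 1" using a by (simp add: abs_square_less_1)
  then have q: "0 < 1 - a\<^sup>2" by simp
  define q where "q = sqrt (1 - a\<^sup>2)"
  have q0: "q > 0" "q ^ 2 = 1 - a ^ 2" using q unfolding q_def by auto
  have dq: "((\<lambda>a. sqrt (1 - a\<^sup>2)) has_real_derivative - a / q) (at a)"
    using q unfolding q_def by (auto intro!: derivative_eq_intros simp: field_simps)
  have dp: "((\<lambda>a. std_normal_density (w a)) has_real_derivative
      - w a * std_normal_density (w a) * ((z * a - 1) / q ^ 3)) (at a)"
    unfolding q_def
    by (rule DERIV_chain2[OF std_normal_density_deriv]) (unfold w_def, rule mehler_deriv1[OF a])
  have dr: "((\<lambda>a. (z * a - 1) / sqrt (1 - a\<^sup>2) ^ 3) has_real_derivative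
      (z * q^3 - (z * a - 1) * (3 * q^2 * (- a / q))) / (q^3 * q^3)) (at a)"
  proof -
    have "((\<lambda>a. sqrt (1 - a\<^sup>2) ^ 3) has_real_derivative 3 * q^2 * (- a / q)) (at a)"
      by (rule DERIV_cong[OF DERIV_power[OF dq]]) (simp add: q_def)
    moreover have "((\<lambda>a. z * a - 1) has_real_derivative z) (at a)"
      by (auto intro!: derivative_eq_intros)
    ultimately show ?thesis
      using DERIV_divide[of "\<lambda>a. z * a - 1" z a UNIV "\<lambda>a. sqrt (1 - a\<^sup>2) ^ 3" "3 * q^2 * (- a / q)"] q0(1)
      by (simp add: q_def)
  qed
  have "((\<lambda>a. std_normal_density (w a) * ((z * a - 1) / sqrt (1 - a\<^sup>2) ^ 3)) has_real_derivative
     - w a * std_normal_density (w a) * ((z * a - 1) / q ^ 3) * ((z * a - 1) / q ^ 3)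
     + (z * q^3 - (z * a - 1) * (3 * q^2 * (- a / q))) / (q^3 * q^3) * std_normal_density (w a)) (at a)"
    by (rule DERIV_cong[OF DERIV_mult[OF dp dr]]) (simp add: q_def)
  moreover have "- w a * std_normal_density (w a) * ((z * a - 1) / q ^ 3) * ((z * a - 1) / q ^ 3)
     + (z * q^3 - (z * a - 1) * (3 * q^2 * (- a / q))) / (q^3 * q^3) * std_normal_density (w a)
     = std_normal_density (w a) / q ^ 7 *
       (a * (2 * z\<^sup>2 - z^3 * a + z\<^sup>2 * a\<^sup>2 - z * a - 2 - 2 * z * a^3 + 3 * a\<^sup>2))"
  proof -
    have wa: "w a = (z - a) / q" unfolding w_def q_def ..
    have "- w a * std_normal_density (w a) * ((z * a - 1) / q ^ 3) * ((z * a - 1) / q ^ 3)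
     + (z * q^3 - (z * a - 1) * (3 * q^2 * (- a / q))) / (q^3 * q^3) * std_normal_density (w a)
     = std_normal_density (w a) / q ^ 7 * 
       (- (z - a) * (z * a - 1)^2 + z * (q^2)^2 + 3 * a * (z * a - 1) * q^2)"
    proof -
      have k: "- w a * D * (u / q ^ 3) * (u / q ^ 3) + (z * q^3 - u * (3 * q^2 * (- a / q))) / (q^3 * q^3) * D
         = D / q ^ 7 * (- (z - a) * u^2 + z * (q^2)^2 + 3 * a * u * q^2)" for D u
      proof -
        define i where "i = inverse q"
        \<comment> \<open>With the inverse as a variable of its own the identity is polynomial modulo q * i = 1.\<close>
        have qi: "q * i = 1" using q0(1) unfolding i_def by simp
        have e: "q^3 * i^6 = q^4 * i^7"
        proof -
          have "q^4 * i^7 = q^3 * i^6 * (q * i)" by (simp add: eval_nat_numeral)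
          then show ?thesis using qi by simp
        qed
        have "- w a * D * (u / q ^ 3) * (u / q ^ 3) + (z * q^3 - u * (3 * q^2 * (- a / q))) / (q^3 * q^3) * D
          = - ((z - a) * i) * D * (u * i^3) * (u * i^3) + (z * q^3 - u * (3 * q^2 * (- a * i))) * i^6 * D"
          unfolding wa i_def by (simp add: divide_inverse power_inverse)
        also have "\<dots> = - (z - a) * D * u^2 * i^7 + z * D * (q^3 * i^6) + 3 * u * a * D * q^2 * i^7"
          by (simp add: eval_nat_numeral algebra_simps)
        also have "\<dots> = D * i^7 * (- (z - a) * u^2 + z * (q^2)^2 + 3 * a * u * q^2)"
          unfolding e by (simp add: eval_nat_numeral algebra_simps)
        finally show ?thesis unfolding i_def by (simp add: divide_inverse power_inverse)
      qed
      show ?thesis by (rule k)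
    qed
    also have "- (z - a) * (z * a - 1)^2 + z * (q^2)^2 + 3 * a * (z * a - 1) * q^2
      = a * (2 * z\<^sup>2 - z^3 * a + z\<^sup>2 * a\<^sup>2 - z * a - 2 - 2 * z * a^3 + 3 * a\<^sup>2)"
      unfolding q0(2) by (simp add: power2_eq_square power3_eq_cube algebra_simps)
    finally show ?thesis .
  qed
  ultimately show ?thesis unfolding q_def by simp
qed

text \<open>The second derivative along the curve is \<open>O(\<bar>a\<bar>)\<close>, so a second-order Taylor expansion leaves a remainder of
third order although only the linear term is subtracted.\<close>

lemma normal_cdf_clock_step:
  fixes z b :: real
  assumes b: "\<bar>b\<bar> \<le> 1/2"
  shows "\<bar>normal_cdf ((z - b) / sqrt (1 - b\<^sup>2)) - normal_cdf z + b * std_normal_density z\<bar> \<le> 4096 * \<bar>b\<bar>^3"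
proof -
  define w where "w = (\<lambda>a. (z - a) / sqrt (1 - a\<^sup>2))"
  define P where "P = (\<lambda>a. 2 * z\<^sup>2 - z^3 * a + z\<^sup>2 * a\<^sup>2 - z * a - 2 - 2 * z * a^3 + 3 * a\<^sup>2)"
  define d where "d = (\<lambda>m::nat. if m = 0 then (\<lambda>a. normal_cdf (w a))
     else if m = 1 then (\<lambda>a. std_normal_density (w a) * ((z * a - 1) / sqrt (1 - a\<^sup>2) ^ 3))
     else (\<lambda>a. std_normal_density (w a) / sqrt (1 - a\<^sup>2) ^ 7 * (a * P a)))"
  have "\<exists>t. \<bar>t\<bar> \<le> \<bar>b\<bar> \<and> normal_cdf (w b) = (\<Sum>m<2. d m 0 / fact m * b ^ m) + d 2 t / fact 2 * b ^ 2"
  proof (rule Maclaurin_bi_le)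
    show "d 0 = (\<lambda>a. normal_cdf (w a))" by (simp add: d_def)
    have "((\<lambda>a. normal_cdf (w a)) has_real_derivative
       std_normal_density (w t) * ((z * t - 1) / sqrt (1 - t\<^sup>2) ^ 3)) (at t)" if "\<bar>t\<bar> \<le> \<bar>b\<bar>" for t
      by (rule DERIV_chain2[OF normal_cdf_deriv])
         (unfold w_def, rule mehler_deriv1, use that b in auto)
    moreover have "((\<lambda>a. std_normal_density (w a) * ((z * a - 1) / sqrt (1 - a\<^sup>2) ^ 3)) has_real_derivative
       std_normal_density (w t) / sqrt (1 - t\<^sup>2) ^ 7 * (t * P t)) (at t)" if "\<bar>t\<bar> \<le> \<bar>b\<bar>" for t
      unfolding w_def P_def by (rule mehler_deriv2) (use that b in auto)
    ultimately show "\<forall>m t. m < 2 \<and> \<bar>t\<bar> \<le> \<bar>b\<bar> \<longrightarrow> (d m has_real_derivative d (Suc m) t) (at t)"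
      by (auto simp: d_def less_2_cases_iff)
  qed
  then obtain t where t: "\<bar>t\<bar> \<le> \<bar>b\<bar>" and
    "normal_cdf (w b) = (\<Sum>m<2. d m 0 / fact m * b ^ m) + d 2 t / fact 2 * b ^ 2"
    by blast
  then have *: "normal_cdf (w b) - normal_cdf z + b * std_normal_density z
     = (std_normal_density (w t) / sqrt (1 - t\<^sup>2) ^ 7 * (t * P t)) * (b\<^sup>2 / 2)"
    by (simp add: d_def w_def lessThan_Suc numeral_2_eq_2 algebra_simps)
  have t2: "\<bar>t\<bar> \<le> 1/2" using t b by simp
  have "t\<^sup>2 \<le> (1/2)\<^sup>2" using power_mono[OF t2, of 2] by simp
  then have q34: "3/4 \<le> 1 - t\<^sup>2" by (simp add: power2_eq_square)
  define q where "q = sqrt (1 - t\<^sup>2)"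
  have q: "0 < q" "q \<le> 1" "q^2 = 1 - t\<^sup>2" unfolding q_def using q34 by auto
  have "(3/4)^4 \<le> (q^2)^4" using q34 q by (intro power_mono) auto
  also have "\<dots> = q^8" by (simp add: power_mult[symmetric])
  also have "\<dots> \<le> q^7" using q by (intro power_decreasing) auto
  finally have q7: "1/4 \<le> q^7" by (simp add: power4_eq_xxxx)
  have "z = w t * q + t" unfolding w_def q_def[symmetric] using q by simp
  then have "\<bar>z\<bar> \<le> \<bar>w t * q\<bar> + \<bar>t\<bar>" by linarith
  also have "\<bar>w t * q\<bar> \<le> \<bar>w t\<bar>" using q by (simp add: abs_mult mult_left_le)
  finally have zw: "\<bar>z\<bar> \<le> \<bar>w t\<bar> + 1" using t2 by linarith
  have P: "\<bar>P t\<bar> \<le> 128 * (1 + w t ^ 4)"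
    unfolding P_def by (rule mehler_poly_bound[OF t2 zw])
  have "\<bar>std_normal_density (w t) / q ^ 7 * (t * P t)\<bar> 
     = std_normal_density (w t) / q^7 * (\<bar>t\<bar> * \<bar>P t\<bar>)"
    using q by (simp add: abs_mult)
  also have "\<dots> \<le> (std_normal_density (w t) * 4) * (\<bar>b\<bar> * (128 * (1 + w t ^ 4)))"
  proof (intro mult_mono P t)
    have "1 / q^7 \<le> 4" using q7 q by (simp add: field_simps)
    then show "std_normal_density (w t) / q ^ 7 \<le> std_normal_density (w t) * 4"
      using mult_left_mono[of "1 / q^7" 4 "std_normal_density (w t)"] by simp
  qed (use q in auto)
  also have "\<dots> = 512 * \<bar>b\<bar> * (std_normal_density (w t) * (1 + w t ^ 4))" by (simp add: algebra_simps)
  also have "\<dots> \<le> 512 * \<bar>b\<bar> * 8" by (intro mult_left_mono std_normal_density_le) auto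
  finally have "\<bar>std_normal_density (w t) / q ^ 7 * (t * P t)\<bar> * (b\<^sup>2 / 2) \<le> 4096 * \<bar>b\<bar> * (b\<^sup>2 / 2)"
    by (intro mult_right_mono) auto
  also have "\<dots> \<le> 4096 * \<bar>b\<bar>^3" by (simp add: power3_eq_cube power2_eq_square zero_le_mult_iff mult.assoc[symmetric])
  finally show ?thesis using * unfolding w_def[symmetric] q_def by (simp add: abs_mult w_def)
qed

lemma normal_cdf_lipschitz: "\<bar>normal_cdf x - normal_cdf y\<bar> \<le> \<bar>x - y\<bar>"
proof -
  have "norm (normal_cdf x - normal_cdf y) \<le> 1 * norm (x - y)"
    by (rule field_differentiable_bound[of UNIV normal_cdf std_normal_density])
       (auto intro: normal_cdf_deriv std_normal_density_le1)
  then show ?thesis by simp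
qed

text \<open>Needed because the clock starts slightly above \<open>1\<close>. The derivative of \<open>u \<mapsto> \<Phi>(t / u)\<close> is bounded uniformly in \<open>t\<close>
since \<open>\<bar>v\<bar>\<close> times the density at \<open>v\<close> is bounded.\<close>

lemma normal_cdf_scale:
  assumes k: "1 \<le> k"
  shows "\<bar>normal_cdf (t / k) - normal_cdf t\<bar> \<le> k - 1"
proof -
  have "\<exists>u. u \<ge> 1 \<and> u \<le> k \<and> normal_cdf (t / k) - normal_cdf (t / 1) = (k - 1) * (std_normal_density (t / u) * (- t / u^2))"
  proof (cases "k = 1")
    case False
    with k have "1 < k" by simp
    have der: "((\<lambda>u. normal_cdf (t / u)) has_real_derivative std_normal_density (t / u) * (- t / u^2)) (at u)"
      if "1 \<le> u" for u
      by (rule DERIV_chain2[OF normal_cdf_deriv])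
         (use that in \<open>auto intro!: derivative_eq_intros simp: power2_eq_square\<close>)
    from MVT2[OF \<open>1 < k\<close>, of "\<lambda>u. normal_cdf (t / u)" "\<lambda>u. std_normal_density (t / u) * (- t / u^2)"]
    have "\<exists>u>1. u < k \<and> normal_cdf (t / k) - normal_cdf (t / 1) = (k - 1) * (std_normal_density (t / u) * (- t / u^2))"
      using der by blast
    then show ?thesis by (meson less_eq_real_def)
  qed auto
  then obtain u where u: "u \<ge> 1" and eq: "normal_cdf (t / k) - normal_cdf t = (k - 1) * (std_normal_density (t / u) * (- t / u^2))"
    by auto
  have "\<bar>std_normal_density (t / u) * (- t / u^2)\<bar> = (\<bar>t / u\<bar> * std_normal_density (t / u)) / u"
    using u by (simp add: abs_mult power2_eq_square)
  also have "\<dots> \<le> 1 / u" using u by (intro divide_right_mono abs_mult_std_normal_density_le) auto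
  also have "\<dots> \<le> 1" using u by simp
  finally have "(k - 1) * \<bar>std_normal_density (t / u) * (- t / u^2)\<bar> \<le> (k - 1) * 1"
    using k by (intro mult_left_mono) auto
  then show ?thesis unfolding eq using k by (simp add: abs_mult)
qed

lemma normal_cdf_symmetric: "normal_cdf (- x) = 1 - normal_cdf x"
proof -
  interpret N: real_distribution std_normal_distribution by (rule real_dist_normal_dist)
  define f where "f = (\<lambda>x. normal_cdf x + normal_cdf (- x))"
  have d: "(f has_real_derivative 0) (at x)" for x
  proof -
    have "(f has_real_derivative std_normal_density x + std_normal_density (- x) * (- 1)) (at x)"
      unfolding f_def
      by (intro DERIV_add normal_cdf_deriv DERIV_chain2[OF normal_cdf_deriv])
         (auto intro!: derivative_eq_intros)
    then show ?thesis by (simp add: normal_density_def)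
  qed
  have "f y = f 0" for y by (rule DERIV_isconst_all) (use d in auto)
  then have c: "f = (\<lambda>_. f 0)" by auto
  have "(f \<longlongrightarrow> 1 + 0) at_top" unfolding f_def
    by (intro tendsto_add N.cdf_lim_at_top_prob filterlim_compose[OF N.cdf_lim_at_bot] filterlim_uminus_at_bot_at_top)
  then have "f 0 = 1" using c by (metis add.right_neutral tendsto_const_iff trivial_limit_at_top_linorder)
  then show ?thesis using c unfolding f_def by (metis add_diff_cancel_left')
qed

text \<open>Any polynomial order suffices: below, \<open>x\<close> is a small power of \<open>n\<close> and \<open>k\<close> is chosen large.\<close>

lemma normal_cdf_tail:
  "\<exists>C. \<forall>x>0. 1 - normal_cdf x \<le> C / x ^ k"
proof -
  interpret N: real_distribution std_normal_distribution by (rule real_dist_normal_dist)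
  define C where "C = (LINT x|std_normal_distribution. x^(2 * k))"
  have int: "integrable std_normal_distribution (\<lambda>x. x^(2 * k))"
    by (rule integrable_std_normal_distribution_moment)
  have C0: "0 \<le> C" unfolding C_def by (rule integral_nonneg_AE) (simp add: power_mult)
  have "1 - normal_cdf x \<le> (1 + C) / x ^ k" if x: "0 < x" for x
  proof (cases "x \<le> 1")
    case True
    then have "1 \<le> 1 / x ^ k" using x by (simp add: power_le_one)
    also have "\<dots> \<le> (1 + C) / x^k" using x C0 by (intro divide_right_mono) auto
    finally show ?thesis using N.cdf_nonneg[of x] by linarith
  next
    case False
    have eq: "1 - normal_cdf x = measure std_normal_distribution {x<..}"
    proof -
      have "{x<..} = space std_normal_distribution - {..x}" by auto
      then show ?thesis using N.prob_compl[of "{..x}"] by (simp add: cdf_def)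
    qed
    also have "\<dots> \<le> measure std_normal_distribution {y \<in> space std_normal_distribution. x ^ (2*k) \<le> y ^ (2*k)}"
      using x by (intro N.finite_measure_mono) (auto intro!: power_mono)
    also have "\<dots> \<le> C / x ^ (2 * k)"
      unfolding C_def by (rule integral_Markov_inequality_measure[OF int, of "{}"]) (use x in \<open>auto simp: power_mult\<close>)
    also have "\<dots> \<le> (1 + C) / x ^ k"
      using x False C0 by (intro frac_le power_increasing) auto
    finally show ?thesis .
  qed
  then show ?thesis by blast
qed

section \<open>The heat functional of a stopped walk\<close>

text \<open>The clock holds the remaining variance of the path \<open>x\<close>. It starts at \<open>1 + 3 e\<^sup>2\<close> rather than \<open>1\<close> so that a path whose
squares sum to at most \<open>1 + e\<^sup>2\<close> never falls below the stopping level \<open>2 e\<^sup>2\<close>. Whether step \<open>k\<close> counts is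
decided by the values before \<open>k\<close>, so stopping keeps the martingale property. Jumps larger than \<open>e\<^sup>2\<close> do not run the clock
down; otherwise a single one could make it negative.\<close>

primrec clock :: "real \<Rightarrow> (nat \<Rightarrow> real) \<Rightarrow> nat \<Rightarrow> real" where
  "clock e x 0 = 1 + 3 * e\<^sup>2"
| "clock e x (Suc k) =
     clock e x k - (if 2 * e\<^sup>2 \<le> clock e x k \<and> \<bar>x k\<bar> \<le> e\<^sup>2 then (x k)\<^sup>2 else 0)"

primrec stopped_walk :: "real \<Rightarrow> (nat \<Rightarrow> real) \<Rightarrow> nat \<Rightarrow> real" where
  "stopped_walk e x 0 = 0"
| "stopped_walk e x (Suc k) =
     stopped_walk e x k + (if 2 * e\<^sup>2 \<le> clock e x k then x k else 0)"

definition heat :: "real \<Rightarrow> real \<Rightarrow> (nat \<Rightarrow> real) \<Rightarrow> nat \<Rightarrow> real" where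
  "heat t e x k = normal_cdf ((t - stopped_walk e x k) / sqrt (clock e x k))"

text \<open>Minus the space derivative of \<open>heat\<close>, set to zero once the walk has stopped: the predictable coefficient of \<open>x k\<close>
in the martingale part of the increment.\<close>

definition heat_slope :: "real \<Rightarrow> real \<Rightarrow> (nat \<Rightarrow> real) \<Rightarrow> nat \<Rightarrow> real" where
  "heat_slope t e x k =
     (if 2 * e\<^sup>2 \<le> clock e x k
      then std_normal_density ((t - stopped_walk e x k) / sqrt (clock e x k)) / sqrt (clock e x k)
      else 0)"

text \<open>The last step that is charged leaves from a level of at least \<open>2 e\<^sup>2\<close> and costs at most \<open>e\<^sup>4\<close>.\<close>

lemma clock_ge:
  assumes e: "0 < e" "e \<le> 1/2"
  shows "e\<^sup>2 \<le> clock e x k"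
proof (induction k)
  case (Suc k)
  have "(x k)\<^sup>2 \<le> e\<^sup>2" if "\<bar>x k\<bar> \<le> e\<^sup>2"
  proof -
    have "\<bar>x k\<bar> \<le> e * e" using that by (simp add: power2_eq_square)
    also have "\<dots> \<le> e * 1" using e by (intro mult_left_mono) auto
    finally show ?thesis using e by (simp add: abs_le_square_iff[symmetric])
  qed
  with Suc show ?case by auto
qed auto

text \<open>Convexity of \<open>R \<mapsto> 1 / sqrt R\<close>. It turns the cubic error \<open>\<bar>x\<bar> x\<^sup>2 / (R sqrt R)\<close>, in which \<open>x\<^sup>2\<close> is the decrease of the clock,
into a telescoping difference.\<close>

lemma inverse_sqrt_diff_ge:
  assumes "0 < R'" "R' \<le> R"
  shows "(R - R') / (R * sqrt R) \<le> 2 * (1 / sqrt R' - 1 / sqrt R)"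
proof -
  define a b where "a = sqrt R" and "b = sqrt R'"
  have ab: "0 < b" "b \<le> a" "0 < a" and R: "R = a * a" "R' = b * b"
    using assms by (auto simp: a_def b_def)
  have "(R - R') / (R * sqrt R) = ((a - b) * (a + b)) / (a * a * a)"
    unfolding a_def[symmetric] R using ab by (simp add: algebra_simps abs_of_pos)
  also have "\<dots> \<le> ((a - b) * (2 * a)) / (a * a * a)"
    using ab by (intro divide_right_mono mult_left_mono) auto
  also have "\<dots> = 2 * (a - b) / (a * a)" using ab by simp
  also have "\<dots> \<le> 2 * (a - b) / (b * a)"
    using ab by (intro divide_left_mono mult_right_mono mult_pos_pos) auto
  also have "\<dots> = 2 * (1 / b - 1 / a)" using ab by (simp add: field_simps)
  finally show ?thesis unfolding a_def b_def .
qed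

text \<open>A jump above the threshold pays for its quadratic error with its moment of order \<open>2 s\<close>.\<close>

lemma powr_gt_trade:
  fixes e x s :: real
  assumes e: "0 < e" "e \<le> 1/2" and s: "1 \<le> s" and x: "e\<^sup>2 < \<bar>x\<bar>"
  shows "x\<^sup>2 / e\<^sup>2 \<le> \<bar>x\<bar> powr (2 * s) / e powr (4 * s)"
proof -
  have x0: "0 < \<bar>x\<bar>" using x e by (meson less_trans zero_less_power)
  have "x\<^sup>2 / e\<^sup>2 \<le> \<bar>x\<bar> powr 2 / e powr 4"
  proof -
    have "e ^ 4 \<le> e ^ 2" using e by (intro power_decreasing) auto
    then have "x\<^sup>2 / e\<^sup>2 \<le> x\<^sup>2 / e ^ 4" using e by (intro divide_left_mono) auto
    also have "\<dots> = \<bar>x\<bar> powr 2 / e powr 4" using e x0 by (simp add: powr_numeral)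
    finally show ?thesis .
  qed
  also have "\<dots> = (\<bar>x\<bar> / e\<^sup>2) powr 2"
    using e x0 by (simp add: powr_divide powr_numeral power_mult[symmetric])
  also have "\<dots> \<le> (\<bar>x\<bar> / e\<^sup>2) powr (2 * s)"
    using s x e by (intro powr_mono) (auto simp: field_simps)
  also have "\<dots> = \<bar>x\<bar> powr (2 * s) / e powr (4 * s)"
  proof -
    have "(e\<^sup>2) powr (2 * s) = (e powr 2) powr (2 * s)" using e by (simp add: powr_numeral)
    also have "\<dots> = e powr (4 * s)" by (simp add: powr_powr)
    finally show ?thesis using e by (simp add: powr_divide)
  qed
  finally show ?thesis .
qed

text \<open>Small jumps are covered by the expansion along the clock, large ones by the expansion at a fixed time, and
a stopped walk contributes nothing.\<close>

lemma heat_step: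
  assumes e: "0 < e" "e \<le> 1/2" and s: "1 \<le> s"
  shows "\<bar>heat t e x (Suc k) - heat t e x k + x k * heat_slope t e x k\<bar>
    \<le> 8192 * e\<^sup>2 * (1 / sqrt (clock e x (Suc k)) - 1 / sqrt (clock e x k))
      + \<bar>x k\<bar> powr (2 * s) / e powr (4 * s)"
proof -
  define R S where "R = clock e x k" and "S = stopped_walk e x k"
  have R: "e\<^sup>2 \<le> R" "e\<^sup>2 \<le> clock e x (Suc k)" unfolding R_def by (rule clock_ge[OF e])+
  have e2: "0 < e\<^sup>2" using e by simp
  have R0: "0 < R" using R e2 by linarith
  have pw: "0 \<le> \<bar>x k\<bar> powr (2 * s) / e powr (4 * s)" by simp
  define b where "b = x k / sqrt R"
  define z where "z = (t - S) / sqrt R"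
  show ?thesis
  proof (cases "2 * e\<^sup>2 \<le> R")
    case False
    then show ?thesis unfolding heat_def heat_slope_def using R_def pw by simp
  next
    case act: True
    have slope: "x k * heat_slope t e x k = b * std_normal_density z"
      using act unfolding heat_slope_def R_def[symmetric] S_def[symmetric] b_def z_def by simp
    have h0: "heat t e x k = normal_cdf z" unfolding heat_def R_def[symmetric] S_def[symmetric] z_def ..
    have b2: "b\<^sup>2 = (x k)\<^sup>2 / R" unfolding b_def using R0 by (simp add: power_divide)
    show ?thesis
    proof (cases "\<bar>x k\<bar> \<le> e\<^sup>2")
      case small: True
      have R': "clock e x (Suc k) = R - (x k)\<^sup>2" using act small by (simp add: R_def[symmetric])
      have "(x k)\<^sup>2 \<le> (e\<^sup>2)\<^sup>2"
        using power_mono[OF small abs_ge_zero, of 2] by (simp only: power2_abs)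
      also have "\<dots> = e\<^sup>2 * e\<^sup>2" by (simp add: power2_eq_square)
      also have "\<dots> \<le> (1/2)\<^sup>2 * e\<^sup>2" using e by (intro mult_right_mono power_mono) auto
      also have "\<dots> \<le> R / 4" using act e2 by (simp add: power2_eq_square)
      finally have xR: "(x k)\<^sup>2 \<le> R / 4" .
      then have "b\<^sup>2 \<le> (1/2)\<^sup>2" unfolding b2 using R0 by (simp add: field_simps power2_eq_square)
      then have b12: "\<bar>b\<bar> \<le> 1/2" using abs_le_square_iff[of b "1/2"] by simp
      have "(t - (S + x k)) / sqrt (R - (x k)\<^sup>2) = (z - b) / sqrt (1 - b\<^sup>2)"
      proof -
        have "R - (x k)\<^sup>2 = R * (1 - b\<^sup>2)" unfolding b2 using R0 by (simp add: field_simps)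
        then have "sqrt (R - (x k)\<^sup>2) = sqrt R * sqrt (1 - b\<^sup>2)" by (simp add: real_sqrt_mult)
        moreover have "z - b = (t - (S + x k)) / sqrt R" unfolding z_def b_def
          by (simp add: diff_divide_distrib[symmetric])
        ultimately show ?thesis by simp
      qed
      then have h1: "heat t e x (Suc k) = normal_cdf ((z - b) / sqrt (1 - b\<^sup>2))"
        unfolding heat_def R' using act by (simp add: R_def[symmetric] S_def[symmetric])
      have "\<bar>heat t e x (Suc k) - heat t e x k + x k * heat_slope t e x k\<bar> \<le> 4096 * \<bar>b\<bar>^3"
        unfolding slope h0 h1 by (rule normal_cdf_clock_step[OF b12])
      also have "\<bar>b\<bar>^3 = \<bar>x k\<bar> * ((x k)\<^sup>2 / (R * sqrt R))"
        using R0 by (simp add: b_def power3_eq_cube power2_eq_square abs_mult_self_eq)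
      also have "\<dots> \<le> e\<^sup>2 * (2 * (1 / sqrt (R - (x k)\<^sup>2) - 1 / sqrt R))"
        using inverse_sqrt_diff_ge[of "R - (x k)\<^sup>2" R] xR R0 small
        by (intro mult_mono) auto
      finally show ?thesis unfolding R' R_def[symmetric] using pw by linarith
    next
      case large: False
      have R': "clock e x (Suc k) = R" using act large by (simp add: R_def[symmetric])
      have h1: "heat t e x (Suc k) = normal_cdf (z - b)"
        unfolding heat_def R' using act
        by (simp add: R_def[symmetric] S_def[symmetric] z_def b_def diff_divide_distrib[symmetric] diff_diff_eq)
      have "\<bar>heat t e x (Suc k) - heat t e x k + x k * heat_slope t e x k\<bar> \<le> b\<^sup>2 / 2"
        unfolding slope h0 h1 by (rule normal_cdf_taylor1)
      also have "\<dots> \<le> b\<^sup>2" by simp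
      also have "\<dots> \<le> (x k)\<^sup>2 / e\<^sup>2" unfolding b2 by (rule frac_le) (use R e2 in auto)
      also have "\<dots> \<le> \<bar>x k\<bar> powr (2 * s) / e powr (4 * s)"
        by (rule powr_gt_trade) (use e s large in auto)
      finally show ?thesis unfolding R' R_def[symmetric] by simp
    qed
  qed
qed

text \<open>The errors of the small jumps telescope, and the clock never falls below \<open>e\<^sup>2\<close>, so they cost \<open>e\<^sup>2 / e\<close> in total and not
a multiple of the number of steps.\<close>

lemma heat_telescope:
  assumes e: "0 < e" "e \<le> 1/2" and s: "1 \<le> s"
  shows "\<bar>heat t e x n - normal_cdf (t / sqrt (1 + 3 * e\<^sup>2)) + (\<Sum>k<n. x k * heat_slope t e x k)\<bar>
    \<le> 8192 * e + (\<Sum>k<n. \<bar>x k\<bar> powr (2 * s) / e powr (4 * s))"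
proof -
  have "\<bar>heat t e x n - normal_cdf (t / sqrt (1 + 3 * e\<^sup>2)) + (\<Sum>k<n. x k * heat_slope t e x k)\<bar>
    \<le> 8192 * e\<^sup>2 * (1 / sqrt (clock e x n) - 1 / sqrt (1 + 3 * e\<^sup>2))
      + (\<Sum>k<n. \<bar>x k\<bar> powr (2 * s) / e powr (4 * s))"
  proof (induction n)
    case (Suc n)
    then show ?case using heat_step[OF e s, of t x n] unfolding sum.lessThan_Suc right_diff_distrib
      by linarith
  qed (simp add: heat_def)
  moreover have "8192 * e\<^sup>2 * (1 / sqrt (clock e x n) - 1 / sqrt (1 + 3 * e\<^sup>2)) \<le> 8192 * e"
  proof -
    have "sqrt (e\<^sup>2) \<le> sqrt (clock e x n)" by (intro real_sqrt_le_mono clock_ge e)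
    then have "e \<le> sqrt (clock e x n)" using e by simp
    then have "1 / sqrt (clock e x n) \<le> 1 / e" using e by (intro frac_le) auto
    moreover have "0 \<le> 1 / sqrt (1 + 3 * e\<^sup>2)" by simp
    ultimately have "1 / sqrt (clock e x n) - 1 / sqrt (1 + 3 * e\<^sup>2) \<le> 1 / e" by linarith
    then have "8192 * e\<^sup>2 * (1 / sqrt (clock e x n) - 1 / sqrt (1 + 3 * e\<^sup>2)) \<le> 8192 * e\<^sup>2 * (1 / e)"
      by (intro mult_left_mono) auto
    then show ?thesis using e by (simp add: power2_eq_square)
  qed
  ultimately show ?thesis by linarith
qed

lemma clock_unstopped:
  assumes small: "\<And>k. k < n \<Longrightarrow> \<bar>x k\<bar> \<le> e\<^sup>2"
    and Q: "(\<Sum>k<n. (x k)\<^sup>2) \<le> 1 + e\<^sup>2" and k: "k \<le> n"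
  shows "clock e x k = 1 + 3 * e\<^sup>2 - (\<Sum>i<k. (x i)\<^sup>2)" "stopped_walk e x k = (\<Sum>i<k. x i)"
proof -
  have "clock e x k = 1 + 3 * e\<^sup>2 - (\<Sum>i<k. (x i)\<^sup>2) \<and> stopped_walk e x k = (\<Sum>i<k. x i)"
    using k
  proof (induction k)
    case (Suc k)
    have "(\<Sum>i<k. (x i)\<^sup>2) \<le> (\<Sum>i<n. (x i)\<^sup>2)" using Suc.prems by (intro sum_mono2) auto
    then have "2 * e\<^sup>2 \<le> clock e x k" using Suc Q by auto
    then show ?case using Suc small[of k] by auto
  qed auto
  then show "clock e x k = 1 + 3 * e\<^sup>2 - (\<Sum>i<k. (x i)\<^sup>2)" "stopped_walk e x k = (\<Sum>i<k. x i)"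
    by auto
qed

lemma measurable_clock:
  assumes "\<And>i. i < k \<Longrightarrow> (\<lambda>\<omega>. X i \<omega>) \<in> borel_measurable F"
  shows "(\<lambda>\<omega>. clock e (\<lambda>i. X i \<omega>) k) \<in> borel_measurable F"
    and "(\<lambda>\<omega>. stopped_walk e (\<lambda>i. X i \<omega>) k) \<in> borel_measurable F"
proof -
  have "(\<lambda>\<omega>. clock e (\<lambda>i. X i \<omega>) k) \<in> borel_measurable F
    \<and> (\<lambda>\<omega>. stopped_walk e (\<lambda>i. X i \<omega>) k) \<in> borel_measurable F"
    using assms
  proof (induction k)
    case (Suc k)
    then have [measurable]: "(\<lambda>\<omega>. clock e (\<lambda>i. X i \<omega>) k) \<in> borel_measurable F"
      "(\<lambda>\<omega>. stopped_walk e (\<lambda>i. X i \<omega>) k) \<in> borel_measurable F"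
      "X k \<in> borel_measurable F" by auto
    show ?case by simp
  qed auto
  then show "(\<lambda>\<omega>. clock e (\<lambda>i. X i \<omega>) k) \<in> borel_measurable F"
    "(\<lambda>\<omega>. stopped_walk e (\<lambda>i. X i \<omega>) k) \<in> borel_measurable F" by auto
qed

lemma measurable_normal_cdf [measurable]: "normal_cdf \<in> borel_measurable borel"
  by (intro borel_measurable_continuous_onI continuous_at_imp_continuous_on ballI
      DERIV_isCont[OF normal_cdf_deriv])

lemma heat_slope_bound:
  assumes e: "0 < e" "e \<le> 1/2"
  shows "\<bar>heat_slope t e x k\<bar> \<le> 1 / e"
proof -
  have "sqrt (e\<^sup>2) \<le> sqrt (clock e x k)" by (intro real_sqrt_le_mono clock_ge e)
  then have "e \<le> sqrt (clock e x k)" using e by simp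
  then have "std_normal_density u / sqrt (clock e x k) \<le> 1 / e" for u
    using e std_normal_density_le1 by (intro frac_le) auto
  moreover have "\<bar>sqrt (clock e x k)\<bar> = sqrt (clock e x k)"
    using \<open>e \<le> sqrt (clock e x k)\<close> e by linarith
  ultimately show ?thesis unfolding heat_slope_def using e by simp
qed

section \<open>A Berry--Esseen bound for martingales\<close>

context prob_space
begin

text \<open>The hypothesis on sets says that the conditional expectation of \<open>X\<close> vanishes.\<close>

lemma martingale_difference_orthogonal:
  fixes X g :: "'a \<Rightarrow> real"
  assumes sub: "subalgebra M F"
    and int: "integrable M X"
    and diff: "\<And>A. A \<in> sets F \<Longrightarrow> (\<integral>x\<in>A. X x \<partial>M) = 0"
    and g: "g \<in> borel_measurable F" and bd: "\<And>x. \<bar>g x\<bar> \<le> C"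
  shows "integrable M (\<lambda>x. X x * g x)" "(\<integral>x. X x * g x \<partial>M) = 0"
proof -
  interpret F: finite_measure_subalgebra M F by unfold_locales (rule sub)
  have gM: "g \<in> borel_measurable M" by (rule measurable_from_subalg[OF sub g])
  have ae: "AE x in M. real_cond_exp M F X x = 0"
    by (rule F.real_cond_exp_charact) (use int diff in \<open>auto simp: set_lebesgue_integral_def\<close>)
  have i: "integrable M (\<lambda>x. g x * X x)"
    by (rule Bochner_Integration.integrable_bound[OF integrable_mult_right[OF int, of C]])
       (use gM int bd in \<open>auto simp: abs_mult intro!: mult_right_mono AE_I2 order_trans[OF bd abs_ge_self]\<close>)
  have "(\<integral>x. g x * X x \<partial>M) = (\<integral>x. g x * real_cond_exp M F X x \<partial>M)"
    using F.real_cond_exp_intg(2)[OF i g] int by simp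
  also have "\<dots> = 0"
    by (rule integral_eq_zero_AE) (use ae in auto)
  finally have "(\<integral>x. g x * X x \<partial>M) = 0" .
  then show "(\<integral>x. X x * g x \<partial>M) = 0" by (simp add: mult.commute)
  show "integrable M (\<lambda>x. X x * g x)" using i by (simp add: mult.commute)
qed

lemma integrable_of_integrable_powr:
  fixes f :: "'a \<Rightarrow> real"
  assumes f: "f \<in> borel_measurable M" and i: "integrable M (\<lambda>x. \<bar>f x\<bar> powr q)" and q: "1 \<le> q"
  shows "integrable M f"
proof (rule Bochner_Integration.integrable_bound[OF _ f])
  show "integrable M (\<lambda>x. 1 + \<bar>f x\<bar> powr q)" using i by simp
  have "\<bar>f x\<bar> \<le> 1 + \<bar>f x\<bar> powr q" for x
  proof (cases "\<bar>f x\<bar> \<le> 1")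
    case False
    then have "\<bar>f x\<bar> powr 1 \<le> \<bar>f x\<bar> powr q" using q by (intro powr_mono) auto
    then show ?thesis using False by simp
  qed (simp add: add_increasing2)
  then show "AE x in M. norm (f x) \<le> norm (1 + \<bar>f x\<bar> powr q)"
    by (auto intro!: AE_I2 order_trans[OF _ abs_ge_self])
qed

text \<open>Markov's inequality for a moment of real order.\<close>

lemma prob_abs_gt_le_powr_moment:
  assumes f: "f \<in> borel_measurable M" and i: "integrable M (\<lambda>x. \<bar>f x\<bar> powr q)"
    and q: "0 < q" and c: "0 < c"
  shows "prob {x \<in> space M. c < \<bar>f x\<bar>} \<le> (\<integral>x. \<bar>f x\<bar> powr q \<partial>M) / c powr q"
proof -
  have "prob {x \<in> space M. c < \<bar>f x\<bar>} \<le> prob {x \<in> space M. c powr q \<le> \<bar>f x\<bar> powr q}"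
    using f c q by (intro finite_measure_mono) (auto intro!: powr_mono2)
  also have "\<dots> \<le> (\<integral>x. \<bar>f x\<bar> powr q \<partial>M) / c powr q"
    by (rule integral_Markov_inequality_measure[OF i, of "{}"]) (use c in auto)
  finally show ?thesis .
qed

text \<open>Taking expectations in \<open>heat_telescope\<close> removes the martingale part, so the mean of \<open>heat\<close> is close to
\<open>\<Phi>(t / sqrt (1 + 3 e\<^sup>2))\<close>. Outside the exceptional events the walk was never stopped and the clock ends in \<open>(0, 4 e\<^sup>2]\<close>, so
there \<open>heat\<close> at \<open>t + 2 y\<close> and at \<open>t - 2 y\<close> encloses the indicator of \<open>\<Sum> X_k + W \<le> t\<close> up to the Gaussian tail at
\<open>y / (2 e)\<close>; one \<open>y\<close> is spent on \<open>W\<close> and one on the smoothing.\<close>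

theorem martingale_berry_esseen:
  fixes X :: "nat \<Rightarrow> 'a \<Rightarrow> real" and F :: "nat \<Rightarrow> 'a measure"
  assumes sub: "\<And>k. k < n \<Longrightarrow> subalgebra M (F k)"
    and adapted: "\<And>i k. i < k \<Longrightarrow> k < n \<Longrightarrow> X i \<in> borel_measurable (F k)"
    and X: "\<And>k. k < n \<Longrightarrow> X k \<in> borel_measurable M"
    and mom: "\<And>k. k < n \<Longrightarrow> integrable M (\<lambda>x. \<bar>X k x\<bar> powr (2 * s))"
    and diff: "\<And>k A. k < n \<Longrightarrow> A \<in> sets (F k) \<Longrightarrow> (\<integral>x\<in>A. X k x \<partial>M) = 0"
    and W: "W \<in> borel_measurable M"
    and s: "1 \<le> s" and e: "0 < e" "e \<le> 1/2" and y: "0 < y"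
  shows "\<bar>prob {x \<in> space M. (\<Sum>k<n. X k x) + W x \<le> t} - normal_cdf t\<bar>
    \<le> 8193 * e + 2 * y + (1 - normal_cdf (y / (2 * e)))
      + 2 * ((\<Sum>k<n. \<integral>x. \<bar>X k x\<bar> powr (2 * s) \<partial>M) / e powr (4 * s))
      + prob {x \<in> space M. e\<^sup>2 < \<bar>(\<Sum>k<n. (X k x)\<^sup>2) - 1\<bar>}
      + prob {x \<in> space M. y < \<bar>W x\<bar>}"
proof -
  interpret N: real_distribution std_normal_distribution by (rule real_dist_normal_dist)
  note [measurable] = X W
  define U where "U = (\<lambda>t x. heat t e (\<lambda>i. X i x) n)"
  define L where "L = (\<Sum>k<n. \<integral>x. \<bar>X k x\<bar> powr (2 * s) \<partial>M) / e powr (4 * s)"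
  define K where "K = sqrt (1 + 3 * e\<^sup>2)"
  define \<eta> where "\<eta> = 1 - normal_cdf (y / (2 * e))"
  have Xint: "integrable M (X k)" if "k < n" for k
    by (rule integrable_of_integrable_powr[OF X mom]) (use that s in auto)
  have cl[measurable]: "(\<lambda>x. clock e (\<lambda>i. X i x) n) \<in> borel_measurable M"
    "(\<lambda>x. stopped_walk e (\<lambda>i. X i x) n) \<in> borel_measurable M"
    by (rule measurable_clock; use X in simp)+
  have U_meas[measurable]: "U t \<in> borel_measurable M" for t
    unfolding U_def heat_def by measurable
  have U01: "0 \<le> U t x" "U t x \<le> 1" for t x
    unfolding U_def heat_def by (auto simp: N.cdf_nonneg N.cdf_bounded_prob)
  have U_int: "integrable M (U t)" for t
    by (rule integrable_const_bound[of _ 1]) (auto simp: U01)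
  have slope: "integrable M (\<lambda>x. X k x * heat_slope t e (\<lambda>i. X i x) k)"
    "(\<integral>x. X k x * heat_slope t e (\<lambda>i. X i x) k \<partial>M) = 0" if "k < n" for k t
  proof -
    have [measurable]: "(\<lambda>x. clock e (\<lambda>i. X i x) k) \<in> borel_measurable (F k)"
      "(\<lambda>x. stopped_walk e (\<lambda>i. X i x) k) \<in> borel_measurable (F k)"
      by (rule measurable_clock; use adapted that in simp)+
    have g: "(\<lambda>x. heat_slope t e (\<lambda>i. X i x) k) \<in> borel_measurable (F k)"
      unfolding heat_slope_def by measurable
    show "integrable M (\<lambda>x. X k x * heat_slope t e (\<lambda>i. X i x) k)"
      "(\<integral>x. X k x * heat_slope t e (\<lambda>i. X i x) k \<partial>M) = 0"
      using martingale_difference_orthogonal[OF sub[OF that] Xint[OF that] diff[OF that] g heat_slope_bound[OF e]]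
      by auto
  qed
  \<comment> \<open>Lindeberg: only the starting value and the error terms survive the expectation.\<close>
  have lind: "\<bar>expectation (U t) - normal_cdf (t / K)\<bar> \<le> 8192 * e + L" for t
  proof -
    define D where "D = (\<lambda>x. U t x - normal_cdf (t / K) + (\<Sum>k<n. X k x * heat_slope t e (\<lambda>i. X i x) k))"
    have sl: "integrable M (\<lambda>x. \<Sum>k<n. X k x * heat_slope t e (\<lambda>i. X i x) k)"
      by (intro Bochner_Integration.integrable_sum slope) auto
    have UK: "integrable M (\<lambda>x. U t x - normal_cdf (t / K))" using U_int by simp
    have "integrable M D" unfolding D_def by (intro Bochner_Integration.integrable_add sl UK)
    have "expectation (\<lambda>x. \<Sum>k<n. X k x * heat_slope t e (\<lambda>i. X i x) k) = 0"
      using slope by (subst Bochner_Integration.integral_sum) auto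
    then have "expectation D = expectation (U t) - normal_cdf (t / K)"
      unfolding D_def using U_int by (simp add: Bochner_Integration.integral_add[OF UK sl] prob_space)
    moreover have "\<bar>expectation D\<bar> \<le> expectation (\<lambda>x. \<bar>D x\<bar>)" by (rule integral_abs_bound)
    moreover have "expectation (\<lambda>x. \<bar>D x\<bar>)
        \<le> expectation (\<lambda>x. 8192 * e + (\<Sum>k<n. \<bar>X k x\<bar> powr (2 * s) / e powr (4 * s)))"
    proof (rule integral_mono)
      show "integrable M (\<lambda>x. 8192 * e + (\<Sum>k<n. \<bar>X k x\<bar> powr (2 * s) / e powr (4 * s)))"
        using mom by (intro Bochner_Integration.integrable_add Bochner_Integration.integrable_sum) auto
      show "integrable M (\<lambda>x. \<bar>D x\<bar>)" using \<open>integrable M D\<close> by simp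
      show "\<bar>D x\<bar> \<le> 8192 * e + (\<Sum>k<n. \<bar>X k x\<bar> powr (2 * s) / e powr (4 * s))" for x
        unfolding D_def U_def K_def by (rule heat_telescope[OF e s])
    qed
    moreover have "expectation (\<lambda>x. 8192 * e + (\<Sum>k<n. \<bar>X k x\<bar> powr (2 * s) / e powr (4 * s))) = 8192 * e + L"
    proof -
      have i: "integrable M (\<lambda>x. \<bar>X k x\<bar> powr (2 * s) / e powr (4 * s))" if "k < n" for k
        using mom[OF that] by simp
      have "integrable M (\<lambda>x. \<Sum>k<n. \<bar>X k x\<bar> powr (2 * s) / e powr (4 * s))"
        using i by (intro Bochner_Integration.integrable_sum) auto
      then have "expectation (\<lambda>x. 8192 * e + (\<Sum>k<n. \<bar>X k x\<bar> powr (2 * s) / e powr (4 * s)))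
        = 8192 * e + expectation (\<lambda>x. \<Sum>k<n. \<bar>X k x\<bar> powr (2 * s) / e powr (4 * s))"
        by (simp add: prob_space)
      also have "expectation (\<lambda>x. \<Sum>k<n. \<bar>X k x\<bar> powr (2 * s) / e powr (4 * s))
        = (\<Sum>k<n. expectation (\<lambda>x. \<bar>X k x\<bar> powr (2 * s) / e powr (4 * s)))"
        using i by (intro Bochner_Integration.integral_sum) auto
      finally show ?thesis unfolding L_def by (simp add: sum_divide_distrib)
    qed
    ultimately show ?thesis by linarith
  qed
  have K: "1 \<le> K" "K - 1 \<le> e"
  proof -
    have "e * e \<le> e * 1" using e by (intro mult_left_mono) auto
    then have "1 + 3 * e\<^sup>2 \<le> (1 + e)\<^sup>2" using e by (simp add: power2_eq_square algebra_simps)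
    then have "K \<le> sqrt ((1 + e)\<^sup>2)" unfolding K_def by (rule real_sqrt_le_mono)
    then show "K - 1 \<le> e" using e by simp
    show "1 \<le> K" unfolding K_def by simp
  qed
  have gauss: "\<bar>normal_cdf (u / K) - normal_cdf t\<bar> \<le> e + \<bar>u - t\<bar>" for u
    using normal_cdf_scale[OF K(1), of u] K(2) normal_cdf_lipschitz[of u t] by linarith
  define BQ where "BQ = {x \<in> space M. e\<^sup>2 < \<bar>(\<Sum>k<n. (X k x)\<^sup>2) - 1\<bar>}"
  define BW where "BW = {x \<in> space M. y < \<bar>W x\<bar>}"
  define BX where "BX = (\<Union>k<n. {x \<in> space M. e\<^sup>2 < \<bar>X k x\<bar>})"
  define B where "B = BX \<union> BQ \<union> BW"
  have BX1: "{x \<in> space M. e\<^sup>2 < \<bar>X k x\<bar>} \<in> events" if "k < n" for k using X[OF that] by measurable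
  have sets[measurable]: "BQ \<in> events" "BW \<in> events" "BX \<in> events"
    unfolding BQ_def BW_def BX_def using BX1 by auto
  have [measurable]: "B \<in> events" unfolding B_def by measurable
  have PB: "prob B \<le> L + prob BQ + prob BW"
  proof -
    have "prob B \<le> prob (BX \<union> BQ) + prob BW" unfolding B_def by (rule measure_Un_le) auto
    also have "prob (BX \<union> BQ) \<le> prob BX + prob BQ" by (rule measure_Un_le) auto
    also have "prob BX \<le> (\<Sum>k<n. prob {x \<in> space M. e\<^sup>2 < \<bar>X k x\<bar>})"
      unfolding BX_def by (rule finite_measure_subadditive_finite) (use BX1 in auto)
    also have "\<dots> \<le> (\<Sum>k<n. (\<integral>x. \<bar>X k x\<bar> powr (2 * s) \<partial>M) / (e\<^sup>2) powr (2 * s))"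
      by (intro sum_mono prob_abs_gt_le_powr_moment mom X) (use s e in auto)
    also have "(e\<^sup>2) powr (2 * s) = e powr (4 * s)"
    proof -
      have "(e\<^sup>2) powr (2 * s) = (e powr 2) powr (2 * s)" using e by (simp add: powr_numeral)
      then show ?thesis by (simp add: powr_powr)
    qed
    finally show ?thesis unfolding L_def sum_divide_distrib by simp
  qed
  have good: "y / (2 * e) \<le> (u - S) / sqrt R" if "S + y \<le> u" "0 < R" "R \<le> 4 * e\<^sup>2" for u S R
  proof -
    have "sqrt R \<le> sqrt (4 * e\<^sup>2)" using that by simp
    also have "\<dots> = 2 * e" using e by (simp add: real_sqrt_mult)
    finally show ?thesis using that y by (intro frac_le) auto
  qed
  have pathwise: "S = (\<Sum>k<n. X k x)" "0 < R" "R \<le> 4 * e\<^sup>2" "\<bar>W x\<bar> \<le> y"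
    if "x \<in> space M" "x \<notin> B" and "S = stopped_walk e (\<lambda>i. X i x) n" "R = clock e (\<lambda>i. X i x) n"
    for x S R
  proof -
    have sm: "\<And>k. k < n \<Longrightarrow> \<bar>X k x\<bar> \<le> e\<^sup>2" and Q: "\<bar>(\<Sum>k<n. (X k x)\<^sup>2) - 1\<bar> \<le> e\<^sup>2"
      and w: "\<bar>W x\<bar> \<le> y"
      using that unfolding B_def BX_def BQ_def BW_def by (auto simp: not_less)
    have "(\<Sum>k<n. (X k x)\<^sup>2) \<le> 1 + e\<^sup>2" using Q by linarith
    note u = clock_unstopped[of n "\<lambda>i. X i x" e n, OF sm this order_refl]
    show "S = (\<Sum>k<n. X k x)" using u(2) that by simp
    have e2: "0 < e\<^sup>2" using e by simp
    have "R = 1 + 3 * e\<^sup>2 - (\<Sum>k<n. (X k x)\<^sup>2)" using u(1) that by simp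
    then show "0 < R" "R \<le> 4 * e\<^sup>2" using Q e2 by linarith+
    show "\<bar>W x\<bar> \<le> y" by (rule w)
  qed
  define A where "A = {x \<in> space M. (\<Sum>k<n. X k x) + W x \<le> t}"
  have [measurable]: "A \<in> events" unfolding A_def by measurable
  have iB: "integrable M (indicator B :: 'a \<Rightarrow> real)" "integrable M (indicator A :: 'a \<Rightarrow> real)"
    by (auto intro!: integrable_real_indicator simp: emeasure_eq_measure)
  have \<eta>0: "0 \<le> \<eta>" unfolding \<eta>_def using N.cdf_bounded_prob by simp
  have upper: "prob A \<le> expectation (U (t + 2 * y)) + \<eta> + prob B"
  proof -
    have "expectation (indicator A) \<le> expectation (\<lambda>x. U (t + 2 * y) x + \<eta> + indicator B x)"
    proof (rule integral_mono)
      fix x assume x: "x \<in> space M"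
      show "indicator A x \<le> U (t + 2 * y) x + \<eta> + indicator B x"
      proof (cases "x \<in> A \<and> x \<notin> B")
        case True
        note p = pathwise[OF x conjunct2[OF True] refl refl]
        have "y / (2 * e) \<le> (t + 2 * y - stopped_walk e (\<lambda>i. X i x) n) / sqrt (clock e (\<lambda>i. X i x) n)"
          using p True unfolding A_def by (intro good) auto
        then have "1 - \<eta> \<le> U (t + 2 * y) x"
          unfolding \<eta>_def U_def heat_def by (simp add: N.cdf_nondecreasing)
        then show ?thesis using True by simp
      qed (use U01[of "t + 2 * y" x] \<eta>0 in \<open>auto simp: indicator_def\<close>)
    qed (use U_int iB in auto)
    also have "\<dots> = expectation (U (t + 2 * y)) + \<eta> + prob B"
      using U_int iB by (simp add: prob_space)
    finally show ?thesis by simp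
  qed
  have lower: "expectation (U (t - 2 * y)) - \<eta> - prob B \<le> prob A"
  proof -
    have "expectation (\<lambda>x. U (t - 2 * y) x - \<eta> - indicator B x) \<le> expectation (indicator A)"
    proof (rule integral_mono)
      fix x assume x: "x \<in> space M"
      show "U (t - 2 * y) x - \<eta> - indicator B x \<le> indicator A x"
      proof (cases "x \<notin> A \<and> x \<notin> B")
        case True
        note p = pathwise[OF x conjunct2[OF True] refl refl]
        have "y / (2 * e) \<le> (- (t - 2 * y) - (- stopped_walk e (\<lambda>i. X i x) n)) / sqrt (clock e (\<lambda>i. X i x) n)"
          using p True x unfolding A_def by (intro good) auto
        then have "(t - 2 * y - stopped_walk e (\<lambda>i. X i x) n) / sqrt (clock e (\<lambda>i. X i x) n) \<le> - (y / (2 * e))"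
          by (simp add: diff_divide_distrib add_divide_distrib)
        then have "U (t - 2 * y) x \<le> \<eta>"
          unfolding \<eta>_def U_def heat_def normal_cdf_symmetric[symmetric] by (rule N.cdf_nondecreasing)
        then show ?thesis using True by simp
      qed (use U01[of "t - 2 * y" x] \<eta>0 in \<open>auto simp: indicator_def\<close>)
    qed (use U_int iB in auto)
    also have "expectation (\<lambda>x. U (t - 2 * y) x - \<eta> - indicator B x) = expectation (U (t - 2 * y)) - \<eta> - prob B"
      using U_int iB by (simp add: prob_space)
    finally show ?thesis by simp
  qed
  have "\<bar>prob A - normal_cdf t\<bar> \<le> 8193 * e + 2 * y + \<eta> + 2 * L + prob BQ + prob BW"
    using upper lower lind[of "t + 2 * y"] lind[of "t - 2 * y"] gauss[of "t + 2 * y"] gauss[of "t - 2 * y"] PB y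
    by (simp add: abs_le_iff)
  then show ?thesis unfolding A_def \<eta>_def L_def BQ_def BW_def .
qed

end

section \<open>The martingale decomposition along one orbit\<close>

lemma bdd_measurable_iff:
  "bdd_measurable N g \<longleftrightarrow> g \<in> borel_measurable N \<and> (\<exists>C. \<forall>x\<in>space N. \<bar>g x\<bar> \<le> C)"
  unfolding bdd_measurable_def bounded_iff by auto

lemma bdd_measurable_const: "bdd_measurable N (\<lambda>x. c)"
  unfolding bdd_measurable_iff by auto

lemma bdd_measurable_add:
  assumes "bdd_measurable N f" "bdd_measurable N g" shows "bdd_measurable N (\<lambda>x. f x + g x)"
proof -
  from assms obtain C D where "\<forall>x\<in>space N. \<bar>f x\<bar> \<le> C" "\<forall>x\<in>space N. \<bar>g x\<bar> \<le> D"
    unfolding bdd_measurable_iff by auto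
  then have "\<forall>x\<in>space N. \<bar>f x + g x\<bar> \<le> C + D" by (meson abs_triangle_ineq add_mono order_trans)
  then show ?thesis using assms unfolding bdd_measurable_iff by auto
qed

lemma bdd_measurable_mult:
  assumes "bdd_measurable N f" "bdd_measurable N g" shows "bdd_measurable N (\<lambda>x. f x * g x)"
proof -
  from assms obtain C D where "\<forall>x\<in>space N. \<bar>f x\<bar> \<le> C" "\<forall>x\<in>space N. \<bar>g x\<bar> \<le> D"
    unfolding bdd_measurable_iff by auto
  then have "\<forall>x\<in>space N. \<bar>f x * g x\<bar> \<le> C * D"
    unfolding abs_mult by (meson abs_ge_zero mult_mono order_trans)
  then show ?thesis using assms unfolding bdd_measurable_iff by auto
qed

lemma bdd_measurable_diff:
  assumes "bdd_measurable N f" "bdd_measurable N g" shows "bdd_measurable N (\<lambda>x. f x - g x)"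
  using bdd_measurable_add[OF assms(1) bdd_measurable_mult[OF bdd_measurable_const[of _ "-1"] assms(2)]]
  by simp

lemma bdd_measurable_sum:
  assumes "\<And>i. i \<in> I \<Longrightarrow> bdd_measurable N (f i)" shows "bdd_measurable N (\<lambda>x. \<Sum>i\<in>I. f i x)"
  using assms by (induction I rule: infinite_finite_induct)
    (auto intro: bdd_measurable_const bdd_measurable_add)

lemma bdd_measurable_power2:
  "bdd_measurable N f \<Longrightarrow> bdd_measurable N (\<lambda>x. (f x)\<^sup>2)"
  unfolding power2_eq_square by (rule bdd_measurable_mult)

lemma bdd_measurable_powr:
  assumes "bdd_measurable N f" "0 \<le> u" shows "bdd_measurable N (\<lambda>x. \<bar>f x\<bar> powr u)"
proof -
  from assms obtain C where "\<forall>x\<in>space N. \<bar>f x\<bar> \<le> C"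
    unfolding bdd_measurable_iff by auto
  then have "\<forall>x\<in>space N. \<bar>\<bar>f x\<bar> powr u\<bar> \<le> C powr u" using assms(2) by (auto intro!: powr_mono2)
  then show ?thesis using assms unfolding bdd_measurable_iff by auto
qed

lemma bdd_measurable_compose:
  assumes "bdd_measurable N' g" "F \<in> measurable N N'" shows "bdd_measurable N (\<lambda>x. g (F x))"
proof -
  have "(\<lambda>x. g (F x)) \<in> borel_measurable N"
    using assms measurable_compose[OF assms(2)] unfolding bdd_measurable_iff by auto
  then show ?thesis using assms measurable_space[OF assms(2)] unfolding bdd_measurable_iff by fastforce
qed

lemma bdd_measurable_indicator: "A \<in> sets N \<Longrightarrow> bdd_measurable N (indicator A)"
  unfolding bdd_measurable_iff by (auto intro!: exI[of _ 1] simp: indicator_def)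

lemma (in prob_space) bdd_measurable_integrable: "bdd_measurable M g \<Longrightarrow> integrable M g"
  unfolding bdd_measurable_iff using integrable_const_bound[of g] by auto

lemmas bdd_measurable_intros = bdd_measurable_const bdd_measurable_add bdd_measurable_mult
  bdd_measurable_diff bdd_measurable_sum bdd_measurable_power2 bdd_measurable_powr
  bdd_measurable_indicator

text \<open>The orbit of a single \<open>\<omega>\<close> on which the almost sure hypotheses hold at every fibre, not only at the first one. The
decomposition and the rate are proved for such an orbit; the quantifier over almost every \<open>\<omega>\<close> enters at the end.\<close>

locale transfer_orbit =
  fixes \<sigma> :: "'w \<Rightarrow> 'w"
    and T :: "'w \<Rightarrow> 'm \<Rightarrow> 'm"
    and \<mu> :: "'w \<Rightarrow> 'm measure"
    and L :: "'w \<Rightarrow> ('m \<Rightarrow> real) \<Rightarrow> 'm \<Rightarrow> real"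
    and \<phi> :: "'w \<Rightarrow> 'm \<Rightarrow> real"
    and \<omega> :: 'w
  assumes fibre_prob: "\<And>k. prob_space (\<mu> ((\<sigma> ^^ k) \<omega>))"
    and fibre_map: "\<And>k. T ((\<sigma> ^^ k) \<omega>) \<in> measurable (\<mu> ((\<sigma> ^^ k) \<omega>)) (\<mu> ((\<sigma> ^^ Suc k) \<omega>))"
    and fibre_distr: "\<And>k. distr (\<mu> ((\<sigma> ^^ k) \<omega>)) (\<mu> ((\<sigma> ^^ Suc k) \<omega>)) (T ((\<sigma> ^^ k) \<omega>))
        = \<mu> ((\<sigma> ^^ Suc k) \<omega>)"
    and fibre_transfer: "\<And>k. is_transfer_operator (\<mu> ((\<sigma> ^^ k) \<omega>)) (\<mu> ((\<sigma> ^^ Suc k) \<omega>))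
        (T ((\<sigma> ^^ k) \<omega>)) (L ((\<sigma> ^^ k) \<omega>))"
    and fibre_obs: "\<And>k. bdd_measurable (\<mu> ((\<sigma> ^^ k) \<omega>)) (\<phi> ((\<sigma> ^^ k) \<omega>))"
    and fibre_mean: "\<And>k. (\<integral>x. \<phi> ((\<sigma> ^^ k) \<omega>) x \<partial>\<mu> ((\<sigma> ^^ k) \<omega>)) = 0"
begin

abbreviation "N k \<equiv> \<mu> ((\<sigma> ^^ k) \<omega>)"
abbreviation "\<theta> k \<equiv> T ((\<sigma> ^^ k) \<omega>)"
abbreviation "f k \<equiv> \<phi> ((\<sigma> ^^ k) \<omega>)"
abbreviation "Lit j m \<equiv> L_iter \<sigma> L ((\<sigma> ^^ j) \<omega>) m"
abbreviation "Tit k \<equiv> T_iter \<sigma> T \<omega> k"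
abbreviation "G n \<equiv> G_fun \<sigma> L \<phi> \<omega> n"
abbreviation "H n \<equiv> H_fun \<sigma> T L \<phi> \<omega> n"

lemma bdd_integrable: "bdd_measurable (N k) g \<Longrightarrow> integrable (N k) g"
  by (rule prob_space.bdd_measurable_integrable[OF fibre_prob])

lemma transfer_bdd: "bdd_measurable (N k) g \<Longrightarrow> bdd_measurable (N (Suc k)) (L ((\<sigma> ^^ k) \<omega>) g)"
  using fibre_transfer[of k] unfolding is_transfer_operator_def by auto

lemma transfer_eq:
  "bdd_measurable (N k) g \<Longrightarrow> bdd_measurable (N (Suc k)) h \<Longrightarrow>
    (\<integral>x. g x * h (\<theta> k x) \<partial>N k) = (\<integral>y. L ((\<sigma> ^^ k) \<omega>) g y * h y \<partial>N (Suc k))"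
  using fibre_transfer[of k] unfolding is_transfer_operator_def by auto

lemma Lit_Suc: "Lit j (Suc m) g = L ((\<sigma> ^^ (j + m)) \<omega>) (Lit j m g)"
  by (simp add: funpow_add add.commute[of j m] del: funpow.simps)

lemma Lit_bdd: "bdd_measurable (N j) g \<Longrightarrow> bdd_measurable (N (j + m)) (Lit j m g)"
proof (induction m)
  case (Suc m)
  then have "bdd_measurable (N (Suc (j + m))) (L ((\<sigma> ^^ (j + m)) \<omega>) (Lit j m g))"
    by (intro transfer_bdd) auto
  then show ?case unfolding Lit_Suc by simp
qed simp

lemma integral_Lit:
  "bdd_measurable (N j) g \<Longrightarrow> (\<integral>x. Lit j m g x \<partial>N (j + m)) = (\<integral>x. g x \<partial>N j)"
proof (induction m)
  case (Suc m)
  have "(\<integral>x. Lit j (Suc m) g x \<partial>N (j + Suc m)) = (\<integral>x. Lit j m g x \<partial>N (j + m))"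
    using transfer_eq[OF Lit_bdd[OF Suc.prems, of m] bdd_measurable_const[of _ 1]]
    unfolding Lit_Suc by simp
  then show ?case using Suc by simp
qed simp

lemma Lit_obs_bdd:
  assumes "j \<le> n" shows "bdd_measurable (N n) (Lit j (n - j) (f j))"
  using Lit_bdd[OF fibre_obs, of j "n - j"] assms by simp

lemma integral_Lit_obs:
  assumes "j \<le> n" shows "(\<integral>x. Lit j (n - j) (f j) x \<partial>N n) = 0"
  using integral_Lit[OF fibre_obs, of j "n - j"] assms fibre_mean by simp

lemma G_bdd: "bdd_measurable (N n) (G n)"
proof -
  have "bdd_measurable (N n) (\<lambda>x. \<Sum>j<n. Lit j (n - j) (f j) x)"
    by (intro bdd_measurable_sum Lit_obs_bdd) auto
  then show ?thesis by (simp add: G_fun_def[abs_def])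
qed

lemma H_bdd: "bdd_measurable (N n) (H n)"
proof -
  have "bdd_measurable (N n) (\<lambda>x. f n x + G n x - G (Suc n) (\<theta> n x))"
    by (intro bdd_measurable_intros fibre_obs G_bdd bdd_measurable_compose[OF G_bdd fibre_map])
  then show ?thesis by (simp add: H_fun_def[abs_def])
qed

lemma integral_compose_map:
  assumes "bdd_measurable (N (Suc k)) h"
  shows "(\<integral>x. h (\<theta> k x) \<partial>N k) = (\<integral>x. h x \<partial>N (Suc k))"
proof -
  have "(\<integral>x. h x \<partial>distr (N k) (N (Suc k)) (\<theta> k)) = (\<integral>x. h (\<theta> k x) \<partial>N k)"
    by (rule integral_distr[OF fibre_map]) (use assms in \<open>simp add: bdd_measurable_iff\<close>)
  then show ?thesis unfolding fibre_distr by simp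
qed

text \<open>This is \<open>L (\<phi>_n + G_n) = G_{n+1}\<close> tested against \<open>h\<close>. A choice of representatives \<open>L\<close> is additive only up to null sets,
so the duality is applied to each summand \<open>L^{n-j} \<phi>_j\<close> separately.\<close>

lemma integral_G_transfer:
  assumes h: "bdd_measurable (N (Suc n)) h"
  shows "(\<integral>x. (f n x + G n x) * h (\<theta> n x) \<partial>N n) = (\<integral>y. G (Suc n) y * h y \<partial>N (Suc n))"
proof -
  have hc: "bdd_measurable (N n) (\<lambda>x. h (\<theta> n x))" by (rule bdd_measurable_compose[OF h fibre_map])
  have lit: "(\<integral>x. Lit j (n - j) (f j) x * h (\<theta> n x) \<partial>N n)
      = (\<integral>y. Lit j (Suc n - j) (f j) y * h y \<partial>N (Suc n))" if "j \<le> n" for j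
    using transfer_eq[OF Lit_obs_bdd[OF that] h] Lit_Suc[of j "n - j" "f j"] that
    by (simp add: Suc_diff_le)
  have "(\<integral>x. (f n x + G n x) * h (\<theta> n x) \<partial>N n)
      = (\<integral>x. (\<Sum>j<Suc n. Lit j (n - j) (f j) x * h (\<theta> n x)) \<partial>N n)"
    by (intro Bochner_Integration.integral_cong refl)
      (simp add: G_fun_def sum_distrib_right distrib_right)
  also have "\<dots> = (\<Sum>j<Suc n. \<integral>x. Lit j (n - j) (f j) x * h (\<theta> n x) \<partial>N n)"
    by (intro Bochner_Integration.integral_sum bdd_integrable bdd_measurable_mult Lit_obs_bdd hc) auto
  also have "\<dots> = (\<Sum>j<Suc n. \<integral>y. Lit j (Suc n - j) (f j) y * h y \<partial>N (Suc n))"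
    by (intro sum.cong lit) auto
  also have "\<dots> = (\<integral>y. (\<Sum>j<Suc n. Lit j (Suc n - j) (f j) y * h y) \<partial>N (Suc n))"
    by (intro Bochner_Integration.integral_sum[symmetric] bdd_integrable bdd_measurable_mult Lit_obs_bdd h) auto
  also have "\<dots> = (\<integral>y. G (Suc n) y * h y \<partial>N (Suc n))"
    by (simp only: G_fun_def sum_distrib_right)
  finally show ?thesis .
qed

lemma H_orthogonal:
  assumes h: "bdd_measurable (N (Suc n)) h"
  shows "(\<integral>x. H n x * h (\<theta> n x) \<partial>N n) = 0"
proof -
  have hc: "bdd_measurable (N n) (\<lambda>x. h (\<theta> n x))" by (rule bdd_measurable_compose[OF h fibre_map])
  have Gh: "bdd_measurable (N (Suc n)) (\<lambda>y. G (Suc n) y * h y)"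
    by (intro bdd_measurable_mult G_bdd h)
  have "(\<integral>x. H n x * h (\<theta> n x) \<partial>N n)
    = (\<integral>x. (f n x + G n x) * h (\<theta> n x) - G (Suc n) (\<theta> n x) * h (\<theta> n x) \<partial>N n)"
    by (simp add: H_fun_def algebra_simps)
  also have "\<dots> = (\<integral>x. (f n x + G n x) * h (\<theta> n x) \<partial>N n)
      - (\<integral>x. G (Suc n) (\<theta> n x) * h (\<theta> n x) \<partial>N n)"
    by (intro Bochner_Integration.integral_diff bdd_integrable bdd_measurable_mult bdd_measurable_add
        fibre_obs G_bdd hc bdd_measurable_compose[OF G_bdd fibre_map])
  finally show ?thesis using integral_G_transfer[OF h] integral_compose_map[OF Gh] by simp
qed

lemma Tit_measurable: "Tit k \<in> measurable (N 0) (N k)"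
proof (induction k)
  case (Suc k)
  show ?case unfolding T_iter.simps by (rule measurable_comp[OF Suc fibre_map])
qed simp

lemma integral_Tit:
  "bdd_measurable (N k) h \<Longrightarrow> (\<integral>x. h (Tit k x) \<partial>N 0) = (\<integral>x. h x \<partial>N k)"
proof (induction k arbitrary: h)
  case (Suc k)
  have "(\<integral>x. h (\<theta> k (Tit k x)) \<partial>N 0) = (\<integral>x. h (\<theta> k x) \<partial>N k)"
    by (rule Suc.IH[OF bdd_measurable_compose[OF Suc.prems fibre_map]])
  then show ?case using integral_compose_map[OF Suc.prems] by simp
qed simp

text \<open>The boundary terms \<open>G_j \<circ> T^j\<close> telescope.\<close>

lemma birkhoff_decomposition:
  "birkhoff_sum \<sigma> T \<phi> \<omega> n x = (\<Sum>j<n. H j (Tit j x)) + G n (Tit n x)"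
proof (induction n)
  case (Suc n)
  then show ?case unfolding birkhoff_sum_def by (simp add: H_fun_def)
qed (simp add: birkhoff_sum_def G_fun_def)

text \<open>Orthogonality without computing any cross term: for an arbitrary last summand \<open>g\<close>, the last martingale
difference is absorbed into it, \<open>g' = H_n + g \<circ> T\<close>, and \<open>H_n\<close> is orthogonal to \<open>g \<circ> T\<close>. With \<open>g = G_n\<close> this shows that
the variance of the Birkhoff sum exceeds that of the martingale only by the second moment of \<open>G_n\<close>.\<close>

lemma variance_decomposition:
  "bdd_measurable (N n) g \<Longrightarrow>
   (\<integral>x. ((\<Sum>j<n. H j (Tit j x)) + g (Tit n x))\<^sup>2 \<partial>N 0)
     = (\<Sum>j<n. \<integral>y. (H j y)\<^sup>2 \<partial>N j) + (\<integral>y. (g y)\<^sup>2 \<partial>N n)"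
proof (induction n arbitrary: g)
  case (Suc n)
  have gc: "bdd_measurable (N n) (\<lambda>x. g (\<theta> n x))" by (rule bdd_measurable_compose[OF Suc.prems fibre_map])
  have "(\<integral>x. ((\<Sum>j<Suc n. H j (Tit j x)) + g (Tit (Suc n) x))\<^sup>2 \<partial>N 0)
    = (\<integral>x. ((\<Sum>j<n. H j (Tit j x)) + (H n (Tit n x) + g (\<theta> n (Tit n x))))\<^sup>2 \<partial>N 0)"
    by (simp add: add.assoc)
  also have "\<dots> = (\<Sum>j<n. \<integral>y. (H j y)\<^sup>2 \<partial>N j) + (\<integral>y. (H n y + g (\<theta> n y))\<^sup>2 \<partial>N n)"
    by (rule Suc.IH[OF bdd_measurable_add[OF H_bdd gc]])
  also have "(\<integral>y. (H n y + g (\<theta> n y))\<^sup>2 \<partial>N n)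
    = (\<integral>y. (H n y)\<^sup>2 + 2 * (H n y * g (\<theta> n y)) + (g (\<theta> n y))\<^sup>2 \<partial>N n)"
    by (simp add: power2_sum algebra_simps)
  also have "\<dots> = (\<integral>y. (H n y)\<^sup>2 \<partial>N n) + 2 * (\<integral>y. H n y * g (\<theta> n y) \<partial>N n) + (\<integral>y. (g (\<theta> n y))\<^sup>2 \<partial>N n)"
    by (simp add: bdd_integrable bdd_measurable_intros H_bdd gc)
  also have "(\<integral>y. (g (\<theta> n y))\<^sup>2 \<partial>N n) = (\<integral>y. (g y)\<^sup>2 \<partial>N (Suc n))"
    by (rule integral_compose_map[OF bdd_measurable_power2[OF Suc.prems]])
  finally show ?case using H_orthogonal[OF Suc.prems] by simp
qed simp

lemma Sigma_std_eq:
  "(Sigma_std \<sigma> T \<mu> \<phi> \<omega> n)\<^sup>2 = (\<Sum>j<n. \<integral>y. (H j y)\<^sup>2 \<partial>N j) + (\<integral>y. (G n y)\<^sup>2 \<partial>N n)"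
proof -
  have "(Sigma_std \<sigma> T \<mu> \<phi> \<omega> n)\<^sup>2 = (\<integral>x. (birkhoff_sum \<sigma> T \<phi> \<omega> n x)\<^sup>2 \<partial>N 0)"
    unfolding Sigma_std_def by (simp add: integral_nonneg_AE)
  also have "\<dots> = (\<Sum>j<n. \<integral>y. (H j y)\<^sup>2 \<partial>N j) + (\<integral>y. (G n y)\<^sup>2 \<partial>N n)"
    unfolding birkhoff_decomposition by (rule variance_decomposition[OF G_bdd])
  finally show ?thesis .
qed

text \<open>The events that depend on the orbit from time \<open>k\<close> on. They decrease in \<open>k\<close>, so \<open>H_j \<circ> T^j\<close> forms a martingale difference
sequence when \<open>j\<close> runs backwards.\<close>

definition tail_algebra :: "nat \<Rightarrow> 'm measure" where
  "tail_algebra k = vimage_algebra (space (N 0)) (Tit k) (N k)"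

lemma subalgebra_tail: "subalgebra (N 0) (tail_algebra k)"
  unfolding subalgebra_def tail_algebra_def
  using measurable_sets[OF Tit_measurable[of k]] measurable_space[OF Tit_measurable[of k]]
  by (auto simp: sets_vimage_algebra2)

lemma Tit_measurable_tail:
  assumes "k \<le> j" shows "Tit j \<in> measurable (tail_algebra k) (N j)"
  using assms
proof (induction j rule: dec_induct)
  case base
  show ?case unfolding tail_algebra_def
    by (rule measurable_vimage_algebra1) (use measurable_space[OF Tit_measurable[of k]] in auto)
next
  case (step j)
  show ?case unfolding T_iter.simps by (rule measurable_comp[OF step.IH fibre_map])
qed

lemma H_martingale_difference:
  assumes A: "A \<in> sets (tail_algebra (Suc j))"
  shows "(\<integral>x\<in>A. H j (Tit j x) \<partial>N 0) = 0"
proof -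
  from A obtain B where B: "B \<in> sets (N (Suc j))" and AB: "A = Tit (Suc j) -` B \<inter> space (N 0)"
    unfolding tail_algebra_def using measurable_space[OF Tit_measurable[of "Suc j"]]
    by (auto simp: sets_vimage_algebra2)
  have iB: "bdd_measurable (N (Suc j)) (indicator B)" by (rule bdd_measurable_indicator[OF B])
  have "(\<integral>x\<in>A. H j (Tit j x) \<partial>N 0) = (\<integral>x. H j (Tit j x) * indicator B (\<theta> j (Tit j x)) \<partial>N 0)"
    unfolding set_lebesgue_integral_def AB
    by (intro Bochner_Integration.integral_cong) (auto simp: indicator_def)
  also have "\<dots> = (\<integral>x. H j x * indicator B (\<theta> j x) \<partial>N j)"
    by (rule integral_Tit[OF bdd_measurable_mult[OF H_bdd bdd_measurable_compose[OF iB fibre_map]]])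
  also have "\<dots> = 0" by (rule H_orthogonal[OF iB])
  finally show ?thesis .
qed

end

section \<open>Moments and the Berry--Esseen bound along one orbit\<close>

text \<open>Jensen's inequality with weights proportional to \<open>b\<close>. With \<open>b\<close> matched to the sizes of the summands it
gives the constant of Minkowski's inequality, which is how it is used in the next lemma.\<close>

lemma powr_abs_sum_le_weighted:
  fixes g b :: "'i \<Rightarrow> real"
  assumes I: "finite I" and b: "\<And>i. i \<in> I \<Longrightarrow> 0 < b i" and u: "1 \<le> u"
  shows "\<bar>\<Sum>i\<in>I. g i\<bar> powr u \<le> (\<Sum>i\<in>I. b i) powr (u - 1) * (\<Sum>i\<in>I. b i powr (1 - u) * \<bar>g i\<bar> powr u)"
proof -
  \<comment> \<open>Convexity is applied on the open half-line, so the vanishing summands are dropped first.\<close>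
  define J where "J = {i\<in>I. g i \<noteq> 0}"
  have J: "finite J" "J \<subseteq> I" using I by (auto simp: J_def)
  have nn: "0 \<le> (\<Sum>i\<in>I. b i powr (1 - u) * \<bar>g i\<bar> powr u)" by (intro sum_nonneg) auto
  show ?thesis
  proof (cases "J = {}")
    case True
    then have "(\<Sum>i\<in>I. g i) = 0" unfolding J_def by (intro sum.neutral) auto
    then show ?thesis using nn by simp
  next
    case False
    define B where "B = (\<Sum>i\<in>J. b i)"
    have bJ: "\<And>i. i \<in> J \<Longrightarrow> 0 < b i" using b J by auto
    then have B: "0 < B" unfolding B_def using J False by (intro sum_pos) auto
    have "(\<Sum>i\<in>J. (b i / B) *\<^sub>R (B * \<bar>g i\<bar> / b i)) powr u
        \<le> (\<Sum>i\<in>J. (b i / B) * (B * \<bar>g i\<bar> / b i) powr u)"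
    proof (rule convex_on_sum[OF J(1) False powr_convex[OF u]])
      show "(\<Sum>i\<in>J. b i / B) = 1" unfolding sum_divide_distrib[symmetric] B_def[symmetric] using B by simp
      show "0 \<le> b i / B" if "i \<in> J" for i using bJ[OF that] B by simp
      show "B * \<bar>g i\<bar> / b i \<in> {0<..}" if "i \<in> J" for i
        using bJ[OF that] B that by (auto simp: J_def)
    qed
    also have "(\<Sum>i\<in>J. (b i / B) *\<^sub>R (B * \<bar>g i\<bar> / b i)) = (\<Sum>i\<in>J. \<bar>g i\<bar>)"
      using bJ B by (intro sum.cong) (auto simp: less_imp_neq[symmetric])
    also have "(\<Sum>i\<in>J. (b i / B) * (B * \<bar>g i\<bar> / b i) powr u)
        = (\<Sum>i\<in>J. B powr (u - 1) * (b i powr (1 - u) * \<bar>g i\<bar> powr u))"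
    proof (intro sum.cong refl)
      fix i assume i: "i \<in> J"
      note bi = bJ[OF i]
      have "(b i / B) * (B * \<bar>g i\<bar> / b i) powr u
          = (B powr u / B) * ((b i / b i powr u) * \<bar>g i\<bar> powr u)"
        using bi B by (simp add: powr_divide powr_mult)
      also have "B powr u / B = B powr (u - 1)" using B by (simp add: powr_diff)
      also have "b i / b i powr u = b i powr (1 - u)" using bi by (simp add: powr_diff)
      finally show "(b i / B) * (B * \<bar>g i\<bar> / b i) powr u = B powr (u - 1) * (b i powr (1 - u) * \<bar>g i\<bar> powr u)" .
    qed
    also have "\<dots> = B powr (u - 1) * (\<Sum>i\<in>J. b i powr (1 - u) * \<bar>g i\<bar> powr u)"
      by (rule sum_distrib_left[symmetric])
    also have "\<dots> \<le> (\<Sum>i\<in>I. b i) powr (u - 1) * (\<Sum>i\<in>I. b i powr (1 - u) * \<bar>g i\<bar> powr u)"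
    proof (intro mult_mono powr_mono2)
      show "B \<le> (\<Sum>i\<in>I. b i)" unfolding B_def by (rule sum_mono2[OF I J(2)]) (use b in \<open>auto intro: less_imp_le\<close>)
      show "(\<Sum>i\<in>J. b i powr (1 - u) * \<bar>g i\<bar> powr u) \<le> (\<Sum>i\<in>I. b i powr (1 - u) * \<bar>g i\<bar> powr u)"
        by (rule sum_mono2[OF I J(2)]) auto
    qed (use u B in \<open>auto intro!: sum_nonneg\<close>)
    finally have "(\<Sum>i\<in>J. \<bar>g i\<bar>) powr u \<le> (\<Sum>i\<in>I. b i) powr (u - 1) * (\<Sum>i\<in>I. b i powr (1 - u) * \<bar>g i\<bar> powr u)" .
    moreover have "(\<Sum>i\<in>I. g i) = (\<Sum>i\<in>J. g i)" unfolding J_def by (rule sum.mono_neutral_right[OF I]) auto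
    then have "\<bar>\<Sum>i\<in>I. g i\<bar> powr u \<le> (\<Sum>i\<in>J. \<bar>g i\<bar>) powr u" using u by (intro powr_mono2) auto
    ultimately show ?thesis by linarith
  qed
qed

lemma powr_moment_sum_le:
  fixes g :: "'i \<Rightarrow> 'a \<Rightarrow> real" and b :: "'i \<Rightarrow> real"
  assumes I: "finite I" and b: "\<And>i. i \<in> I \<Longrightarrow> 0 < b i" and u: "1 \<le> u" and c: "0 \<le> c"
    and int: "\<And>i. i \<in> I \<Longrightarrow> integrable M (\<lambda>x. \<bar>g i x\<bar> powr u)"
    and int_sum: "integrable M (\<lambda>x. \<bar>\<Sum>i\<in>I. g i x\<bar> powr u)"
    and bd: "\<And>i. i \<in> I \<Longrightarrow> (\<integral>x. \<bar>g i x\<bar> powr u \<partial>M) \<le> (c * b i) powr u"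
  shows "(\<integral>x. \<bar>\<Sum>i\<in>I. g i x\<bar> powr u \<partial>M) \<le> (c * (\<Sum>i\<in>I. b i)) powr u"
proof -
  define B where "B = (\<Sum>i\<in>I. b i)"
  have B0: "0 \<le> B" unfolding B_def using b by (intro sum_nonneg) (auto intro: less_imp_le)
  have "(\<integral>x. \<bar>\<Sum>i\<in>I. g i x\<bar> powr u \<partial>M)
      \<le> (\<integral>x. B powr (u - 1) * (\<Sum>i\<in>I. b i powr (1 - u) * \<bar>g i x\<bar> powr u) \<partial>M)"
    unfolding B_def
    by (intro integral_mono int_sum powr_abs_sum_le_weighted I b u integrable_mult_right
        Bochner_Integration.integrable_sum int)
  also have "\<dots> = B powr (u - 1) * (\<Sum>i\<in>I. b i powr (1 - u) * (\<integral>x. \<bar>g i x\<bar> powr u \<partial>M))"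
    using int by (simp add: Bochner_Integration.integral_sum)
  also have "\<dots> \<le> B powr (u - 1) * (\<Sum>i\<in>I. b i powr (1 - u) * (c * b i) powr u)"
    by (intro mult_left_mono sum_mono bd) auto
  also have "(\<Sum>i\<in>I. b i powr (1 - u) * (c * b i) powr u) = c powr u * B"
  proof -
    have "b i powr (1 - u) * (c * b i) powr u = c powr u * b i" if "i \<in> I" for i
      using b[OF that] c by (simp add: powr_mult powr_diff)
    then show ?thesis unfolding B_def by (simp add: sum_distrib_left)
  qed
  also have "B powr (u - 1) * (c powr u * B) = (c * B) powr u"
  proof (cases "B = 0")
    case False
    then have "B powr u = B powr (u - 1) * B" using B0 by (simp add: powr_diff)
    then show ?thesis using c B0 by (simp add: powr_mult)
  qed (use u in auto)
  finally show ?thesis unfolding B_def .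
qed

lemma powr_abs_add3_le:
  fixes x y z :: real
  assumes u: "0 \<le> u"
  shows "\<bar>x + y - z\<bar> powr u \<le> 3 powr u * (\<bar>x\<bar> powr u + \<bar>y\<bar> powr u + \<bar>z\<bar> powr u)"
proof -
  define m where "m = max \<bar>x\<bar> (max \<bar>y\<bar> \<bar>z\<bar>)"
  have "\<bar>x + y - z\<bar> powr u \<le> (3 * m) powr u" using u by (intro powr_mono2) (auto simp: m_def)
  also have "\<dots> = 3 powr u * m powr u" by (simp add: powr_mult m_def)
  also have "m powr u \<le> \<bar>x\<bar> powr u + \<bar>y\<bar> powr u + \<bar>z\<bar> powr u"
    unfolding m_def by (auto simp: max_def)
  finally show ?thesis by simp
qed

lemma Lp_norm_le_imp_moment_le:
  assumes "Lp_norm N u g \<le> c" "0 < u"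
  shows "(\<integral>x. \<bar>g x\<bar> powr u \<partial>N) \<le> c powr u"
proof -
  have nn: "0 \<le> (\<integral>x. \<bar>g x\<bar> powr u \<partial>N)" by (intro integral_nonneg_AE) auto
  have "(\<integral>x. \<bar>g x\<bar> powr u \<partial>N) = (Lp_norm N u g) powr u"
    unfolding Lp_norm_def using assms nn by (simp add: powr_powr)
  also have "\<dots> \<le> c powr u" using assms by (intro powr_mono2) (auto simp: Lp_norm_def)
  finally show ?thesis .
qed

context transfer_orbit
begin

text \<open>The weights are the decay rates \<open>a (n - j)\<close> themselves, so the factor that they contribute stays bounded in \<open>n\<close> when \<open>a\<close> is
summable.\<close>

lemma G_moment_le:
  assumes u: "1 \<le> u" and c: "0 \<le> c" and a: "\<And>m. 0 < a m"
    and bd: "\<And>j. j < n \<Longrightarrow> Lp_norm (N n) u (Lit j (n - j) (f j)) \<le> c * a (n - j)"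
  shows "(\<integral>x. \<bar>G n x\<bar> powr u \<partial>N n) \<le> (c * (\<Sum>m<n. a (Suc m))) powr u"
proof -
  have bm: "bdd_measurable (N n) (Lit j (n - j) (f j))" if "j \<in> {..<n}" for j
    using Lit_obs_bdd[of j n] that by simp
  have "(\<integral>x. \<bar>\<Sum>j<n. Lit j (n - j) (f j) x\<bar> powr u \<partial>N n) \<le> (c * (\<Sum>j<n. a (n - j))) powr u"
  proof (rule powr_moment_sum_le)
    show "integrable (N n) (\<lambda>x. \<bar>Lit i (n - i) (f i) x\<bar> powr u)" if "i \<in> {..<n}" for i
      using u by (intro bdd_integrable bdd_measurable_powr bm that) auto
    show "integrable (N n) (\<lambda>x. \<bar>\<Sum>j<n. Lit j (n - j) (f j) x\<bar> powr u)"
      using u by (intro bdd_integrable bdd_measurable_powr bdd_measurable_sum bm) auto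
    show "(\<integral>x. \<bar>Lit i (n - i) (f i) x\<bar> powr u \<partial>N n) \<le> (c * a (n - i)) powr u" if "i \<in> {..<n}" for i
      by (rule Lp_norm_le_imp_moment_le) (use bd that u in auto)
  qed (use a u c in auto)
  also have "(\<Sum>j<n. a (n - j)) = (\<Sum>m<n. a (Suc m))"
    by (rule sum.reindex_bij_witness[of _ "\<lambda>m. n - Suc m" "\<lambda>j. n - Suc j"]) (auto simp: Suc_diff_Suc)
  finally show ?thesis by (simp add: G_fun_def)
qed

lemma H_moment_le:
  assumes u: "0 \<le> u"
  shows "(\<integral>x. \<bar>H n x\<bar> powr u \<partial>N n) \<le> 3 powr u * ((\<integral>x. \<bar>f n x\<bar> powr u \<partial>N n)
     + (\<integral>x. \<bar>G n x\<bar> powr u \<partial>N n) + (\<integral>x. \<bar>G (Suc n) x\<bar> powr u \<partial>N (Suc n)))"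
proof -
  have b: "bdd_measurable (N n) (\<lambda>x. \<bar>f n x\<bar> powr u)" "bdd_measurable (N n) (\<lambda>x. \<bar>G n x\<bar> powr u)"
    "bdd_measurable (N (Suc n)) (\<lambda>x. \<bar>G (Suc n) x\<bar> powr u)"
    "bdd_measurable (N n) (\<lambda>x. \<bar>H n x\<bar> powr u)"
    by (intro bdd_measurable_powr fibre_obs G_bdd H_bdd u)+
  note b' = bdd_measurable_compose[OF b(3) fibre_map]
  have "(\<integral>x. \<bar>H n x\<bar> powr u \<partial>N n) \<le> (\<integral>x. 3 powr u * (\<bar>f n x\<bar> powr u + \<bar>G n x\<bar> powr u
      + \<bar>G (Suc n) (\<theta> n x)\<bar> powr u) \<partial>N n)"
    by (intro integral_mono bdd_integrable b b' bdd_measurable_intros)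
       (auto simp: H_fun_def intro: powr_abs_add3_le[OF u])
  also have "\<dots> = 3 powr u * ((\<integral>x. \<bar>f n x\<bar> powr u \<partial>N n)
     + (\<integral>x. \<bar>G n x\<bar> powr u \<partial>N n) + (\<integral>x. \<bar>G (Suc n) (\<theta> n x)\<bar> powr u \<partial>N n))"
    by (simp add: bdd_integrable b b' bdd_measurable_add)
  finally show ?thesis using integral_compose_map[OF b(3)] by simp
qed

text \<open>The martingale bound for \<open>X_k = H_{n-1-k} \<circ> T^{n-1-k} / S\<close> with the boundary term \<open>W = G_n \<circ> T^n / S\<close>. The assumption \<open>small\<close>
makes the normalisation by the full variance \<open>S\<^sup>2\<close> instead of the variance of the martingale harmless.\<close>

theorem orbit_berry_esseen:
  fixes s e y t :: real and n :: nat
  defines "S \<equiv> Sigma_std \<sigma> T \<mu> \<phi> \<omega> n"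
  assumes s: "1 \<le> s" and e: "0 < e" "e \<le> 1/2" and y: "0 < y" and S: "0 < S"
    and small: "2 * (\<integral>x. (G n x)\<^sup>2 \<partial>N n) \<le> e\<^sup>2 * S\<^sup>2"
  shows "\<bar>measure (N 0) {x \<in> space (N 0). birkhoff_sum \<sigma> T \<phi> \<omega> n x \<le> t * S} - normal_cdf t\<bar>
    \<le> 8193 * e + 2 * y + (1 - normal_cdf (y / (2 * e)))
      + 2 * ((\<Sum>j<n. \<integral>x. \<bar>H j x\<bar> powr (2 * s) \<partial>N j) / (S powr (2 * s) * e powr (4 * s)))
      + (\<integral>x. \<bar>(\<Sum>j<n. (H j (Tit j x))\<^sup>2) - (\<Sum>j<n. \<integral>y. (H j y)\<^sup>2 \<partial>N j)\<bar> powr s \<partial>N 0)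
          / (e\<^sup>2 * S\<^sup>2 / 2) powr s
      + (\<integral>x. \<bar>G n x\<bar> powr (2 * s) \<partial>N n) / (y * S) powr (2 * s)"
proof -
  interpret N0: prob_space "N 0" by (rule fibre_prob)
  define V where "V = (\<lambda>x. (\<Sum>j<n. (H j (Tit j x))\<^sup>2) - (\<Sum>j<n. \<integral>y. (H j y)\<^sup>2 \<partial>N j))"
  have HT: "bdd_measurable (N 0) (\<lambda>x. H j (Tit j x))" for j
    by (rule bdd_measurable_compose[OF H_bdd Tit_measurable])
  have GT: "bdd_measurable (N 0) (\<lambda>x. G n (Tit n x))"
    by (rule bdd_measurable_compose[OF G_bdd Tit_measurable])
  have V: "bdd_measurable (N 0) V"
    unfolding V_def by (intro bdd_measurable_diff bdd_measurable_sum bdd_measurable_power2 HT bdd_measurable_const)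
  define X where "X = (\<lambda>k x. H (n - Suc k) (Tit (n - Suc k) x) * (1 / S))"
  define W where "W = (\<lambda>x. G n (Tit n x) * (1 / S))"
  define F where "F = (\<lambda>k. tail_algebra (n - k))"
  have Xb: "bdd_measurable (N 0) (X k)" for k
    unfolding X_def by (intro bdd_measurable_mult HT bdd_measurable_const)
  have Wb: "bdd_measurable (N 0) W"
    unfolding W_def by (intro bdd_measurable_mult GT bdd_measurable_const)
  \<comment> \<open>Undoing the time reversal in sums over all steps.\<close>
  have rev: "(\<Sum>k<n. h (n - Suc k)) = (\<Sum>j<n. h j)" for h :: "nat \<Rightarrow> real"
    by (rule sum.nat_diff_reindex)
  have "\<bar>N0.prob {x \<in> space (N 0). (\<Sum>k<n. X k x) + W x \<le> t} - normal_cdf t\<bar>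
    \<le> 8193 * e + 2 * y + (1 - normal_cdf (y / (2 * e)))
      + 2 * ((\<Sum>k<n. \<integral>x. \<bar>X k x\<bar> powr (2 * s) \<partial>N 0) / e powr (4 * s))
      + N0.prob {x \<in> space (N 0). e\<^sup>2 < \<bar>(\<Sum>k<n. (X k x)\<^sup>2) - 1\<bar>}
      + N0.prob {x \<in> space (N 0). y < \<bar>W x\<bar>}"
  proof (rule N0.martingale_berry_esseen[where F = F])
    show "subalgebra (N 0) (F k)" for k unfolding F_def by (rule subalgebra_tail)
    show "X i \<in> borel_measurable (F k)" if "i < k" "k < n" for i k
    proof -
      have "(\<lambda>x. H (n - Suc i) (Tit (n - Suc i) x)) \<in> borel_measurable (F k)"
        unfolding F_def using that H_bdd[of "n - Suc i"]
        by (intro measurable_compose[OF Tit_measurable_tail]) (auto simp: bdd_measurable_iff)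
      then show ?thesis unfolding X_def by simp
    qed
    show "(\<integral>x\<in>A. X k x \<partial>N 0) = 0" if "k < n" "A \<in> sets (F k)" for k A
    proof -
      have "A \<in> sets (tail_algebra (Suc (n - Suc k)))"
        using that unfolding F_def by (simp add: Suc_diff_Suc)
      from H_martingale_difference[OF this] show ?thesis
        unfolding X_def set_lebesgue_integral_def by simp
    qed
    show "integrable (N 0) (\<lambda>x. \<bar>X k x\<bar> powr (2 * s))" for k
      using s by (intro bdd_integrable bdd_measurable_powr Xb) auto
  qed (use Xb Wb s e y in \<open>auto simp: bdd_measurable_iff\<close>)
  also have "(\<Sum>k<n. \<integral>x. \<bar>X k x\<bar> powr (2 * s) \<partial>N 0) = (\<Sum>j<n. \<integral>x. \<bar>H j x\<bar> powr (2 * s) \<partial>N j) / S powr (2 * s)"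
  proof -
    have "(\<integral>x. \<bar>X k x\<bar> powr (2 * s) \<partial>N 0)
        = (\<integral>x. \<bar>H (n - Suc k) x\<bar> powr (2 * s) \<partial>N (n - Suc k)) / S powr (2 * s)" for k
    proof -
      have "(\<integral>x. \<bar>X k x\<bar> powr (2 * s) \<partial>N 0)
        = (\<integral>x. \<bar>H (n - Suc k) (Tit (n - Suc k) x)\<bar> powr (2 * s) / S powr (2 * s) \<partial>N 0)"
        unfolding X_def using S by (simp add: abs_mult powr_divide)
      also have "\<dots> = (\<integral>x. \<bar>H (n - Suc k) (Tit (n - Suc k) x)\<bar> powr (2 * s) \<partial>N 0) / S powr (2 * s)"
        by simp
      also have "(\<integral>x. \<bar>H (n - Suc k) (Tit (n - Suc k) x)\<bar> powr (2 * s) \<partial>N 0)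
          = (\<integral>x. \<bar>H (n - Suc k) x\<bar> powr (2 * s) \<partial>N (n - Suc k))"
        using s by (intro integral_Tit bdd_measurable_powr H_bdd) auto
      finally show ?thesis .
    qed
    then show ?thesis using rev[of "\<lambda>j. \<integral>x. \<bar>H j x\<bar> powr (2 * s) \<partial>N j"]
      by (simp add: sum_divide_distrib[symmetric])
  qed
  also have "{x \<in> space (N 0). (\<Sum>k<n. X k x) + W x \<le> t}
      = {x \<in> space (N 0). birkhoff_sum \<sigma> T \<phi> \<omega> n x \<le> t * S}"
  proof -
    have "(\<Sum>k<n. X k x) + W x = birkhoff_sum \<sigma> T \<phi> \<omega> n x / S" for x
      unfolding X_def W_def birkhoff_decomposition
      using rev[of "\<lambda>j. H j (Tit j x)"]
      by (simp add: sum_divide_distrib[symmetric] add_divide_distrib)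
    then show ?thesis using S by (simp add: divide_le_eq)
  qed
  finally have main: "\<bar>N0.prob {x \<in> space (N 0). birkhoff_sum \<sigma> T \<phi> \<omega> n x \<le> t * S} - normal_cdf t\<bar>
    \<le> 8193 * e + 2 * y + (1 - normal_cdf (y / (2 * e)))
      + 2 * ((\<Sum>j<n. \<integral>x. \<bar>H j x\<bar> powr (2 * s) \<partial>N j) / S powr (2 * s) / e powr (4 * s))
      + N0.prob {x \<in> space (N 0). e\<^sup>2 < \<bar>(\<Sum>k<n. (X k x)\<^sup>2) - 1\<bar>}
      + N0.prob {x \<in> space (N 0). y < \<bar>W x\<bar>}" .
  have PV: "N0.prob {x \<in> space (N 0). e\<^sup>2 < \<bar>(\<Sum>k<n. (X k x)\<^sup>2) - 1\<bar>}
      \<le> (\<integral>x. \<bar>V x\<bar> powr s \<partial>N 0) / (e\<^sup>2 * S\<^sup>2 / 2) powr s"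
  proof -
    have "e\<^sup>2 * S\<^sup>2 / 2 < \<bar>V x\<bar>" if "e\<^sup>2 < \<bar>(\<Sum>k<n. (X k x)\<^sup>2) - 1\<bar>" for x
    proof -
      define Q where "Q = (\<Sum>j<n. (H j (Tit j x))\<^sup>2)"
      have "(\<Sum>k<n. (X k x)\<^sup>2) = Q / S\<^sup>2"
        unfolding X_def Q_def using rev[of "\<lambda>j. (H j (Tit j x))\<^sup>2"]
        by (simp add: power_divide sum_divide_distrib[symmetric])
      then have "e\<^sup>2 * S\<^sup>2 < \<bar>Q / S\<^sup>2 - 1\<bar> * S\<^sup>2" using that S by simp
      also have "\<dots> = \<bar>(Q / S\<^sup>2 - 1) * S\<^sup>2\<bar>" by (simp add: abs_mult)
      also have "(Q / S\<^sup>2 - 1) * S\<^sup>2 = Q - S\<^sup>2" using S by (simp add: left_diff_distrib)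
      finally have "e\<^sup>2 * S\<^sup>2 < \<bar>Q - S\<^sup>2\<bar>" .
      moreover have "Q - S\<^sup>2 = V x - (\<integral>x. (G n x)\<^sup>2 \<partial>N n)"
        unfolding S_def Sigma_std_eq V_def Q_def by simp
      moreover have "0 \<le> (\<integral>x. (G n x)\<^sup>2 \<partial>N n)" by simp
      ultimately show ?thesis using small by linarith
    qed
    then have "N0.prob {x \<in> space (N 0). e\<^sup>2 < \<bar>(\<Sum>k<n. (X k x)\<^sup>2) - 1\<bar>}
        \<le> N0.prob {x \<in> space (N 0). e\<^sup>2 * S\<^sup>2 / 2 < \<bar>V x\<bar>}"
      using V by (intro N0.finite_measure_mono) (auto simp: bdd_measurable_iff)
    also have "\<dots> \<le> (\<integral>x. \<bar>V x\<bar> powr s \<partial>N 0) / (e\<^sup>2 * S\<^sup>2 / 2) powr s"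
      by (rule N0.prob_abs_gt_le_powr_moment)
         (use V s e S N0.bdd_measurable_integrable[OF bdd_measurable_powr[OF V, of s]]
           in \<open>auto simp: bdd_measurable_iff\<close>)
    finally show ?thesis .
  qed
  have PW: "N0.prob {x \<in> space (N 0). y < \<bar>W x\<bar>} \<le> (\<integral>x. \<bar>G n x\<bar> powr (2 * s) \<partial>N n) / (y * S) powr (2 * s)"
  proof -
    have "{x \<in> space (N 0). y < \<bar>W x\<bar>} = {x \<in> space (N 0). y * S < \<bar>G n (Tit n x)\<bar>}"
      unfolding W_def using S by (auto simp: abs_mult less_divide_eq)
    then have "N0.prob {x \<in> space (N 0). y < \<bar>W x\<bar>} = N0.prob {x \<in> space (N 0). y * S < \<bar>G n (Tit n x)\<bar>}" by simp
    also have "\<dots> \<le> (\<integral>x. \<bar>G n (Tit n x)\<bar> powr (2 * s) \<partial>N 0) / (y * S) powr (2 * s)"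
      by (rule N0.prob_abs_gt_le_powr_moment)
         (use GT s y S N0.bdd_measurable_integrable[OF bdd_measurable_powr[OF GT, of "2 * s"]]
           in \<open>auto simp: bdd_measurable_iff\<close>)
    also have "(\<integral>x. \<bar>G n (Tit n x)\<bar> powr (2 * s) \<partial>N 0) = (\<integral>x. \<bar>G n x\<bar> powr (2 * s) \<partial>N n)"
      using s by (intro integral_Tit bdd_measurable_powr G_bdd) auto
    finally show ?thesis .
  qed
  show ?thesis using main PV PW unfolding V_def by (simp add: divide_divide_eq_left)
qed

end

section \<open>The rate of convergence along one orbit\<close>

lemma eventually_powr_ge:
  fixes \<gamma> K :: real
  assumes "0 < \<gamma>"
  shows "\<forall>\<^sub>F n in sequentially. K \<le> real n powr \<gamma>"
proof -
  have "filterlim (\<lambda>n. real n powr \<gamma>) at_top sequentially"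
    using assms by (intro filterlim_compose[OF real_powr_at_top] filterlim_real_sequentially)
  then show ?thesis by (simp add: filterlim_at_top)
qed

text \<open>The next three lemmas collect the powers of \<open>x = n\<close> in the error terms of \<open>orbit_berry_esseen\<close>: the large jumps, the
boundary term and the fluctuation of the squares.\<close>

lemma powr_quotient_moment:
  fixes x C c :: real
  assumes "0 < x" "0 < C" "0 < c"
  shows "x * (C * x powr \<alpha>) powr u / ((c * x) powr s * (x powr \<beta>) powr v)
    = C powr u / c powr s * x powr (1 + \<alpha> * u - s - \<beta> * v)"
  using assms by (simp add: powr_mult powr_powr powr_diff powr_add ac_simps)

lemma powr_quotient_boundary:
  fixes x C c :: real
  assumes "0 < x" "0 < C" "0 < c"
  shows "(C * x powr \<alpha>) powr u / ((x powr \<beta>) powr u * (c * x) powr s)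
    = C powr u / c powr s * x powr (\<alpha> * u - \<beta> * u - s)"
  using assms by (simp add: powr_mult powr_powr powr_diff powr_add ac_simps)

lemma powr_quotient_variance:
  fixes x C c :: real
  assumes "0 < x" "0 < c"
  shows "C * x powr \<gamma> / (x powr \<beta> * (c * x)) powr s = C / c powr s * x powr (\<gamma> - \<beta> * s - s)"
  using assms by (simp add: powr_mult powr_powr powr_diff powr_add ac_simps)

text \<open>Split at \<open>\<bar>g\<bar> = l\<close>: below, \<open>g\<^sup>2 \<le> l\<^sup>2\<close>; above, \<open>g\<^sup>2\<close> is dominated by \<open>l\<^sup>2\<close> times \<open>(\<bar>g\<bar> / l) powr (2 * s)\<close>.\<close>

lemma (in prob_space) second_moment_le_of_powr_moment:
  fixes g :: "'a \<Rightarrow> real"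
  assumes g: "bdd_measurable M g" and s: "1 \<le> s" and l: "0 < l"
    and mom: "(\<integral>x. \<bar>g x\<bar> powr (2 * s) \<partial>M) \<le> l powr (2 * s)"
  shows "(\<integral>x. (g x)\<^sup>2 \<partial>M) \<le> 2 * l\<^sup>2"
proof -
  have pw: "(g x)\<^sup>2 \<le> l\<^sup>2 + l\<^sup>2 / l powr (2 * s) * \<bar>g x\<bar> powr (2 * s)" for x
  proof (cases "\<bar>g x\<bar> \<le> l")
    case True
    then have "(g x)\<^sup>2 \<le> l\<^sup>2" using power_mono[OF True abs_ge_zero, of 2] by simp
    then show ?thesis by (simp add: add_increasing2)
  next
    case False
    then have g0: "0 < \<bar>g x\<bar> / l" using l by simp
    have "1 \<le> \<bar>g x\<bar> / l" using False l by simp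
    then have "(\<bar>g x\<bar> / l) powr 2 \<le> (\<bar>g x\<bar> / l) powr (2 * s)" using s by (intro powr_mono) auto
    moreover have "(\<bar>g x\<bar> / l) powr 2 = (g x)\<^sup>2 / l\<^sup>2" using g0 by (simp add: powr_numeral power_divide)
    moreover have "(\<bar>g x\<bar> / l) powr (2 * s) = \<bar>g x\<bar> powr (2 * s) / l powr (2 * s)"
      using l by (simp add: powr_divide)
    ultimately have "(g x)\<^sup>2 / l\<^sup>2 \<le> \<bar>g x\<bar> powr (2 * s) / l powr (2 * s)" by simp
    then have "l\<^sup>2 * ((g x)\<^sup>2 / l\<^sup>2) \<le> l\<^sup>2 * (\<bar>g x\<bar> powr (2 * s) / l powr (2 * s))"
      by (intro mult_left_mono) auto
    then have "(g x)\<^sup>2 \<le> l\<^sup>2 / l powr (2 * s) * \<bar>g x\<bar> powr (2 * s)" using l by simp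
    then show ?thesis by (simp add: add_increasing)
  qed
  have i: "integrable M (\<lambda>x. \<bar>g x\<bar> powr (2 * s))"
    using s by (intro bdd_measurable_integrable bdd_measurable_powr g) auto
  have "(\<integral>x. (g x)\<^sup>2 \<partial>M) \<le> (\<integral>x. l\<^sup>2 + l\<^sup>2 / l powr (2 * s) * \<bar>g x\<bar> powr (2 * s) \<partial>M)"
    using bdd_measurable_integrable[OF bdd_measurable_power2[OF g]] i pw by (intro integral_mono) auto
  also have "\<dots> = l\<^sup>2 + l\<^sup>2 / l powr (2 * s) * (\<integral>x. \<bar>g x\<bar> powr (2 * s) \<partial>M)"
    using i by (simp add: prob_space)
  also have "\<dots> \<le> l\<^sup>2 + l\<^sup>2 / l powr (2 * s) * l powr (2 * s)"
    by (intro add_left_mono mult_left_mono mom) auto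
  also have "\<dots> = 2 * l\<^sup>2" using l by simp
  finally show ?thesis .
qed

context transfer_orbit
begin

definition kolmogorov_distance :: "nat \<Rightarrow> real" where
  "kolmogorov_distance n = (SUP t. \<bar>measure (\<mu> \<omega>) {x \<in> space (\<mu> \<omega>).
      birkhoff_sum \<sigma> T \<phi> \<omega> n x \<le> t * Sigma_std \<sigma> T \<mu> \<phi> \<omega> n} - normal_cdf t\<bar>)"

lemma cdf_gap_le_1:
  "\<bar>measure (\<mu> \<omega>) {x \<in> space (\<mu> \<omega>). birkhoff_sum \<sigma> T \<phi> \<omega> n x \<le> t * S} - normal_cdf t\<bar> \<le> 1"
proof -
  interpret N0: prob_space "\<mu> \<omega>" using fibre_prob[of 0] by simp
  interpret Z: real_distribution std_normal_distribution by (rule real_dist_normal_dist)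
  have "0 \<le> N0.prob {x \<in> space (\<mu> \<omega>). birkhoff_sum \<sigma> T \<phi> \<omega> n x \<le> t * S}"
    "N0.prob {x \<in> space (\<mu> \<omega>). birkhoff_sum \<sigma> T \<phi> \<omega> n x \<le> t * S} \<le> 1"
    by auto
  then show ?thesis using Z.cdf_bounded_prob[of t] Z.cdf_nonneg[of t] by linarith
qed

lemma kolmogorov_distance_nonneg: "0 \<le> kolmogorov_distance n"
  unfolding kolmogorov_distance_def
  by (rule cSUP_upper2[of _ _ 0]) (use cdf_gap_le_1 in \<open>auto intro!: bdd_aboveI\<close>)

lemma kolmogorov_distance_le:
  assumes "\<And>t. \<bar>measure (\<mu> \<omega>) {x \<in> space (\<mu> \<omega>).
      birkhoff_sum \<sigma> T \<phi> \<omega> n x \<le> t * Sigma_std \<sigma> T \<mu> \<phi> \<omega> n} - normal_cdf t\<bar> \<le> B"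
  shows "kolmogorov_distance n \<le> B"
  unfolding kolmogorov_distance_def by (rule cSUP_least) (use assms in auto)

text \<open>If the exponent \<open>\<rho> + \<delta>\<close> is not negative, the trivial bound \<open>1\<close> suffices. Otherwise take \<open>e = n\<^bsup>\<rho>+\<delta>/2\<^esup>\<close> and \<open>y = n\<^bsup>\<rho>+\<delta>\<^esup>\<close>, so that \<open>y / e\<close> is
a positive power of \<open>n\<close> and the Gaussian tail is negligible. The fluctuation of the squares is the critical
term. For the others \<open>\<rho> < 0\<close> and \<open>A \<ge> 1\<close> leave room; note that \<open>\<rho> < 0\<close> forces \<open>q < 1/4\<close>.\<close>

theorem orbit_rate:
  fixes s q A \<delta> C c :: real
  assumes s: "1 \<le> s" and q: "0 < q" and A: "1 \<le> A" and \<delta>: "0 < \<delta>" and C: "0 < C" and c: "0 < c"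
    and G_mom: "\<And>n. (\<integral>x. \<bar>G n x\<bar> powr (2 * s) \<partial>N n) \<le> (C * real n powr (q + \<delta> / 4)) powr (2 * s)"
    and H_mom: "\<And>n. (\<integral>x. \<bar>H n x\<bar> powr (2 * s) \<partial>N n) \<le> (C * real (Suc n) powr (q + \<delta> / 4)) powr (2 * s)"
    and quad: "(\<lambda>n. \<integral>x. \<bar>(\<Sum>j<n. (H j (Tit j x))\<^sup>2) - (\<Sum>j<n. \<integral>y. (H j y)\<^sup>2 \<partial>N j)\<bar> powr s \<partial>\<mu> \<omega>)
        \<in> O(\<lambda>n. real n powr (s / 2 + 2 * s * q + A + \<delta>))"
    and nondeg: "\<forall>\<^sub>F n in sequentially. c * real n \<le> (Sigma_std \<sigma> T \<mu> \<phi> \<omega> n)\<^sup>2"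
  shows "kolmogorov_distance \<in> O(\<lambda>n. real n powr ((- s / 2 + 2 * s * q + A) / (2 * s + 1) + \<delta>))"
proof -
  define \<rho> where "\<rho> = (- s / 2 + 2 * s * q + A) / (2 * s + 1)"
  have \<rho>: "(2 * s + 1) * \<rho> = - s / 2 + 2 * s * q + A" unfolding \<rho>_def using s by simp
  show ?thesis
  proof (cases "0 \<le> \<rho> + \<delta>")
    case True
    have "kolmogorov_distance n \<le> real n powr (\<rho> + \<delta>)" if "1 \<le> n" for n
    proof -
      have "kolmogorov_distance n \<le> 1" by (rule kolmogorov_distance_le) (rule cdf_gap_le_1)
      also have "1 \<le> real n powr (\<rho> + \<delta>)" using that True by (intro ge_one_powr_ge_zero) auto
      finally show ?thesis .
    qed
    then show ?thesis
      unfolding \<rho>_def[symmetric]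
      by (intro bigoI[of _ 1] eventually_mono[OF eventually_ge_at_top[of 1]])
         (auto simp: kolmogorov_distance_nonneg)
  next
    case False
    then have neg: "\<rho> + \<delta> < 0" by simp
    have \<rho>neg: "\<rho> < 0" using neg \<delta> by simp
    have sd: "0 \<le> s * \<delta>" "\<delta> \<le> s * \<delta>" and sq: "0 \<le> s * q" using s \<delta> q by auto
    have \<rho>': "2 * (s * \<rho>) + \<rho> = - s / 2 + 2 * (s * q) + A" using \<rho> by (simp add: algebra_simps)
    define e where "e = (\<lambda>n. real n powr (\<rho> + \<delta> / 2))"
    define y where "y = (\<lambda>n. real n powr (\<rho> + \<delta>))"
    define S where "S = (\<lambda>n. Sigma_std \<sigma> T \<mu> \<phi> \<omega> n)"
    define V where "V = (\<lambda>n. \<integral>x. \<bar>(\<Sum>j<n. (H j (Tit j x))\<^sup>2) - (\<Sum>j<n. \<integral>y. (H j y)\<^sup>2 \<partial>N j)\<bar> powr s \<partial>\<mu> \<omega>)"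
    have V0: "0 \<le> V n" for n unfolding V_def by (intro integral_nonneg_AE) auto
    obtain Cv where Cv: "0 < Cv" "\<forall>\<^sub>F n in sequentially. norm (V n) \<le> Cv * norm (real n powr (s / 2 + 2 * s * q + A + \<delta>))"
      using landau_o.bigE[OF quad[folded V_def]] by blast
    \<comment> \<open>The order of the tail bound: x = n powr (\<delta> / 2) / 2 to the power k has to beat n powr - (\<rho> + \<delta>).\<close>
    obtain k :: nat where k: "- (\<rho> + \<delta>) / (\<delta> / 2) \<le> real k" using real_arch_simple by blast
    then have k: "- (\<delta> / 2 * real k) \<le> \<rho> + \<delta>" using \<delta> by (simp add: field_simps)
    obtain Ct where Ct: "\<And>x. 0 < x \<Longrightarrow> 1 - normal_cdf x \<le> Ct / x ^ k" using normal_cdf_tail[of k] by blast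
    define B where "B = 8193 + 2 + \<bar>Ct\<bar> * 2 ^ k + 2 * (C powr (2 * s) / c powr s)
      + Cv / (c / 2) powr s + C powr (2 * s) / c powr s"
    \<comment> \<open>This excess of exponents makes the second moment of G_n negligible against e^2 times the variance.\<close>
    have gap: "0 < 2 * \<rho> + \<delta> + 1 - (2 * q + \<delta> / 2)"
    proof -
      have "2 * (s * q) < s / 2" using \<rho>' \<rho>neg s A mult_pos_neg[of s \<rho>] by linarith
      then have "s * (4 * q) < s * 1" by simp
      then have "q < 1 / 4" using s by (simp only: mult_less_cancel_left_pos)
      have "(2 * s + 1) * (2 * \<rho> + 1 - 2 * q) = s + 2 * A + 1 - 2 * q"
        using \<rho>' by (simp add: algebra_simps)
      also have "\<dots> > 0" using \<open>q < 1 / 4\<close> s A by linarith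
      finally have "0 < 2 * \<rho> + 1 - 2 * q" using s by (simp add: zero_less_mult_iff)
      then show ?thesis using \<delta> by simp
    qed
    have gap': "0 < - (\<rho> + \<delta> / 2)" using neg \<delta> by simp
    have "\<forall>\<^sub>F n in sequentially. kolmogorov_distance n \<le> B * real n powr (\<rho> + \<delta>)"
      using eventually_gt_at_top[of 0] nondeg Cv(2)
        eventually_powr_ge[OF gap, of "4 * C\<^sup>2 / c"]
        eventually_powr_ge[OF gap', of 2]
    proof eventually_elim
      case (elim n)
      define x where "x = real n"
      have x: "1 \<le> x" "0 < x" using elim(1) by (auto simp: x_def)
      have mono: "x powr \<alpha> \<le> x powr (\<rho> + \<delta>)" if "\<alpha> \<le> \<rho> + \<delta>" for \<alpha>
        using that x by (intro powr_mono) auto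
      have e: "0 < e n" "e n \<le> 1 / 2"
      proof -
        show "0 < e n" using x unfolding e_def x_def[symmetric] by simp
        have "2 \<le> x powr (- (\<rho> + \<delta> / 2))" using elim(5) neg \<delta> unfolding x_def by simp
        then show "e n \<le> 1 / 2" using x unfolding e_def x_def[symmetric] powr_minus
          by (simp add: field_simps)
      qed
      have y: "0 < y n" using x unfolding y_def x_def[symmetric] by simp
      have S2: "c * x \<le> (S n)\<^sup>2" using elim(2) unfolding S_def x_def .
      have S0: "0 < S n"
      proof -
        have "0 < (S n)\<^sup>2" using S2 c x by (meson less_le_trans mult_pos_pos)
        moreover have "0 \<le> S n" unfolding S_def Sigma_std_def by simp
        ultimately show ?thesis by (cases "S n = 0") auto
      qed
      have Ss: "(c * x) powr s \<le> S n powr (2 * s)"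
      proof -
        have "(c * x) powr s \<le> ((S n)\<^sup>2) powr s" using S2 c x s by (intro powr_mono2) auto
        also have "(S n)\<^sup>2 = S n powr 2" using S0 by (simp add: powr_numeral)
        finally show ?thesis by (simp add: powr_powr)
      qed
      have small: "2 * (\<integral>z. (G n z)\<^sup>2 \<partial>N n) \<le> (e n)\<^sup>2 * (S n)\<^sup>2"
      proof -
        have "(\<integral>z. (G n z)\<^sup>2 \<partial>N n) \<le> 2 * (C * x powr (q + \<delta> / 4))\<^sup>2"
          using G_mom[of n] C x s unfolding x_def[symmetric]
          by (intro prob_space.second_moment_le_of_powr_moment[OF fibre_prob G_bdd s]) auto
        then have "2 * (\<integral>z. (G n z)\<^sup>2 \<partial>N n) \<le> 4 * C\<^sup>2 * (x powr (q + \<delta> / 4))\<^sup>2"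
          by (simp add: power_mult_distrib)
        also have "(x powr (q + \<delta> / 4))\<^sup>2 = x powr (2 * q + \<delta> / 2)"
          using x by (simp add: power2_eq_square powr_add[symmetric])
        also have "4 * C\<^sup>2 * x powr (2 * q + \<delta> / 2)
            \<le> (c * x powr (2 * \<rho> + \<delta> + 1 - (2 * q + \<delta> / 2))) * x powr (2 * q + \<delta> / 2)"
          using elim(4) c unfolding x_def[symmetric] by (intro mult_right_mono) (auto simp: field_simps)
        also have "\<dots> = x powr (2 * \<rho> + \<delta>) * (c * x)"
        proof -
          have "x powr (2 * \<rho> + \<delta> + 1 - (2 * q + \<delta> / 2)) * x powr (2 * q + \<delta> / 2)
              = x powr (2 * \<rho> + \<delta> + 1)"
            unfolding powr_add[symmetric] by (simp add: ac_simps)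
          also have "\<dots> = x powr (2 * \<rho> + \<delta>) * x"
            using x powr_add[of x "2 * \<rho> + \<delta>" 1] by simp
          finally show ?thesis by simp
        qed
        also have "\<dots> \<le> x powr (2 * \<rho> + \<delta>) * (S n)\<^sup>2" by (intro mult_left_mono S2) auto
        also have "x powr (2 * \<rho> + \<delta>) = (e n)\<^sup>2"
          unfolding e_def x_def[symmetric] using x by (simp add: power2_eq_square powr_add[symmetric])
        finally show ?thesis .
      qed
      have t1: "8193 * e n \<le> 8193 * x powr (\<rho> + \<delta>)"
        unfolding e_def x_def[symmetric] using \<delta> by (intro mult_left_mono mono) auto
      have t2: "1 - normal_cdf (y n / (2 * e n)) \<le> \<bar>Ct\<bar> * 2 ^ k * x powr (\<rho> + \<delta>)"
      proof -
        have "y n / (2 * e n) = x powr (\<delta> / 2) / 2"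
          unfolding y_def e_def x_def[symmetric] using x by (simp add: powr_diff[symmetric])
        moreover have "0 < x powr (\<delta> / 2) / 2" using x by simp
        ultimately have "1 - normal_cdf (y n / (2 * e n)) \<le> Ct / (x powr (\<delta> / 2) / 2) ^ k"
          using Ct[of "x powr (\<delta> / 2) / 2"] by (simp only:)
        also have "\<dots> \<le> \<bar>Ct\<bar> / (x powr (\<delta> / 2) / 2) ^ k" using x by (intro divide_right_mono) auto
        also have "\<dots> = \<bar>Ct\<bar> * 2 ^ k * x powr (- (\<delta> / 2 * real k))"
        proof -
          have "(x powr (\<delta> / 2)) ^ k = x powr (\<delta> / 2 * real k)" using x by (simp add: powr_realpow[symmetric] powr_powr)
          then show ?thesis using x by (simp add: power_divide powr_minus field_simps)
        qed
        also have "\<dots> \<le> \<bar>Ct\<bar> * 2 ^ k * x powr (\<rho> + \<delta>)" by (intro mult_left_mono mono k) auto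
        finally show ?thesis .
      qed
      have t3: "(\<Sum>j<n. \<integral>x. \<bar>H j x\<bar> powr (2 * s) \<partial>N j) / (S n powr (2 * s) * e n powr (4 * s))
          \<le> C powr (2 * s) / c powr s * x powr (\<rho> + \<delta>)"
      proof -
        have "(\<Sum>j<n. \<integral>x. \<bar>H j x\<bar> powr (2 * s) \<partial>N j) \<le> (\<Sum>j<n. (C * x powr (q + \<delta> / 4)) powr (2 * s))"
        proof (rule sum_mono)
          fix j assume "j \<in> {..<n}"
          then have "real (Suc j) powr (q + \<delta> / 4) \<le> x powr (q + \<delta> / 4)"
            using q \<delta> unfolding x_def by (intro powr_mono2) auto
          then have "(C * real (Suc j) powr (q + \<delta> / 4)) powr (2 * s) \<le> (C * x powr (q + \<delta> / 4)) powr (2 * s)"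
            using C s by (intro powr_mono2[of "2 * s"] mult_left_mono) auto
          with H_mom[of j] show "(\<integral>x. \<bar>H j x\<bar> powr (2 * s) \<partial>N j) \<le> (C * x powr (q + \<delta> / 4)) powr (2 * s)"
            by (rule order_trans)
        qed
        also have "\<dots> = x * (C * x powr (q + \<delta> / 4)) powr (2 * s)" unfolding x_def by simp
        finally have "(\<Sum>j<n. \<integral>x. \<bar>H j x\<bar> powr (2 * s) \<partial>N j) / (S n powr (2 * s) * e n powr (4 * s))
          \<le> x * (C * x powr (q + \<delta> / 4)) powr (2 * s) / ((c * x) powr s * e n powr (4 * s))"
          using Ss x c e by (intro frac_le mult_right_mono mult_pos_pos mult_nonneg_nonneg) auto
        also have "\<dots> = C powr (2 * s) / c powr s
            * x powr (1 + 2 * s * (q + \<delta> / 4) - s - 4 * s * (\<rho> + \<delta> / 2))"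
          unfolding e_def x_def[symmetric] 
          by (rule trans[OF powr_quotient_moment[OF x(2) C c]]) (simp add: algebra_simps)
        also have "\<dots> \<le> C powr (2 * s) / c powr s * x powr (\<rho> + \<delta>)"
        proof (intro mult_left_mono mono)
          have "1 + 2 * s * (q + \<delta> / 4) - s - 4 * s * (\<rho> + \<delta> / 2)
              = 1 + 2 * (s * q) - s - 4 * (s * \<rho>) - 3 / 2 * (s * \<delta>)" by (simp add: field_simps)
          then show "1 + 2 * s * (q + \<delta> / 4) - s - 4 * s * (\<rho> + \<delta> / 2) \<le> \<rho> + \<delta>"
            using \<rho>' \<rho>neg sd sq A \<delta> by linarith
        qed auto
        finally show ?thesis .
      qed
      have t4: "V n / ((e n)\<^sup>2 * (S n)\<^sup>2 / 2) powr s \<le> Cv / (c / 2) powr s * x powr (\<rho> + \<delta>)"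
      proof -
        have "V n \<le> Cv * x powr (s / 2 + 2 * s * q + A + \<delta>)"
          using elim(3) V0[of n] unfolding x_def by simp
        moreover have "(x powr (2 * \<rho> + \<delta>) * (c / 2 * x)) powr s \<le> ((e n)\<^sup>2 * (S n)\<^sup>2 / 2) powr s"
        proof (rule powr_mono2)
          have "(e n)\<^sup>2 = x powr (2 * \<rho> + \<delta>)"
            unfolding e_def x_def[symmetric] using x by (simp add: power2_eq_square powr_add[symmetric])
          moreover have "x powr (2 * \<rho> + \<delta>) * (c * x) \<le> x powr (2 * \<rho> + \<delta>) * (S n)\<^sup>2"
            by (intro mult_left_mono S2) auto
          ultimately show "x powr (2 * \<rho> + \<delta>) * (c / 2 * x) \<le> (e n)\<^sup>2 * (S n)\<^sup>2 / 2" by simp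
        qed (use s c x in auto)
        ultimately have "V n / ((e n)\<^sup>2 * (S n)\<^sup>2 / 2) powr s
            \<le> Cv * x powr (s / 2 + 2 * s * q + A + \<delta>) / (x powr (2 * \<rho> + \<delta>) * (c / 2 * x)) powr s"
          using V0[of n] x c by (intro frac_le) auto
        also have "\<dots> = Cv / (c / 2) powr s * x powr (s / 2 + 2 * s * q + A + \<delta> - s * (2 * \<rho> + \<delta>) - s)"
          
          by (rule trans[OF powr_quotient_variance[OF x(2)]]) (use c in \<open>simp_all add: algebra_simps\<close>)
        also have "\<dots> \<le> Cv / (c / 2) powr s * x powr (\<rho> + \<delta>)"
        proof (intro mult_left_mono mono)
          have "s / 2 + 2 * s * q + A + \<delta> - s * (2 * \<rho> + \<delta>) - s
            = - s / 2 + 2 * (s * q) + A + \<delta> - 2 * (s * \<rho>) - s * \<delta>" by (simp add: field_simps)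
          then show "s / 2 + 2 * s * q + A + \<delta> - s * (2 * \<rho> + \<delta>) - s \<le> \<rho> + \<delta>"
            using \<rho>' sd by linarith
        qed (use Cv in auto)
        finally show ?thesis .
      qed
      have t5: "(\<integral>x. \<bar>G n x\<bar> powr (2 * s) \<partial>N n) / (y n * S n) powr (2 * s) \<le> C powr (2 * s) / c powr s * x powr (\<rho> + \<delta>)"
      proof -
        have "(y n * S n) powr (2 * s) = y n powr (2 * s) * S n powr (2 * s)" using y S0 by (simp add: powr_mult)
        then have "(\<integral>x. \<bar>G n x\<bar> powr (2 * s) \<partial>N n) / (y n * S n) powr (2 * s)
           \<le> (C * x powr (q + \<delta> / 4)) powr (2 * s) / (y n powr (2 * s) * (c * x) powr s)"
          using G_mom[of n] Ss y x c unfolding x_def[symmetric] by (auto intro!: frac_le mult_left_mono)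
        also have "\<dots> = C powr (2 * s) / c powr s
            * x powr (2 * s * (q + \<delta> / 4) - 2 * s * (\<rho> + \<delta>) - s)"
          unfolding y_def x_def[symmetric] 
          by (rule trans[OF powr_quotient_boundary[OF x(2) C c]]) (simp add: algebra_simps)
        also have "\<dots> \<le> C powr (2 * s) / c powr s * x powr (\<rho> + \<delta>)"
        proof (intro mult_left_mono mono)
          have "2 * s * (q + \<delta> / 4) - 2 * s * (\<rho> + \<delta>) - s
              = 2 * (s * q) - 2 * (s * \<rho>) - s - 3 / 2 * (s * \<delta>)" by (simp add: field_simps)
          then show "2 * s * (q + \<delta> / 4) - 2 * s * (\<rho> + \<delta>) - s \<le> \<rho> + \<delta>"
            using \<rho>' sd A \<delta> s by linarith
        qed auto
        finally show ?thesis .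
      qed
      show ?case
      proof (rule kolmogorov_distance_le)
        fix t
        have "\<bar>measure (\<mu> \<omega>) {x \<in> space (\<mu> \<omega>). birkhoff_sum \<sigma> T \<phi> \<omega> n x \<le> t * S n} - normal_cdf t\<bar>
          \<le> 8193 * e n + 2 * y n + (1 - normal_cdf (y n / (2 * e n)))
            + 2 * ((\<Sum>j<n. \<integral>x. \<bar>H j x\<bar> powr (2 * s) \<partial>N j) / (S n powr (2 * s) * e n powr (4 * s)))
            + V n / ((e n)\<^sup>2 * (S n)\<^sup>2 / 2) powr s
            + (\<integral>x. \<bar>G n x\<bar> powr (2 * s) \<partial>N n) / (y n * S n) powr (2 * s)"
          using orbit_berry_esseen[OF s e y, of n t] S0 small unfolding S_def V_def by simp
        also have "\<dots> \<le> B * x powr (\<rho> + \<delta>)"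
          using t1 t2 t3 t4 t5 unfolding B_def y_def x_def[symmetric] distrib_right by linarith
        finally show "\<bar>measure (\<mu> \<omega>) {x \<in> space (\<mu> \<omega>).
            birkhoff_sum \<sigma> T \<phi> \<omega> n x \<le> t * Sigma_std \<sigma> T \<mu> \<phi> \<omega> n} - normal_cdf t\<bar> \<le> B * real n powr (\<rho> + \<delta>)"
          unfolding S_def x_def .
      qed
    qed
    then show ?thesis
      unfolding \<rho>_def[symmetric]
      by (intro bigoI[of _ B]) (auto elim!: eventually_mono simp: kolmogorov_distance_nonneg)
  qed
qed

end

section \<open>Almost sure growth along orbits and the conclusion\<close>

context transfer_orbit
begin

text \<open>The growth of the constants along the orbit enters \<open>G_n\<close> only through indices up to \<open>n\<close>, so it factors out of the
weighted sum.\<close>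

lemma polynomial_moment_bounds:
  fixes u \<alpha> D :: real and a :: "nat \<Rightarrow> real"
  assumes u: "1 \<le> u" and \<alpha>: "0 \<le> \<alpha>" and D: "0 \<le> D"
    and a: "\<And>m. 0 < a m" "summable (\<lambda>m. a (Suc m))"
    and decay: "\<And>j n. j < n \<Longrightarrow>
        Lp_norm (N n) u (Lit j (n - j) (f j)) \<le> D * real (Suc j) powr \<alpha> * a (n - j)"
    and obs: "\<And>n x. x \<in> space (N n) \<Longrightarrow> \<bar>f n x\<bar> \<le> D * real (Suc n) powr \<alpha>"
  obtains C where "0 < C"
    "\<And>n. (\<integral>x. \<bar>G n x\<bar> powr u \<partial>N n) \<le> (C * real n powr \<alpha>) powr u"
    "\<And>n. (\<integral>x. \<bar>H n x\<bar> powr u \<partial>N n) \<le> (C * real (Suc n) powr \<alpha>) powr u"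
proof -
  define A0 where "A0 = (\<Sum>m. a (Suc m))"
  define E where "E = D * (1 + A0) + 1"
  have A0: "0 \<le> A0" unfolding A0_def by (intro suminf_nonneg a less_imp_le)
  have E: "0 < E" "D \<le> E" "D * A0 \<le> E"
    using D A0 mult_nonneg_nonneg[OF D A0] unfolding E_def distrib_left by linarith+
  have Gb: "(\<integral>x. \<bar>G n x\<bar> powr u \<partial>N n) \<le> (E * real n powr \<alpha>) powr u" for n
  proof -
    have "(\<integral>x. \<bar>G n x\<bar> powr u \<partial>N n) \<le> (D * real n powr \<alpha> * (\<Sum>m<n. a (Suc m))) powr u"
    proof (rule G_moment_le[OF u _ a(1)])
      show "Lp_norm (N n) u (Lit j (n - j) (f j)) \<le> D * real n powr \<alpha> * a (n - j)" if "j < n" for j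
      proof -
        have "D * real (Suc j) powr \<alpha> * a (n - j) \<le> D * real n powr \<alpha> * a (n - j)"
          using that D \<alpha> a(1)[of "n - j"] by (intro mult_right_mono mult_left_mono powr_mono2) auto
        then show ?thesis using decay[OF that] by linarith
      qed
    qed (use D in auto)
    also have "\<dots> \<le> (E * real n powr \<alpha>) powr u"
    proof (rule powr_mono2)
      have "(\<Sum>m<n. a (Suc m)) \<le> A0" unfolding A0_def
        by (rule sum_le_suminf[OF a(2)]) (use a(1) in \<open>auto intro: less_imp_le\<close>)
      then have "D * real n powr \<alpha> * (\<Sum>m<n. a (Suc m)) \<le> D * real n powr \<alpha> * A0"
        using D by (intro mult_left_mono) auto
      also have "\<dots> = D * A0 * real n powr \<alpha>" by simp
      also have "\<dots> \<le> E * real n powr \<alpha>" by (intro mult_right_mono E) auto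
      finally show "D * real n powr \<alpha> * (\<Sum>m<n. a (Suc m)) \<le> E * real n powr \<alpha>" .
      show "0 \<le> D * real n powr \<alpha> * (\<Sum>m<n. a (Suc m))"
        using D a(1) by (intro mult_nonneg_nonneg sum_nonneg) (auto intro: less_imp_le)
    qed (use u in auto)
    finally show ?thesis .
  qed
  have Hb: "(\<integral>x. \<bar>H n x\<bar> powr u \<partial>N n) \<le> (9 * E * real (Suc n) powr \<alpha>) powr u" for n
  proof -
    define X where "X = (E * real (Suc n) powr \<alpha>) powr u"
    have "(\<integral>x. \<bar>f n x\<bar> powr u \<partial>N n) \<le> X"
    proof -
      interpret prob_space "N n" by (rule fibre_prob)
      have "(\<integral>x. \<bar>f n x\<bar> powr u \<partial>N n) \<le> (\<integral>x. X \<partial>N n)"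
      proof (rule integral_mono)
        fix x assume "x \<in> space (N n)"
        then have "\<bar>f n x\<bar> \<le> D * real (Suc n) powr \<alpha>" by (rule obs)
        also have "\<dots> \<le> E * real (Suc n) powr \<alpha>" by (intro mult_right_mono E) auto
        finally show "\<bar>f n x\<bar> powr u \<le> X" unfolding X_def using u by (intro powr_mono2) auto
      qed (use u in \<open>auto intro!: bdd_measurable_integrable bdd_measurable_powr fibre_obs\<close>)
      then show ?thesis by (simp add: prob_space)
    qed
    moreover have "(\<integral>x. \<bar>G n x\<bar> powr u \<partial>N n) \<le> X"
    proof -
      have "(E * real n powr \<alpha>) powr u \<le> X"
        unfolding X_def using u E \<alpha> by (intro powr_mono2[of u] mult_left_mono powr_mono2[of \<alpha>]) auto
      then show ?thesis using Gb[of n] by linarith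
    qed
    moreover have "(\<integral>x. \<bar>G (Suc n) x\<bar> powr u \<partial>N (Suc n)) \<le> X" using Gb[of "Suc n"] unfolding X_def .
    ultimately have "(\<integral>x. \<bar>f n x\<bar> powr u \<partial>N n) + (\<integral>x. \<bar>G n x\<bar> powr u \<partial>N n)
        + (\<integral>x. \<bar>G (Suc n) x\<bar> powr u \<partial>N (Suc n)) \<le> 3 * X" by linarith
    then have "3 powr u * ((\<integral>x. \<bar>f n x\<bar> powr u \<partial>N n) + (\<integral>x. \<bar>G n x\<bar> powr u \<partial>N n)
        + (\<integral>x. \<bar>G (Suc n) x\<bar> powr u \<partial>N (Suc n))) \<le> 3 powr u * (3 * X)"
      by (intro mult_left_mono) auto
    then have "(\<integral>x. \<bar>H n x\<bar> powr u \<partial>N n) \<le> 3 powr u * (3 * X)"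
      using H_moment_le[of u n] u by linarith
    also have "\<dots> \<le> 3 powr u * (3 powr u * X)"
    proof (intro mult_left_mono mult_right_mono)
      show "3 \<le> (3::real) powr u" using powr_mono[OF u, of 3] by simp
    qed (auto simp: X_def)
    also have "\<dots> = (9 * E * real (Suc n) powr \<alpha>) powr u"
    proof -
      have "(9 * E * real (Suc n) powr \<alpha>) powr u = (3 * (3 * (E * real (Suc n) powr \<alpha>))) powr u"
        by (simp add: mult.assoc)
      also have "\<dots> = 3 powr u * (3 powr u * X)" unfolding X_def using E by (simp only: powr_mult)
      finally show ?thesis by simp
    qed
    finally show ?thesis .
  qed
  show ?thesis
  proof (rule that[of "9 * E"])
    show "(\<integral>x. \<bar>G n x\<bar> powr u \<partial>N n) \<le> (9 * E * real n powr \<alpha>) powr u" for n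
    proof -
      have "(E * real n powr \<alpha>) powr u \<le> (9 * E * real n powr \<alpha>) powr u"
        using E u by (intro powr_mono2 mult_right_mono) auto
      then show ?thesis using Gb[of n] by linarith
    qed
  qed (use E Hb in auto)
qed

end

lemma funpow_measure_preserving:
  assumes s: "\<sigma> \<in> measurable P P" and d: "distr P P \<sigma> = P"
  shows "(\<sigma> ^^ k) \<in> measurable P P" "distr P P (\<sigma> ^^ k) = P"
proof -
  have "(\<sigma> ^^ k) \<in> measurable P P \<and> distr P P (\<sigma> ^^ k) = P"
  proof (induction k)
    case 0
    have "distr P P (\<lambda>x. x) = P" by (rule distr_id2) simp
    then show ?case by (simp add: id_def)
  next
    case (Suc k)
    then have m: "(\<sigma> ^^ k) \<in> measurable P P" by simp
    have "distr P P (\<sigma> \<circ> (\<sigma> ^^ k)) = distr (distr P P (\<sigma> ^^ k)) P \<sigma>"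
      by (rule distr_distr[symmetric, OF s m])
    also have "\<dots> = P" using Suc d by simp
    finally show ?case unfolding funpow.simps(2) using measurable_comp[OF m s] by blast
  qed
  then show "(\<sigma> ^^ k) \<in> measurable P P" "distr P P (\<sigma> ^^ k) = P" by auto
qed

lemma AE_along_orbit:
  assumes s: "\<sigma> \<in> measurable P P" and d: "distr P P \<sigma> = P" and Q: "AE \<omega> in P. Q \<omega>"
  shows "AE \<omega> in P. \<forall>k. Q ((\<sigma> ^^ k) \<omega>)"
  unfolding AE_all_countable
proof
  fix k
  note m = funpow_measure_preserving[OF s d, of k]
  have "AE \<omega> in distr P P (\<sigma> ^^ k). Q \<omega>" unfolding m(2) by (rule Q)
  then show "AE \<omega> in P. Q ((\<sigma> ^^ k) \<omega>)" by (rule AE_distrD[OF m(1)])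
qed

text \<open>Integrate \<open>\<Sum>k. \<bar>X \<circ> \<sigma>^k\<bar>^p (k+1)^{-1-\<epsilon>p}\<close>: by invariance its integral is finite, hence so is the series almost surely, and
every term is bounded by its sum.\<close>

lemma orbit_growth:
  assumes s: "\<sigma> \<in> measurable P P" and d: "distr P P \<sigma> = P"
    and X: "in_Lp P p X" and p: "0 < p" and \<epsilon>: "0 < \<epsilon>"
  shows "AE \<omega> in P. \<exists>C\<ge>0. \<forall>k. \<bar>X ((\<sigma> ^^ k) \<omega>)\<bar> \<le> C * real (Suc k) powr (1 / p + \<epsilon>)"
proof -
  obtain h where h[measurable]: "h \<in> borel_measurable P" and Xh: "AE \<omega> in P. X \<omega> = h \<omega>"
    and int: "integrable P (\<lambda>x. \<bar>h x\<bar> powr p)"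
    using X unfolding in_Lp_def by blast
  define w where "w = (\<lambda>k. real (Suc k) powr (- (1 + \<epsilon> * p)))"
  have w: "summable w"
  proof -
    have "summable (\<lambda>n. real n powr (- (1 + \<epsilon> * p)))"
      unfolding summable_real_powr_iff using \<epsilon> p by simp
    then show ?thesis unfolding w_def by (subst summable_Suc_iff)
  qed
  have mk[measurable]: "(\<sigma> ^^ k) \<in> measurable P P" for k by (rule funpow_measure_preserving[OF s d])
  have shift: "(\<integral>\<^sup>+\<omega>. ennreal (\<bar>h ((\<sigma> ^^ k) \<omega>)\<bar> powr p) \<partial>P) = (\<integral>\<^sup>+\<omega>. ennreal (\<bar>h \<omega>\<bar> powr p) \<partial>P)" for k
    using nn_integral_distr[OF mk[of k], of "\<lambda>\<omega>. ennreal (\<bar>h \<omega>\<bar> powr p)"]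
    unfolding funpow_measure_preserving(2)[OF s d] by simp
  have fin: "(\<integral>\<^sup>+\<omega>. ennreal (\<bar>h \<omega>\<bar> powr p) \<partial>P) < \<infinity>"
    using int by (subst nn_integral_eq_integral) auto
  have "(\<integral>\<^sup>+\<omega>. (\<Sum>k. ennreal (w k) * ennreal (\<bar>h ((\<sigma> ^^ k) \<omega>)\<bar> powr p)) \<partial>P)
      = (\<Sum>k. \<integral>\<^sup>+\<omega>. ennreal (w k) * ennreal (\<bar>h ((\<sigma> ^^ k) \<omega>)\<bar> powr p) \<partial>P)"
    by (rule nn_integral_suminf) measurable
  also have "\<dots> = (\<Sum>k. ennreal (w k) * (\<integral>\<^sup>+\<omega>. ennreal (\<bar>h \<omega>\<bar> powr p) \<partial>P))"
    by (subst nn_integral_cmult) (auto simp: shift)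
  also have "\<dots> = (\<Sum>k. ennreal (w k)) * (\<integral>\<^sup>+\<omega>. ennreal (\<bar>h \<omega>\<bar> powr p) \<partial>P)"
    by (rule ennreal_suminf_multc)
  also have "(\<Sum>k. ennreal (w k)) = ennreal (\<Sum>k. w k)"
    by (rule suminf_ennreal2[OF _ w]) (simp add: w_def)
  finally have "(\<integral>\<^sup>+\<omega>. (\<Sum>k. ennreal (w k) * ennreal (\<bar>h ((\<sigma> ^^ k) \<omega>)\<bar> powr p)) \<partial>P) \<noteq> \<infinity>"
    using fin by (simp add: ennreal_mult_eq_top_iff)
  then have "AE \<omega> in P. (\<Sum>k. ennreal (w k) * ennreal (\<bar>h ((\<sigma> ^^ k) \<omega>)\<bar> powr p)) \<noteq> \<infinity>"
    by (intro nn_integral_PInf_AE) measurable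
  moreover have "AE \<omega> in P. \<forall>k. X ((\<sigma> ^^ k) \<omega>) = h ((\<sigma> ^^ k) \<omega>)" by (rule AE_along_orbit[OF s d Xh])
  ultimately show ?thesis
  proof eventually_elim
    case (elim \<omega>)
    define Y where "Y = enn2real (\<Sum>k. ennreal (w k) * ennreal (\<bar>h ((\<sigma> ^^ k) \<omega>)\<bar> powr p))"
    have "w k * \<bar>h ((\<sigma> ^^ k) \<omega>)\<bar> powr p \<le> Y" for k
    proof -
      have "ennreal (w k * \<bar>h ((\<sigma> ^^ k) \<omega>)\<bar> powr p) \<le> (\<Sum>k. ennreal (w k) * ennreal (\<bar>h ((\<sigma> ^^ k) \<omega>)\<bar> powr p))"
        using sum_le_suminf[of "\<lambda>k. ennreal (w k) * ennreal (\<bar>h ((\<sigma> ^^ k) \<omega>)\<bar> powr p)" "{k}"]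
        by (simp add: ennreal_mult w_def)
      also have "\<dots> = ennreal Y" unfolding Y_def using elim(1) by (simp add: less_top)
      finally show ?thesis by (subst (asm) ennreal_le_iff) (auto simp: Y_def)
    qed
    then have le: "\<bar>h ((\<sigma> ^^ k) \<omega>)\<bar> powr p \<le> Y * real (Suc k) powr (1 + \<epsilon> * p)" for k
      unfolding w_def powr_minus by (simp add: field_simps)
    have "\<bar>h ((\<sigma> ^^ k) \<omega>)\<bar> \<le> Y powr (1 / p) * real (Suc k) powr (1 / p + \<epsilon>)" for k
    proof -
      have "\<bar>h ((\<sigma> ^^ k) \<omega>)\<bar> = (\<bar>h ((\<sigma> ^^ k) \<omega>)\<bar> powr p) powr (1 / p)" using p by (simp add: powr_powr)
      also have "\<dots> \<le> (Y * real (Suc k) powr (1 + \<epsilon> * p)) powr (1 / p)"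
        using p le[of k] by (intro powr_mono2) auto
      also have "\<dots> = Y powr (1 / p) * real (Suc k) powr ((1 + \<epsilon> * p) / p)"
        by (simp add: powr_mult powr_powr Y_def)
      also have "(1 + \<epsilon> * p) / p = 1 / p + \<epsilon>" using p by (simp add: field_simps)
      finally show ?thesis .
    qed
    then show ?case using elim(2) by (intro exI[of _ "Y powr (1 / p)"]) auto
  qed
qed

text \<open>One null set for all \<open>\<epsilon>\<close>: the bound weakens as \<open>\<epsilon>\<close> grows, so the values \<open>1 / (m + 1)\<close> are enough.\<close>

lemma orbit_growth_all:
  assumes s: "\<sigma> \<in> measurable P P" and d: "distr P P \<sigma> = P"
    and X: "in_Lp P p X" and p: "0 < p"
  shows "AE \<omega> in P. \<forall>\<epsilon>>0. \<exists>C\<ge>0. \<forall>k. \<bar>X ((\<sigma> ^^ k) \<omega>)\<bar> \<le> C * real (Suc k) powr (1 / p + \<epsilon>)"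
proof -
  have "AE \<omega> in P. \<forall>m. \<exists>C\<ge>0. \<forall>k. \<bar>X ((\<sigma> ^^ k) \<omega>)\<bar> \<le> C * real (Suc k) powr (1 / p + 1 / real (Suc m))"
    unfolding AE_all_countable by (intro allI orbit_growth[OF s d X p]) simp
  then show ?thesis
  proof eventually_elim
    case (elim \<omega>)
    show ?case
    proof (intro allI impI)
      fix \<epsilon> :: real assume "0 < \<epsilon>"
      then obtain m where m: "inverse (real (Suc m)) < \<epsilon>" using reals_Archimedean by blast
      from elim obtain C where C: "0 \<le> C"
        "\<And>k. \<bar>X ((\<sigma> ^^ k) \<omega>)\<bar> \<le> C * real (Suc k) powr (1 / p + 1 / real (Suc m))" by blast
      have "C * real (Suc k) powr (1 / p + 1 / real (Suc m)) \<le> C * real (Suc k) powr (1 / p + \<epsilon>)" for k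
        using C(1) m by (intro mult_left_mono powr_mono) (auto simp: inverse_eq_divide)
      then show "\<exists>C\<ge>0. \<forall>k. \<bar>X ((\<sigma> ^^ k) \<omega>)\<bar> \<le> C * real (Suc k) powr (1 / p + \<epsilon>)"
        using C by (meson order_trans)
    qed
  qed
qed

lemma lipschitz_fun_const: "lipschitz_fun S (\<lambda>x. c)"
  unfolding lipschitz_fun_def using lipschitz_on_constant by (auto simp: image_constant_conv)

lemma lip_norm_const:
  assumes "S \<noteq> {}" shows "lip_norm S (\<lambda>x. c) = \<bar>c\<bar>"
proof -
  have "(\<lambda>z. case z of (x, y) \<Rightarrow> \<bar>c - c\<bar> / dist x y) = (\<lambda>z::'a \<times> 'a. 0)" by auto
  then show ?thesis unfolding lip_norm_def using assms by simp
qed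

lemma abs_le_lip_norm:
  assumes g: "lipschitz_fun S g" and x: "x \<in> S"
  shows "\<bar>g x\<bar> \<le> lip_norm S g"
proof -
  from g obtain B where B: "\<And>x. x \<in> S \<Longrightarrow> \<bar>g x\<bar> \<le> B"
    unfolding lipschitz_fun_def bounded_iff by auto
  from g obtain C where C: "C-lipschitz_on S g" unfolding lipschitz_fun_def by auto
  have "\<bar>g x\<bar> \<le> (SUP x\<in>S. \<bar>g x\<bar>)" using B by (intro cSUP_upper x bdd_aboveI2) auto
  moreover have "0 \<le> (SUP (x, y)\<in>S \<times> S. \<bar>g x - g y\<bar> / dist x y)"
  proof (rule cSUP_upper2)
    show "(x, x) \<in> S \<times> S" using x by simp
    show "bdd_above ((\<lambda>(x, y). \<bar>g x - g y\<bar> / dist x y) ` (S \<times> S))"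
    proof (rule bdd_aboveI2[where M = C], clarify)
      fix a b assume ab: "a \<in> S" "b \<in> S"
      have "\<bar>g a - g b\<bar> \<le> C * dist a b" using lipschitz_onD[OF C ab] by (simp add: dist_real_def)
      then show "\<bar>g a - g b\<bar> / dist a b \<le> C"
        using lipschitz_on_nonneg[OF C] by (cases "a = b") (auto simp: divide_le_eq)
    qed
  qed simp
  ultimately show ?thesis unfolding lip_norm_def by linarith
qed

context fibred_system
begin

lemma base_measurable: "\<sigma> \<in> measurable P P" and base_distr: "distr P P \<sigma> = P"
  using base unfolding ergodic_pps_def by auto

lemma space_fibre: "\<omega> \<in> space P \<Longrightarrow> space (\<mu> \<omega>) = M \<omega>"
  using sets_eq_imp_space_eq[OF mu_sets] by (simp add: space_restrict_space)

lemma fibre_nonempty: "\<omega> \<in> space P \<Longrightarrow> M \<omega> \<noteq> {}"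
  using prob_space.not_empty[OF mu_prob] space_fibre by auto

lemma orbit_in_space: "\<omega> \<in> space P \<Longrightarrow> (\<sigma> ^^ k) \<omega> \<in> space P"
  by (rule measurable_space[OF funpow_measure_preserving(1)[OF base_measurable base_distr]])

lemma section_measurable:
  assumes g: "(\<lambda>(\<omega>, x). g \<omega> x) \<in> measurable (restrict_space (P \<Otimes>\<^sub>M borel) (Sigma (space P) M)) N"
    and \<omega>: "\<omega> \<in> space P"
  shows "g \<omega> \<in> measurable (\<mu> \<omega>) N"
proof -
  have "Pair \<omega> \<in> measurable (restrict_space borel (M \<omega>)) (restrict_space (P \<Otimes>\<^sub>M borel) (Sigma (space P) M))"
  proof (rule measurable_restrict_space2)
    show "Pair \<omega> \<in> space (restrict_space borel (M \<omega>)) \<rightarrow> Sigma (space P) M"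
      using \<omega> by (auto simp: space_restrict_space)
    show "Pair \<omega> \<in> measurable (restrict_space borel (M \<omega>)) (P \<Otimes>\<^sub>M borel)"
      by (rule measurable_restrict_space1) (rule measurable_Pair1'[OF \<omega>])
  qed
  from measurable_compose[OF this g] have "g \<omega> \<in> measurable (restrict_space borel (M \<omega>)) N" by simp
  then show ?thesis by (subst measurable_cong_sets[OF mu_sets[OF \<omega>] refl])
qed

lemma fibre_map_measurable:
  assumes \<omega>: "\<omega> \<in> space P" shows "T \<omega> \<in> measurable (\<mu> \<omega>) (\<mu> (\<sigma> \<omega>))"
proof -
  have s\<omega>: "\<sigma> \<omega> \<in> space P" using orbit_in_space[OF \<omega>, of 1] by simp
  have "T \<omega> \<in> measurable (\<mu> \<omega>) (restrict_space borel (M (\<sigma> \<omega>)))"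
    by (rule measurable_restrict_space2[OF _ section_measurable[OF T_measurable \<omega>]])
       (use T_maps[OF \<omega>] space_fibre[OF \<omega>] in auto)
  then show ?thesis by (subst measurable_cong_sets[OF refl mu_sets[OF s\<omega>]])
qed

lemma AE_transfer_orbit:
  assumes phi: "(\<lambda>(\<omega>, x). \<phi> \<omega> x)
      \<in> borel_measurable (restrict_space (P \<Otimes>\<^sub>M borel) (Sigma (space P) M))"
    and mean: "AE \<omega> in P. (\<integral>x. \<phi> \<omega> x \<partial>\<mu> \<omega>) = 0"
    and lip: "AE \<omega> in P. lipschitz_fun (M \<omega>) (\<phi> \<omega>)"
  shows "AE \<omega> in P. transfer_orbit \<sigma> T \<mu> L \<phi> \<omega>"
  using AE_space AE_along_orbit[OF base_measurable base_distr mu_equivariant]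
    AE_along_orbit[OF base_measurable base_distr L_transfer]
    AE_along_orbit[OF base_measurable base_distr mean]
    AE_along_orbit[OF base_measurable base_distr lip]
proof eventually_elim
  case (elim \<omega>)
  note sp = orbit_in_space[OF elim(1)]
  show ?case
  proof (rule transfer_orbit.intro)
    fix k
    show "prob_space (\<mu> ((\<sigma> ^^ k) \<omega>))" by (rule mu_prob[OF sp])
    show "T ((\<sigma> ^^ k) \<omega>) \<in> measurable (\<mu> ((\<sigma> ^^ k) \<omega>)) (\<mu> ((\<sigma> ^^ Suc k) \<omega>))"
      using fibre_map_measurable[OF sp] by simp
    show "distr (\<mu> ((\<sigma> ^^ k) \<omega>)) (\<mu> ((\<sigma> ^^ Suc k) \<omega>)) (T ((\<sigma> ^^ k) \<omega>)) = \<mu> ((\<sigma> ^^ Suc k) \<omega>)"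
      using elim(2) by simp
    show "is_transfer_operator (\<mu> ((\<sigma> ^^ k) \<omega>)) (\<mu> ((\<sigma> ^^ Suc k) \<omega>)) (T ((\<sigma> ^^ k) \<omega>)) (L ((\<sigma> ^^ k) \<omega>))"
      using elim(3) by simp
    show "bdd_measurable (\<mu> ((\<sigma> ^^ k) \<omega>)) (\<phi> ((\<sigma> ^^ k) \<omega>))"
      using section_measurable[OF phi sp] elim(5)
      unfolding bdd_measurable_def lipschitz_fun_def space_fibre[OF sp] by auto
    show "(\<integral>x. \<phi> ((\<sigma> ^^ k) \<omega>) x \<partial>\<mu> ((\<sigma> ^^ k) \<omega>)) = 0" using elim(4) by simp
  qed
qed

end

theorem proposition18:
  fixes P :: "'w measure"
    and \<sigma> :: "'w \<Rightarrow> 'w"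
    and M :: "'w \<Rightarrow> 'm::metric_space set"
    and T :: "'w \<Rightarrow> 'm \<Rightarrow> 'm"
    and \<mu> :: "'w \<Rightarrow> 'm measure"
    and L :: "'w \<Rightarrow> ('m \<Rightarrow> real) \<Rightarrow> 'm \<Rightarrow> real"
    and \<phi> :: "'w \<Rightarrow> 'm \<Rightarrow> real"
    and a :: "real \<Rightarrow> nat \<Rightarrow> real"
    and r s p A :: real
  assumes system: "fibred_system P \<sigma> M T \<mu> L"
    and phi_measurable: "(\<lambda>(\<omega>, x). \<phi> \<omega> x)
      \<in> borel_measurable (restrict_space (P \<Otimes>\<^sub>M borel) (Sigma (space P) M))"
    and phi_mean: "AE \<omega> in P. (\<integral>x. \<phi> \<omega> x \<partial>\<mu> \<omega>) = 0"
    and phi_lipschitz: "AE \<omega> in P. lipschitz_fun (M \<omega>) (\<phi> \<omega>)"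
    and r_pos: "0 < r"
    and phi_norm: "in_Lp P r (\<lambda>\<omega>. lip_norm (M \<omega>) (\<phi> \<omega>))"
    and s_ge: "2 * s \<ge> 2"
    and decay: "decay_condition P \<sigma> M \<mu> L {2 * s} p a"
    and a_summable: "summable (\<lambda>n. a (2 * s) (Suc n))"
    and A_ge: "A \<ge> 1"
    and quadratic: "AE \<omega> in P. \<forall>\<delta>>0.
      (\<lambda>n. (Lp_norm (\<mu> \<omega>) s (\<lambda>x.
              (\<Sum>j<n. (H_fun \<sigma> T L \<phi> \<omega> j (T_iter \<sigma> T \<omega> j x))\<^sup>2)
            - (\<Sum>j<n. \<integral>y. (H_fun \<sigma> T L \<phi> \<omega> j y)\<^sup>2 \<partial>\<mu> ((\<sigma> ^^ j) \<omega>)))) powr s)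
      \<in> O(\<lambda>n. real n powr (s / 2 + 2 * s / p + 2 * s / r + A + \<delta>))"
    and nondegenerate: "AE \<omega> in P. \<exists>c>0. \<forall>\<^sub>F n in sequentially.
      c * real n \<le> (Sigma_std \<sigma> T \<mu> \<phi> \<omega> n)\<^sup>2"
  shows "AE \<omega> in P. \<forall>\<delta>>0.
      (\<lambda>n. SUP t. \<bar>measure (\<mu> \<omega>) {x \<in> M \<omega>. birkhoff_sum \<sigma> T \<phi> \<omega> n x \<le> t * Sigma_std \<sigma> T \<mu> \<phi> \<omega> n}
                  - cdf std_normal_distribution t\<bar>)
      \<in> O(\<lambda>n. real n powr (- s / (2 * (2 * s + 1)) + 2 * s / (p * (2 * s + 1))
                + 2 * s / (r * (2 * s + 1)) + A / (2 * s + 1) + \<delta>))"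
proof -
  interpret fibred_system P \<sigma> M T \<mu> L by (rule system)
  note orb = AE_along_orbit[OF base_measurable base_distr]
  from decay obtain K where p: "0 < p" and apos: "\<And>n. 0 < a (2 * s) n" and K: "in_Lp P p K"
    and dec: "AE \<omega> in P. \<forall>r' i j. r' \<le> i \<longrightarrow> i \<le> j \<longrightarrow>
         (\<forall>g1 g2. lipschitz_fun (M ((\<sigma> ^^ r') \<omega>)) g1 \<longrightarrow> lipschitz_fun (M ((\<sigma> ^^ i) \<omega>)) g2 \<longrightarrow>
           Lp_norm (\<mu> ((\<sigma> ^^ j) \<omega>)) (2 * s)
             (centered (\<mu> ((\<sigma> ^^ j) \<omega>))
               (L_iter \<sigma> L ((\<sigma> ^^ i) \<omega>) (j - i)
                 (\<lambda>x. g2 x * L_iter \<sigma> L ((\<sigma> ^^ r') \<omega>) (i - r') g1 x)))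
           \<le> K ((\<sigma> ^^ i) \<omega>) * a (2 * s) (j - i)
               * (1 + lip_norm (M ((\<sigma> ^^ r') \<omega>)) g1) * (1 + lip_norm (M ((\<sigma> ^^ i) \<omega>)) g2))"
    unfolding decay_condition_def by auto
  have s: "1 \<le> s" using s_ge by simp
  define q where "q = 1 / p + 1 / r"
  have q: "0 < q" unfolding q_def using p r_pos by (simp add: add_pos_pos)
  show ?thesis
    using AE_space AE_transfer_orbit[OF phi_measurable phi_mean phi_lipschitz] dec orb[OF phi_lipschitz]
      orbit_growth_all[OF base_measurable base_distr K p]
      orbit_growth_all[OF base_measurable base_distr phi_norm r_pos] quadratic nondegenerate
  proof eventually_elim
    case (elim \<omega>)
    note dec = elim(3) and lip = elim(4)
    interpret transfer_orbit \<sigma> T \<mu> L \<phi> \<omega> by (rule elim(2))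
    note sp = orbit_in_space[OF elim(1)]
    obtain c where c: "0 < c" "\<forall>\<^sub>F n in sequentially. c * real n \<le> (Sigma_std \<sigma> T \<mu> \<phi> \<omega> n)\<^sup>2"
      using elim(8) by blast
    show ?case
    proof (intro allI impI)
      fix \<delta> :: real assume \<delta>: "0 < \<delta>"
      then have "0 < \<delta> / 8" by simp
      with elim(5,6) obtain C1 C2 where
        C1: "0 \<le> C1" "\<And>k. \<bar>K ((\<sigma> ^^ k) \<omega>)\<bar> \<le> C1 * real (Suc k) powr (1 / p + \<delta> / 8)" and
        C2: "0 \<le> C2" "\<And>k. \<bar>lip_norm (M ((\<sigma> ^^ k) \<omega>)) (f k)\<bar> \<le> C2 * real (Suc k) powr (1 / r + \<delta> / 8)"
        by meson
      \<comment> \<open>The factor 2 is 1 plus the Lipschitz norm of the constant function 1.\<close>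
      define D where "D = 2 * C1 * (1 + C2) + C2"
      have D: "0 \<le> D" "2 * C1 * (1 + C2) \<le> D" "C2 \<le> D" unfolding D_def using C1 C2 by auto
      have obs: "\<bar>f n x\<bar> \<le> D * real (Suc n) powr (q + \<delta> / 4)" if "x \<in> space (N n)" for n x
      proof -
        have "\<bar>f n x\<bar> \<le> lip_norm (M ((\<sigma> ^^ n) \<omega>)) (f n)"
          by (rule abs_le_lip_norm) (use lip that space_fibre[OF sp] in auto)
        also have "\<dots> \<le> C2 * real (Suc n) powr (1 / r + \<delta> / 8)" using C2(2)[of n] by linarith
        also have "\<dots> \<le> D * real (Suc n) powr (q + \<delta> / 4)"
          using D C2(1) p \<delta> unfolding q_def by (intro mult_mono powr_mono) auto
        finally show ?thesis .
      qed
      \<comment> \<open>The decay condition with r' = i = j and first function 1: the inner transfer operator is then the identity, and centring changes nothing since \<phi> has mean zero.\<close>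
      have decay': "Lp_norm (N n) (2 * s) (Lit j (n - j) (f j))
          \<le> D * real (Suc j) powr (q + \<delta> / 4) * a (2 * s) (n - j)" if jn: "j < n" for j n
      proof -
        define x where "x = real (Suc j)"
        have x: "1 \<le> x" unfolding x_def by simp
        define l where "l = lip_norm (M ((\<sigma> ^^ j) \<omega>)) (f j)"
        have l0: "0 \<le> l"
          using abs_le_lip_norm[of "M ((\<sigma> ^^ j) \<omega>)" "f j"] lip fibre_nonempty[OF sp[of j]]
          unfolding l_def by (meson abs_ge_zero all_not_in_conv order_trans)
        have "centered (N n) (Lit j (n - j) (f j)) = Lit j (n - j) (f j)"
          unfolding centered_def using integral_Lit_obs[of j n] jn by simp
        then have "Lp_norm (N n) (2 * s) (Lit j (n - j) (f j))
            \<le> K ((\<sigma> ^^ j) \<omega>) * a (2 * s) (n - j) * (1 + lip_norm (M ((\<sigma> ^^ j) \<omega>)) (\<lambda>x. 1)) * (1 + l)"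
          using dec[rule_format, of j j n "\<lambda>x. 1" "f j"] jn lip unfolding l_def by (simp add: lipschitz_fun_const)
        also have "\<dots> = K ((\<sigma> ^^ j) \<omega>) * (2 * a (2 * s) (n - j) * (1 + l))"
          unfolding lip_norm_const[OF fibre_nonempty[OF sp]] by simp
        also have "\<dots> \<le> (C1 * x powr (1 / p + \<delta> / 8)) * (2 * a (2 * s) (n - j) * (1 + l))"
          using C1(2)[of j] apos[of "n - j"] l0 unfolding x_def by (intro mult_right_mono) auto
        also have "\<dots> \<le> (C1 * x powr (1 / p + \<delta> / 8)) * (2 * a (2 * s) (n - j) * ((1 + C2) * x powr (1 / r + \<delta> / 8)))"
        proof (intro mult_left_mono)
          have "1 \<le> x powr (1 / r + \<delta> / 8)" using x r_pos \<delta> by (intro ge_one_powr_ge_zero) auto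
          then show "1 + l \<le> (1 + C2) * x powr (1 / r + \<delta> / 8)"
            using C2(2)[of j] unfolding l_def x_def distrib_right by linarith
        qed (use C1 apos[of "n - j"] in auto)
        also have "\<dots> = 2 * C1 * (1 + C2) * x powr (q + \<delta> / 4) * a (2 * s) (n - j)"
        proof -
          have "x powr (q + \<delta> / 4) = x powr (1 / p + \<delta> / 8) * x powr (1 / r + \<delta> / 8)"
            unfolding q_def powr_add[symmetric] by (simp add: ac_simps)
          then show ?thesis by simp
        qed
        also have "\<dots> \<le> D * x powr (q + \<delta> / 4) * a (2 * s) (n - j)"
          using apos[of "n - j"] by (intro mult_right_mono D) auto
        finally show ?thesis unfolding x_def .
      qed
      obtain C where C: "0 < C"
        "\<And>n. (\<integral>x. \<bar>G n x\<bar> powr (2 * s) \<partial>N n) \<le> (C * real n powr (q + \<delta> / 4)) powr (2 * s)"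
        "\<And>n. (\<integral>x. \<bar>H n x\<bar> powr (2 * s) \<partial>N n) \<le> (C * real (Suc n) powr (q + \<delta> / 4)) powr (2 * s)"
        by (rule polynomial_moment_bounds[of "2 * s" "q + \<delta> / 4" D "a (2 * s)"])
           (use s q \<delta> D(1) apos a_summable decay' obs in auto)
      have e1: "s / 2 + 2 * s / p + 2 * s / r + A + \<delta> = s / 2 + 2 * s * q + A + \<delta>"
        unfolding q_def by (simp add: algebra_simps)
      have e2: "- s / (2 * (2 * s + 1)) + 2 * s / (p * (2 * s + 1)) + 2 * s / (r * (2 * s + 1)) + A / (2 * s + 1) + \<delta>
          = (- s / 2 + 2 * s * q + A) / (2 * s + 1) + \<delta>"
      proof -
        define d where "d = 2 * s + 1"
        show ?thesis unfolding d_def[symmetric] q_def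
          by (simp add: distrib_left add_divide_distrib diff_divide_distrib)
      qed
      have V: "(\<lambda>n. (Lp_norm (\<mu> \<omega>) s (\<lambda>x. (\<Sum>j<n. (H j (Tit j x))\<^sup>2) - (\<Sum>j<n. \<integral>y. (H j y)\<^sup>2 \<partial>N j))) powr s)
        = (\<lambda>n. \<integral>x. \<bar>(\<Sum>j<n. (H j (Tit j x))\<^sup>2) - (\<Sum>j<n. \<integral>y. (H j y)\<^sup>2 \<partial>N j)\<bar> powr s \<partial>\<mu> \<omega>)"
        unfolding Lp_norm_def using s by (simp add: powr_powr integral_nonneg_AE)
      have "(\<lambda>n. \<integral>x. \<bar>(\<Sum>j<n. (H j (Tit j x))\<^sup>2) - (\<Sum>j<n. \<integral>y. (H j y)\<^sup>2 \<partial>N j)\<bar> powr s \<partial>\<mu> \<omega>)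
        \<in> O(\<lambda>n. real n powr (s / 2 + 2 * s * q + A + \<delta>))"
        unfolding e1[symmetric] V[symmetric] by (rule elim(7)[rule_format, OF \<delta>])
      from orbit_rate[OF s q A_ge \<delta> C(1) c(1) C(2,3) this c(2)]
      show "(\<lambda>n. SUP t. \<bar>measure (\<mu> \<omega>) {x \<in> M \<omega>. birkhoff_sum \<sigma> T \<phi> \<omega> n x \<le> t * Sigma_std \<sigma> T \<mu> \<phi> \<omega> n}
                  - cdf std_normal_distribution t\<bar>)
        \<in> O(\<lambda>n. real n powr (- s / (2 * (2 * s + 1)) + 2 * s / (p * (2 * s + 1))
                + 2 * s / (r * (2 * s + 1)) + A / (2 * s + 1) + \<delta>))"
        unfolding e2 kolmogorov_distance_def[abs_def] space_fibre[OF elim(1)] .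
    qed
  qed
qed

end
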